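(* Consider the i.i.d. model and let $\widetilde\lambda_1^n\le\cdots\le\widetilde\lambda_n^n$ be the eigenvalues of $X_n+\sum_{i=1}^r\theta_iu_i^nu_i^{n*}$. Let $p_-$ (resp. $p_+$) be the number of indices $i$ such that $\rho_{\theta_i}<a$ (resp. $\rho_{\theta_i}>b$). Assume Assumptions (A1) and (A3), Hypothesis (H1), and that conditions (C1),(C2) of Hypothesis (H3)$[p,\alpha,a]$ and conditions (C1'),(C2') of Hypothesis (H3)$[q,\alpha,b]$ hold for some $\alpha\in(0,1)$ and positive integers $p,q$. Then for all $\alpha'>\alpha$, for every fixed $1\le i\le p-(p_-+r)$ and every fixed $0\le j<q-(p_++r)$, $$n^{1-\alpha'}(\widetilde\lambda^n_{p_-+i}-\lambda^n_i)\quad\text{and}\quad n^{1-\alpha'}(\widetilde\lambda^n_{n-(p_++j)}-\lambda^n_{n-j})$$ both converge to $0$ in probability as $n\to\infty$ (if the range of $i$ or $j$ is empty, the corresponding statement is empty).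
   Context: For each $n$, $X_n$ is a deterministic $n\times n$ Hermitian (or real symmetric) matrix with eigenvalues $\lambda_1^n\le\cdots\le\lambda_n^n$, spectral measure $\mu_n=\frac1n\sum_l\delta_{\lambda_l^n}$. Hypothesis (H1): $\mu_n\to\mu_X$ weakly, $\mu_X$ deterministic compactly supported probability measure, $\lambda_1^n\to a$, $\lambda_n^n\to b$, the lower and upper bounds of the support of $\mu_X$. Assumption (A1): $\nu$ probability measure on $\mathbb R$ or $\mathbb C$ satisfying a logarithmic Sobolev inequality, centred, variance one; if not supported on $\mathbb R$, real and imaginary parts i.i.d. Fix $r\ge1$ and nonzero reals $\theta_1\le\cdots\le\theta_r$ independent of $n$. i.i.d. model: $u_1^n,\ldots,u_r^n$ are independent copies of $v^n=\frac1{\sqrt n}(x_1,\ldots,x_n)^T$, $x_i$ i.i.d. with law $\nu$. $G_{\mu_X}(z)=\int\frac{d\mu_X(x)}{z-x}$; $\overline\theta=1/\lim_{z\downarrow b}G_{\mu_X}(z)$, $\underline\theta=1/\lim_{z\uparrow a}G_{\mu_X}(z)$ ($1/\pm\infty=0$); $\rho_\theta=G_{\mu_X}^{-1}(1/\theta)$ if $\theta\in(-\infty,\underline\theta)\cup(\overline\theta,\infty)$, $a$ if $\theta\in[\underline\theta,0)$, $b$ if $\theta\in(0,\overline\theta]$. Assumption (A3): for all $i$, $\theta_i\notin\{\underline\theta,\overline\theta\}$. Conditions of Hypothesis (H3)$[p,\alpha,a]$: there is a sequence $m_n\to\infty$ of positive integers with $m_n=O(n^\alpha)$ such that (C1) $\liminf_n\frac1n\sum_{i=m_n+1}^n\frac1{\lambda_p^n-\lambda_i^n}\ge\frac1{\underline\theta}$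 and (C2) for some $\eta_2>0$, $\sum_{i=m_n+1}^n(\lambda_p^n-\lambda_i^n)^{-2}\le n^{2-\eta_2}$ for $n$ large. Conditions of Hypothesis (H3)$[q,\alpha,b]$: there is a sequence $m_n\to\infty$ with $m_n=O(n^\alpha)$ such that (C1') $\limsup_n\frac1n\sum_{i=m_n+1}^n\frac1{\lambda_{n-q+1}^n-\lambda_{n-i+1}^n}\le\frac1{\overline\theta}$ and (C2') for some $\eta_2>0$, $\sum_{i=m_n+1}^n(\lambda_{n-q+1}^n-\lambda_{n-i+1}^n)^{-2}\le n^{2-\eta_2}$ for $n$ large. *)

theory Defs
  imports "HOL-Probability.Probability" "Jordan_Normal_Form.Char_Poly"
begin

definition hermitian_mat :: "nat \<Rightarrow> complex mat \<Rightarrow> bool" where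
  "hermitian_mat n A \<longleftrightarrow> A \<in> carrier_mat n n \<and>
     (\<forall>i<n. \<forall>j<n. A $$ (i,j) = cnj (A $$ (j,i)))"

definition ord_eig :: "complex mat \<Rightarrow> nat \<Rightarrow> real" where
  "ord_eig A = (THE f. (\<forall>i j. 1 \<le> i \<longrightarrow> i \<le> j \<longrightarrow> j \<le> dim_row A \<longrightarrow> f i \<le> f j)
      \<and> char_poly A = (\<Prod>i\<in>{1..dim_row A}. [: - complex_of_real (f i), 1 :])
      \<and> (\<forall>i. i \<notin> {1..dim_row A} \<longrightarrow> f i = 0))"

definition perturbed :: "nat \<Rightarrow> complex mat \<Rightarrow> nat \<Rightarrow> (nat \<Rightarrow> real) \<Rightarrow> (nat \<Rightarrow> nat \<Rightarrow> complex) \<Rightarrow> complex mat" where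
  "perturbed n X r \<theta> u = mat n n (\<lambda>(i,j). X $$ (i,j) +
       (\<Sum>k\<in>{1..r}. complex_of_real (\<theta> k) * u k i * cnj (u k j)))"

definition msupp :: "real measure \<Rightarrow> real set" where
  "msupp \<mu> = {x. \<forall>e>0. measure \<mu> {x - e <..< x + e} > 0}"

definition stieltjes :: "real measure \<Rightarrow> real \<Rightarrow> real" where
  "stieltjes \<mu> z = (\<integral>x. 1 / (z - x) \<partial>\<mu>)"

definition G_right :: "real measure \<Rightarrow> ereal" where
  "G_right \<mu> = Lim (at_right (Sup (msupp \<mu>))) (\<lambda>z. ereal (stieltjes \<mu> z))"

definition G_left :: "real measure \<Rightarrow> ereal" where
  "G_left \<mu> = Lim (at_left (Inf (msupp \<mu>))) (\<lambda>z. ereal (stieltjes \<mu> z))"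

definition ereal_inv :: "ereal \<Rightarrow> real" where
  "ereal_inv x = (if x = \<infinity> \<or> x = -\<infinity> then 0 else 1 / real_of_ereal x)"

definition theta_bar :: "real measure \<Rightarrow> real" where
  "theta_bar \<mu> = ereal_inv (G_right \<mu>)"

definition theta_under :: "real measure \<Rightarrow> real" where
  "theta_under \<mu> = ereal_inv (G_left \<mu>)"

definition rho :: "real measure \<Rightarrow> real \<Rightarrow> real" where
  "rho \<mu> \<theta> =
     (let a = Inf (msupp \<mu>); b = Sup (msupp \<mu>) in
      if \<theta> < theta_under \<mu> \<or> \<theta> > theta_bar \<mu>
      then (THE z. (z < a \<or> b < z) \<and> stieltjes \<mu> z = 1 / \<theta>)
      else if \<theta> < 0 then a else b)"

definition entropy :: "complex measure \<Rightarrow> (complex \<Rightarrow> real) \<Rightarrow> real" where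
  "entropy \<nu> g = (\<integral>z. g z * ln (g z) \<partial>\<nu>) - (\<integral>z. g z \<partial>\<nu>) * ln (\<integral>z. g z \<partial>\<nu>)"

(* logarithmic Sobolev inequality (on C = R^2; for laws supported on R this is
   equivalent to the one-dimensional inequality), tested on bounded
   differentiable functions with bounded gradient *)
definition log_sobolev :: "complex measure \<Rightarrow> bool" where
  "log_sobolev \<nu> \<longleftrightarrow> (\<exists>c>0. \<forall>f D.
     (\<forall>z. (f has_derivative D z) (at z)) \<and> bounded (range f) \<and>
     bounded ((\<lambda>z. onorm (D z)) ` UNIV)
     \<longrightarrow> entropy \<nu> (\<lambda>z. (f z)\<^sup>2) \<le> 2 * c * (\<integral>z. (onorm (D z))\<^sup>2 \<partial>\<nu>))"

definition assumption_A1 :: "complex measure \<Rightarrow> bool" where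
  "assumption_A1 \<nu> \<longleftrightarrow> prob_space \<nu> \<and> sets \<nu> = sets borel \<and> log_sobolev \<nu> \<and>
     integrable \<nu> (\<lambda>z. z) \<and> (\<integral>z. z \<partial>\<nu>) = 0 \<and>
     integrable \<nu> (\<lambda>z. (cmod z)\<^sup>2) \<and> (\<integral>z. (cmod z)\<^sup>2 \<partial>\<nu>) = 1 \<and>
     ((AE z in \<nu>. Im z = 0) \<or>
      (distr \<nu> borel Re = distr \<nu> borel Im \<and>
       prob_space.indep_var \<nu> borel Re borel Im))"

definition conv_prob_zero :: "'w measure \<Rightarrow> (nat \<Rightarrow> 'w \<Rightarrow> real) \<Rightarrow> bool" where
  "conv_prob_zero M Y \<longleftrightarrow>
     (\<forall>e>0. (\<lambda>n. measure M {w \<in> space M. \<bar>Y n w\<bar> > e}) \<longlonglongrightarrow> 0)"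

end

theory Submission
  imports Defs "HOL-Computational_Algebra.Fundamental_Theorem_Algebra"
begin

text \<open>
  Put \<open>K(z) = U\<^sup>* (z - X)\<inverse> U - \<Theta>\<inverse>\<close>. By inertia additivity, the number of eigenvalues of
  \<open>X + U \<Theta> U\<^sup>*\<close> below \<open>z\<close> exceeds the number of eigenvalues of \<open>X\<close> below \<open>z\<close> by the number of
  negative squares of \<open>K(z)\<close> minus the number of positive \<open>\<theta>\<^sub>i\<close>. If \<open>z\<close> lies near the lower edge,
  left of \<open>\<lambda>\<^sub>p\<close> and at distance at least \<open>n\<^sup>\<beta>\<^sup>-\<^sup>1\<close> (\<open>\<alpha> < \<beta> < \<alpha>'\<close>) from the spectrum, the \<open>m\<^sub>n\<close> first
  eigenvalues do not contribute to \<open>tr (z - X)\<inverse> / n\<close> in the limit, and this trace tends to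
  \<open>G(a-)\<close>, the inverse of the critical value of \<open>\<theta>\<close>; the second condition of the hypothesis bounds the
  variances of the entries of \<open>K(z)\<close>. So \<open>K(z)\<close> is close to \<open>G(a-) - \<Theta>\<inverse>\<close> in probability and has
  \<open>p\<^sub>- + #{i. \<theta>\<^sub>i > 0}\<close> negative squares: the counting function is shifted by exactly \<open>p\<^sub>-\<close>. A
  pigeonhole argument provides such points \<open>z\<close> on both sides of \<open>\<lambda>\<^sub>i\<close>, within distance of order
  \<open>n\<^sup>\<beta>\<^sup>-\<^sup>1\<close>; if there is none on the right, \<open>\<lambda>\<^sub>p\<close> itself is that close and interlacing gives the upper
  bound. The upper edge follows by passing to \<open>- X\<close>. Only fourth moments of the entries are needed,
  and these follow from the logarithmic Sobolev inequality.
\<close>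

section \<open>Spectral theorem for Hermitian matrices\<close>

text \<open>The points \<open>z\<close> depend on \<open>n\<close> and on the spectrum of
  \<open>X n\<close>, not on the sample, and at most two of them are used for each \<open>n\<close>.
  Chebyshev bounds at fixed \<open>z\<close> therefore suffice, with no uniformity in
  \<open>z\<close>; this is why fourth moments are enough. The trace needs two one-sided bounds of
  different origin. That it is asymptotically at most \<open>G(a-)\<close> follows from weak
  convergence, tested at a fixed point left of the edge and carried to \<open>z\<close> by
  monotonicity. The reverse bound cannot come from weak convergence, to which o(n) eigenvalues near
  the edge are invisible: it is what the first condition supplies. Both conditions are stated at the
  p-th eigenvalue, and they pass to \<open>z\<close> by monotonicity because \<open>z\<close> stays
  to its left. The edge value is kept as an extended real \<open>G\<close> and is compared with
  \<open>1 / \<theta>\<close>, never inverted. If \<open>G\<close> is \<open>- \<infinity>\<close>,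
  every negative \<theta> yields an outlier and only the upper trace bound has content. (A3) says
  that no \<open>1 / \<theta>\<close> equals \<open>G\<close>; this leaves a fixed margin within
  which \<open>K(z)\<close> may fluctuate without changing its signature.\<close>

lemma underdetermined_system:
  fixes a :: "'i \<Rightarrow> 'j \<Rightarrow> 'a::field"
  assumes "finite I" "finite J" "card I < card J"
  shows "\<exists>t. (\<exists>j\<in>J. t j \<noteq> 0) \<and> (\<forall>j. j \<notin> J \<longrightarrow> t j = 0) \<and> (\<forall>i\<in>I. (\<Sum>j\<in>J. a i j * t j) = 0)"
  using assms
proof (induction I arbitrary: a J rule: finite_induct)
  case empty
  then obtain j where "j \<in> J" by fastforce
  then show ?case by (intro exI[of _ "\<lambda>k. if k = j then 1 else 0"]) auto
next
  case (insert i0 I)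
  show ?case
  proof (cases "\<forall>j\<in>J. a i0 j = 0")
    case True
    have "card I < card J" using insert by simp
    from insert.IH[OF insert.prems(1) this, of a] obtain t where
      "\<exists>j\<in>J. t j \<noteq> 0" "\<forall>j. j \<notin> J \<longrightarrow> t j = 0" "\<forall>i\<in>I. (\<Sum>j\<in>J. a i j * t j) = 0" by blast
    with True show ?thesis by (intro exI[of _ t]) auto
  next
    case False
    then obtain j0 where j0: "j0 \<in> J" "a i0 j0 \<noteq> 0" by blast
    let ?J = "J - {j0}"
    \<comment> \<open>Gaussian elimination with pivot \<open>a i0 j0\<close>: the unknown
      \<open>j0\<close> is removed from the other equations, and \<open>c\<close> below recovers it
      from equation \<open>i0\<close>.\<close>
    let ?a = "\<lambda>i j. a i j - a i j0 * a i0 j / a i0 j0"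
    have "card I < card ?J" using insert j0 by simp
    from insert.IH[OF _ this, of ?a] insert.prems obtain t where
      t: "\<exists>j\<in>?J. t j \<noteq> 0" "\<forall>j. j \<notin> ?J \<longrightarrow> t j = 0" "\<forall>i\<in>I. (\<Sum>j\<in>?J. ?a i j * t j) = 0" by auto
    define c where "c = - (\<Sum>j\<in>?J. a i0 j * t j) / a i0 j0"
    define s where "s = t(j0 := c)"
    have s: "(\<Sum>j\<in>J. a i j * s j) = a i j0 * c + (\<Sum>j\<in>?J. a i j * t j)" for i
      using insert.prems(1) j0 by (simp add: sum.remove[of J j0] s_def)
    have "(\<Sum>j\<in>J. a i0 j * s j) = 0" using j0 by (simp add: s c_def)
    moreover have "(\<Sum>j\<in>J. a i j * s j) = 0" if "i \<in> I" for i
    proof -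
      have "0 = (\<Sum>j\<in>?J. ?a i j * t j)" using t that by simp
      also have "\<dots> = (\<Sum>j\<in>?J. a i j * t j - a i j0 / a i0 j0 * (a i0 j * t j))"
        by (rule sum.cong) (simp_all add: algebra_simps)
      also have "\<dots> = (\<Sum>j\<in>J. a i j * s j)"
        unfolding s sum_subtractf sum_distrib_left[symmetric] by (simp add: c_def)
      finally show ?thesis by simp
    qed
    moreover have "\<exists>j\<in>J. s j \<noteq> 0" "\<forall>j. j \<notin> J \<longrightarrow> s j = 0"
      using t(1,2) j0 by (auto simp: s_def)
    ultimately show ?thesis by (intro exI[of _ s]) auto
  qed
qed

text \<open>Vectors of \<open>\<complex>\<^sup>n\<close> are functions on \<open>nat\<close> read on \<open>{..<n}\<close>; families of vectors and
  eigenvalues are indexed by \<open>{1..n}\<close>, as in \<^const>\<open>ord_eig\<close>.\<close>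

definition cip :: "nat \<Rightarrow> (nat \<Rightarrow> complex) \<Rightarrow> (nat \<Rightarrow> complex) \<Rightarrow> complex" where
  "cip n u y = (\<Sum>i<n. cnj (u i) * y i)"

text \<open>Padding with zeros outside \<open>{..<n}\<close> allows eigenvector equations to be
  stated as equalities of functions, and a nonzero vector to be one that differs from
  \<open>\<lambda>_. 0\<close>.\<close>

definition mv :: "nat \<Rightarrow> (nat \<Rightarrow> nat \<Rightarrow> complex) \<Rightarrow> (nat \<Rightarrow> complex) \<Rightarrow> nat \<Rightarrow> complex" where
  "mv n A y = (\<lambda>i. if i < n then \<Sum>j<n. A i j * y j else 0)"

lemma cip_cnj: "cnj (cip n u y) = cip n y u" by (simp add: cip_def mult.commute)

lemma cip_self: "cip n u u = complex_of_real (\<Sum>i<n. (cmod (u i))\<^sup>2)"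
  unfolding cip_def of_real_sum 
  by (rule sum.cong) (simp_all del: of_real_power add: complex_norm_square mult.commute)

lemma cip_self_eq_0: "cip n u u = 0 \<longleftrightarrow> (\<forall>i<n. u i = 0)"
proof -
  have "cip n u u = 0 \<longleftrightarrow> (\<Sum>i<n. (cmod (u i))\<^sup>2) = 0"
    by (simp only: cip_self of_real_eq_0_iff)
  then show ?thesis by (auto simp: sum_nonneg_eq_0_iff)
qed

lemma cip_lin_right: "cip n u (\<lambda>i. x i + c * y i) = cip n u x + c * cip n u y"
  by (simp add: cip_def algebra_simps sum.distrib sum_distrib_left)

lemma cip_sum_right: "cip n u (\<lambda>i. \<Sum>k\<in>K. c k * y k i) = (\<Sum>k\<in>K. c k * cip n u (y k))"
  unfolding cip_def sum_distrib_left by (subst sum.swap) (simp add: mult.left_commute)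

lemma mv_lin: "mv n A (\<lambda>i. x i + c * y i) = (\<lambda>i. mv n A x i + c * mv n A y i)"
  by (auto simp: mv_def algebra_simps sum.distrib sum_distrib_left)

lemma mv_pow_lin:
  "(mv n A ^^ k) (\<lambda>i. x i + c * y i) = (\<lambda>i. (mv n A ^^ k) x i + c * (mv n A ^^ k) y i)"
  by (induction k) (simp_all add: mv_lin)

lemma mv_self_adjoint:
  assumes "\<And>i j. i < n \<Longrightarrow> j < n \<Longrightarrow> A i j = cnj (A j i)"
  shows "cip n u (mv n A y) = cip n (mv n A u) y"
proof -
  have "cip n u (mv n A y) = (\<Sum>i<n. \<Sum>j<n. cnj (u i) * A i j * y j)"
    by (simp add: cip_def mv_def sum_distrib_left algebra_simps)
  also have "\<dots> = (\<Sum>j<n. \<Sum>i<n. cnj (u i) * A i j * y j)" by (rule sum.swap)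
  also have "\<dots> = (\<Sum>j<n. \<Sum>i<n. cnj (A j i * u i) * y j)"
  proof (intro sum.cong refl)
    fix i j assume "j \<in> {..<n}" "i \<in> {..<n}"
    then have "A i j = cnj (A j i)" by (intro assms) auto
    then show "cnj (u i) * A i j * y j = cnj (A j i * u i) * y j" by (simp only: complex_cnj_mult mult_ac)
  qed
  also have "\<dots> = cip n (mv n A u) y" by (simp add: cip_def mv_def sum_distrib_right)
  finally show ?thesis .
qed

text \<open>Peel off linear factors of \<open>p\<close>: the last nonzero vector obtained is an eigenvector.\<close>

lemma eigenvector_of_annihilating_poly:
  assumes V_comb: "\<And>x y c. V x \<Longrightarrow> V y \<Longrightarrow> V (\<lambda>i. x i + c * y i)"
    and V_inv: "\<And>y. V y \<Longrightarrow> V (mv n A y)"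
    and "V y" "y \<noteq> (\<lambda>_. 0)" "p \<noteq> 0" "degree p \<le> N"
    and "\<And>i. (\<Sum>k\<le>N. coeff p k * (mv n A ^^ k) y i) = 0"
  shows "\<exists>e v. V v \<and> v \<noteq> (\<lambda>_. 0) \<and> mv n A v = (\<lambda>i. e * v i)"
  using assms(3-)
proof (induction N arbitrary: p y)
  case 0
  then obtain c where c: "p = [:c:]" by (metis degree_0_id le_zero_eq)
  with 0 have "c \<noteq> 0" "\<And>i. c * y i = 0" by auto
  with 0 show ?case by auto
next
  case (Suc N)
  show ?case
  proof (cases "degree p = 0")
    case True
    then obtain c where c: "p = [:c:]" by (metis degree_0_id)
    with Suc.prems have "c \<noteq> 0" by auto
    have "(\<Sum>k\<le>Suc N. coeff p k * (mv n A ^^ k) y i) = c * y i" for i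
      unfolding c by (subst sum.mono_neutral_right[of _ "{0}"]) (auto simp: coeff_pCons split: nat.splits)
    with Suc.prems \<open>c \<noteq> 0\<close> have "y i = 0" for i by simp
    with Suc.prems show ?thesis by auto
  next
    case False
    then have "\<not> constant (poly p)" by (simp add: constant_degree)
    then obtain e where "poly p e = 0" using fundamental_theorem_of_algebra by blast
    then obtain q where q: "p = [:-e, 1:] * q" by (meson dvdE poly_eq_0_iff_dvd)
    with Suc.prems have q0: "q \<noteq> 0" by auto
    have "degree p = Suc (degree q)" unfolding q by (subst degree_mult_eq) (use q0 in auto)
    with Suc.prems have dq: "degree q \<le> N" by simp
    define w where "w = (\<lambda>i. mv n A y i + (-e) * y i)"
    show ?thesis
    proof (cases "w = (\<lambda>_. 0)")
      case True
      have "mv n A y i = e * y i" for i using fun_cong[OF True, of i] by (simp add: w_def)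
      with Suc.prems show ?thesis by blast
    next
      case False
      have Vw: "V w" unfolding w_def by (intro V_comb V_inv Suc.prems)
      have z: "(\<Sum>k\<le>N. coeff q k * (mv n A ^^ k) w i) = 0" for i
      proof -
        let ?T = "\<lambda>k. (mv n A ^^ k) y i"
        have cp: "coeff p k = (case k of 0 \<Rightarrow> 0 | Suc j \<Rightarrow> coeff q j) - e * coeff q k" for k
          unfolding q by (simp add: coeff_pCons algebra_simps split: nat.splits)
        have "0 = (\<Sum>k\<le>Suc N. coeff p k * ?T k)" using Suc.prems(5) by simp
        also have "\<dots> = (\<Sum>k\<le>Suc N. (case k of 0 \<Rightarrow> 0 | Suc j \<Rightarrow> coeff q j) * ?T k)
            - e * (\<Sum>k\<le>Suc N. coeff q k * ?T k)"
          by (simp only: cp left_diff_distrib sum_subtractf sum_distrib_left mult.assoc)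
        also have "(\<Sum>k\<le>Suc N. (case k of 0 \<Rightarrow> 0 | Suc j \<Rightarrow> coeff q j) * ?T k) = (\<Sum>k\<le>N. coeff q k * ?T (Suc k))"
          by (subst sum.atMost_Suc_shift) simp
        also have "(\<Sum>k\<le>Suc N. coeff q k * ?T k) = (\<Sum>k\<le>N. coeff q k * ?T k)"
          using dq by (simp add: coeff_eq_0)
        also have "(\<Sum>k\<le>N. coeff q k * ?T (Suc k)) - e * (\<Sum>k\<le>N. coeff q k * ?T k)
            = (\<Sum>k\<le>N. coeff q k * (mv n A ^^ k) w i)"
          unfolding w_def mv_pow_lin
          by (simp add: sum_distrib_left funpow_swap1 sum_subtractf algebra_simps)
        finally show ?thesis by simp
      qed
      show ?thesis using Suc.IH[OF Vw False q0 dq z] .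
    qed
  qed
qed

text \<open>The \<open>n + 1\<close> iterates of \<open>y\<close> under \<open>mv n A\<close> live
  in \<open>n\<close> coordinates, so they are linearly dependent. The coefficients of a dependence
  form a nonzero polynomial that annihilates \<open>y\<close>, and no determinant is
  involved.\<close>

lemma invariant_eigenvector:
  assumes V_comb: "\<And>x y c. V x \<Longrightarrow> V y \<Longrightarrow> V (\<lambda>i. x i + c * y i)"
    and V_inv: "\<And>y. V y \<Longrightarrow> V (mv n A y)"
    and supp: "\<And>y i. V y \<Longrightarrow> n \<le> i \<Longrightarrow> y i = 0"
    and y: "V y" "y \<noteq> (\<lambda>_. 0)"
  shows "\<exists>e v. V v \<and> v \<noteq> (\<lambda>_. 0) \<and> mv n A v = (\<lambda>i. e * v i)"
proof -
  have "card {..<n} < card {..n}" by simp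
  from underdetermined_system[OF _ _ this, of "\<lambda>i k. (mv n A ^^ k) y i"]
  obtain t where t: "\<exists>k\<in>{..n}. t k \<noteq> 0" "\<forall>i<n. (\<Sum>k\<le>n. (mv n A ^^ k) y i * t k) = 0" by auto
  have V_pow: "V ((mv n A ^^ k) y)" for k by (induction k) (auto intro: V_inv y)
  define p where "p = (\<Sum>k\<le>n. monom (t k) k)"
  have cp: "coeff p k = (if k \<le> n then t k else 0)" for k
    by (auto simp: p_def coeff_sum)
  from t(1) obtain k0 where "k0 \<le> n" "t k0 \<noteq> 0" by auto
  then have "p \<noteq> 0" using cp[of k0] by auto
  moreover have "degree p \<le> n" by (rule degree_le) (simp add: cp)
  moreover have "(\<Sum>k\<le>n. coeff p k * (mv n A ^^ k) y i) = 0" for i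
  proof (cases "i < n")
    case True
    then show ?thesis using t(2) by (simp add: cp mult.commute)
  next
    case False
    then show ?thesis using supp[OF V_pow] by simp
  qed
  ultimately show ?thesis
    using eigenvector_of_annihilating_poly[OF V_comb V_inv y, where N = n and p = p] by blast
qed

definition orthonormal_sys :: "nat \<Rightarrow> (nat \<Rightarrow> nat \<Rightarrow> complex) \<Rightarrow> nat set \<Rightarrow> bool" where
  "orthonormal_sys n v K \<longleftrightarrow> (\<forall>k\<in>K. \<forall>l\<in>K. cip n (v k) (v l) = (if k = l then 1 else 0))"

text \<open>Induction on the number of vectors: the orthogonal complement of the eigenvectors found
  so far is invariant by self-adjointness, and it is nonzero as long as \<open>m < n\<close>, so it
  contains a further eigenvector.\<close>

lemma hermitian_orthonormal_eigenvectors: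
  assumes A: "\<And>i j. i < n \<Longrightarrow> j < n \<Longrightarrow> A i j = cnj (A j i)" and "m \<le> n"
  shows "\<exists>v f. orthonormal_sys n v {1..m} \<and>
           (\<forall>k\<in>{1..m}. mv n A (v k) = (\<lambda>i. complex_of_real (f k) * v k i))"
  using \<open>m \<le> n\<close>
proof (induction m)
  case 0
  then show ?case by (simp add: orthonormal_sys_def)
next
  case (Suc m)
  then obtain v and f :: "nat \<Rightarrow> real" where v: "orthonormal_sys n v {1..m}"
    and f: "\<And>k. k \<in> {1..m} \<Longrightarrow> mv n A (v k) = (\<lambda>i. complex_of_real (f k) * v k i)" by auto
  define V where "V = (\<lambda>y. (\<forall>k\<in>{1..m}. cip n (v k) y = 0) \<and> (\<forall>i\<ge>n. y i = (0::complex)))"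
  have "card {1..m} < card {..<n}" using Suc by simp
  from underdetermined_system[OF _ _ this, of "\<lambda>k i. cnj (v k i)"]
  obtain y where y: "\<exists>i\<in>{..<n}. y i \<noteq> 0" "\<forall>i. i \<notin> {..<n} \<longrightarrow> y i = 0"
    "\<forall>k\<in>{1..m}. cip n (v k) y = 0" unfolding cip_def by auto
  have "\<exists>e u. V u \<and> u \<noteq> (\<lambda>_. 0) \<and> mv n A u = (\<lambda>i. e * u i)"
  proof (rule invariant_eigenvector)
    show "V (\<lambda>i. x i + c * y i)" if "V x" "V y" for x y c
      using that by (simp add: V_def cip_lin_right)
    show "V (mv n A y)" if "V y" for y
    proof -
      have "cip n (v k) (mv n A y) = 0" if k: "k \<in> {1..m}" for k
      proof -
        have "cip n (v k) (mv n A y) = cip n (mv n A (v k)) y" by (rule mv_self_adjoint[OF A])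
        also have "\<dots> = f k * cip n (v k) y"
          unfolding f[OF k] by (simp add: cip_def sum_distrib_left mult.assoc)
        finally show ?thesis using \<open>V y\<close> k by (simp add: V_def)
      qed
      then show ?thesis by (simp add: V_def mv_def)
    qed
    show "y i = 0" if "V y" "n \<le> i" for y i using that by (simp add: V_def)
    show "V y" "y \<noteq> (\<lambda>_. 0)" using y by (auto simp: V_def)
  qed
  then obtain e u where u: "V u" "u \<noteq> (\<lambda>_. 0)" "mv n A u = (\<lambda>i. e * u i)" by blast
  define s where "s = sqrt (\<Sum>i<n. (cmod (u i))\<^sup>2)"
  have "\<exists>i<n. u i \<noteq> 0"
  proof (rule ccontr)
    assume "\<not> ?thesis"
    then have "u i = 0" for i using u(1) by (cases "i < n") (auto simp: V_def)
    then show False using u(2) by auto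
  qed
  then have uu: "cip n u u \<noteq> 0" by (auto simp: cip_self_eq_0)
  have ss: "complex_of_real (s\<^sup>2) = cip n u u" unfolding s_def cip_self
    by (subst real_sqrt_pow2) (auto simp: sum_nonneg)
  then have s0: "s \<noteq> 0" using uu by auto
  \<comment> \<open>Self-adjointness gives \<open>e = cnj e\<close>, so the eigenvalue is
    real.\<close>
  have "e * cip n u u = cip n u (mv n A u)"
    unfolding u(3) by (simp add: cip_def sum_distrib_left mult.left_commute)
  also have "\<dots> = cip n (mv n A u) u" by (rule mv_self_adjoint[OF A])
  also have "\<dots> = cnj e * cip n u u"
    unfolding u(3) by (simp add: cip_def sum_distrib_left mult.assoc)
  finally have "e = cnj e" using uu by simp
  then have e: "e = complex_of_real (Re e)" by (simp add: complex_eq_iff)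
  define w where "w = (\<lambda>i. u i / complex_of_real s)"
  have ww: "cip n w w = 1"
  proof -
    have "cip n w w = cip n u u / complex_of_real (s\<^sup>2)"
      by (simp add: w_def cip_def sum_divide_distrib power2_eq_square)
    then show ?thesis unfolding ss using uu by simp
  qed
  have vw: "cip n (v k) w = 0" if "k \<in> {1..m}" for k
  proof -
    have "cip n (v k) w = cip n (v k) u / complex_of_real s"
      by (simp add: w_def cip_def sum_divide_distrib)
    then show ?thesis using u(1) that by (simp add: V_def)
  qed
  then have wv: "cip n w (v k) = 0" if "k \<in> {1..m}" for k
    using that cip_cnj[of n "v k" w] by simp
  have mw: "mv n A w = (\<lambda>i. complex_of_real (Re e) * w i)"
  proof
    fix i
    have "mv n A w i = mv n A u i / complex_of_real s"
      by (simp add: mv_def w_def sum_divide_distrib)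
    then show "mv n A w i = complex_of_real (Re e) * w i"
      using u(3) e by (simp add: w_def)
  qed
  let ?v = "v(Suc m := w)" and ?f = "f(Suc m := Re e)"
  have "orthonormal_sys n ?v {1..Suc m}"
    using v vw wv ww unfolding orthonormal_sys_def by (auto simp: atLeastAtMostSuc_conv)
  moreover have "\<forall>k\<in>{1..Suc m}. mv n A (?v k) = (\<lambda>i. complex_of_real (?f k) * ?v k i)"
    using f mw by (auto simp: atLeastAtMostSuc_conv)
  ultimately show ?case by blast
qed


section \<open>Completeness, characteristic polynomial and ordered eigenvalues\<close>

lemma sum_Suc_lessThan: "(\<Sum>k<n. g (Suc k)) = (\<Sum>k\<in>{1..n}. g k)" for g :: "nat \<Rightarrow> complex"
  by (rule sum.reindex_bij_witness[of _ "\<lambda>k. k - 1" Suc]) auto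

text \<open>Matrices are indexed from 0 and families of vectors from 1, hence the
  \<open>Suc\<close>. Orthonormality is \<open>W * V = 1\<close>; a one-sided inverse of a square
  matrix is two-sided, and \<open>V * W = 1\<close> is the completeness relation.\<close>

lemma orthonormal_sys_mat:
  assumes "orthonormal_sys n v {1..n}"
  defines "V \<equiv> mat n n (\<lambda>(i,k). v (Suc k) i)" and "W \<equiv> mat n n (\<lambda>(k,i). cnj (v (Suc k) i))"
  shows "W * V = 1\<^sub>m n" "V * W = 1\<^sub>m n"
proof -
  have c: "V \<in> carrier_mat n n" "W \<in> carrier_mat n n" by (simp_all add: V_def W_def)
  show "W * V = 1\<^sub>m n"
  proof (rule eq_matI)
    fix k l assume "k < dim_row (1\<^sub>m n :: complex mat)" "l < dim_col (1\<^sub>m n :: complex mat)"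
    then have kl: "k < n" "l < n" by auto
    have "(W * V) $$ (k, l) = cip n (v (Suc k)) (v (Suc l))"
      using kl by (simp add: V_def W_def scalar_prod_def lessThan_atLeast0 cip_def)
    also have "\<dots> = 1\<^sub>m n $$ (k, l)" using assms(1) kl by (simp add: orthonormal_sys_def)
    finally show "(W * V) $$ (k, l) = 1\<^sub>m n $$ (k, l)" .
  qed (simp_all add: V_def W_def)
  then show "V * W = 1\<^sub>m n" by (rule mat_mult_left_right_inverse[OF c(2) c(1)])
qed

lemma orthonormal_sys_complete:
  assumes "orthonormal_sys n v {1..n}" "i < n" "j < n"
  shows "(\<Sum>k\<in>{1..n}. v k i * cnj (v k j)) = (if i = j then 1 else 0)"
proof -
  have "(\<Sum>k<n. v (Suc k) i * cnj (v (Suc k) j)) = (1\<^sub>m n :: complex mat) $$ (i, j)"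
    unfolding orthonormal_sys_mat(2)[OF assms(1), symmetric] using assms(2,3)
    by (simp add: scalar_prod_def lessThan_atLeast0)
  then show ?thesis
    using assms(2,3) unfolding sum_Suc_lessThan[of "\<lambda>k. v k i * cnj (v k j)"] by simp
qed

text \<open>Sortedness is included so that \<open>f\<close> is determined on \<open>{1..n}\<close>
  and agrees there with \<open>ord_eig X\<close>, while the eigenvectors \<open>v\<close> remain a
  free choice.\<close>

definition eigensystem :: "nat \<Rightarrow> complex mat \<Rightarrow> (nat \<Rightarrow> real) \<Rightarrow> (nat \<Rightarrow> nat \<Rightarrow> complex) \<Rightarrow> bool" where
  "eigensystem n X f v \<longleftrightarrow> X \<in> carrier_mat n n \<and> orthonormal_sys n v {1..n} \<and>
     (\<forall>k\<in>{1..n}. \<forall>i<n. (\<Sum>j<n. X $$ (i,j) * v k j) = complex_of_real (f k) * v k i) \<and>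
     (\<forall>i j. 1 \<le> i \<longrightarrow> i \<le> j \<longrightarrow> j \<le> n \<longrightarrow> f i \<le> f j)"

lemma eigensystem_spectral_sum:
  assumes "eigensystem n X f v" "i < n" "j < n"
  shows "X $$ (i,j) = (\<Sum>k\<in>{1..n}. complex_of_real (f k) * v k i * cnj (v k j))"
proof -
  from assms have on: "orthonormal_sys n v {1..n}"
    and ev: "\<And>k. k \<in> {1..n} \<Longrightarrow> (\<Sum>j<n. X $$ (i,j) * v k j) = complex_of_real (f k) * v k i"
    by (auto simp: eigensystem_def)
  have "(\<Sum>k\<in>{1..n}. complex_of_real (f k) * v k i * cnj (v k j))
      = (\<Sum>k\<in>{1..n}. \<Sum>l<n. X $$ (i,l) * v k l * cnj (v k j))"
    by (intro sum.cong refl) (simp add: ev[symmetric] sum_distrib_right)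
  also have "\<dots> = (\<Sum>l<n. \<Sum>k\<in>{1..n}. X $$ (i,l) * v k l * cnj (v k j))" by (rule sum.swap)
  also have "\<dots> = (\<Sum>l<n. X $$ (i,l) * (\<Sum>k\<in>{1..n}. v k l * cnj (v k j)))"
    by (simp add: sum_distrib_left mult.assoc)
  also have "\<dots> = (\<Sum>l<n. if l = j then X $$ (i,l) else 0)"
    by (intro sum.cong refl) (simp add: orthonormal_sys_complete[OF on _ assms(3)] del: One_nat_def)
  also have "\<dots> = X $$ (i,j)" using assms(3) by simp
  finally show ?thesis by simp
qed

lemma eigensystem_char_poly:
  assumes "eigensystem n X f v"
  shows "char_poly X = (\<Prod>k\<in>{1..n}. [:- complex_of_real (f k), 1:])"
proof -
  from assms have X: "X \<in> carrier_mat n n" and on: "orthonormal_sys n v {1..n}"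
    by (auto simp: eigensystem_def)
  define V where "V = mat n n (\<lambda>(i,k). v (Suc k) i)"
  define W where "W = mat n n (\<lambda>(k,i). cnj (v (Suc k) i))"
  define D where "D = mat n n (\<lambda>(k,l). if k = l then complex_of_real (f (Suc k)) else 0)"
  have c: "V \<in> carrier_mat n n" "W \<in> carrier_mat n n" "D \<in> carrier_mat n n"
    by (simp_all add: V_def W_def D_def)
  have WV: "W * V = 1\<^sub>m n" and VW: "V * W = 1\<^sub>m n"
    unfolding V_def W_def by (rule orthonormal_sys_mat[OF on])+
  have "V * D = mat n n (\<lambda>(i,k). complex_of_real (f (Suc k)) * v (Suc k) i)"
  proof (rule eq_matI, goal_cases)
    case (1 i k)
    then have ik: "i < n" "k < n" by auto
    have "(V * D) $$ (i, k) = (\<Sum>l<n. if l = k then v (Suc l) i * complex_of_real (f (Suc l)) else 0)"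
      using ik by (simp add: V_def D_def scalar_prod_def lessThan_atLeast0 mult_delta_right)
    then show ?case using ik by (simp add: mult.commute)
  qed (simp_all add: V_def D_def)
  then have "V * D * W = X"
  proof (intro eq_matI, goal_cases)
    case (1 i j)
    then have ij: "i < n" "j < n" using X by auto
    have "(V * D * W) $$ (i, j) = (\<Sum>k<n. complex_of_real (f (Suc k)) * v (Suc k) i * cnj (v (Suc k) j))"
      using ij unfolding 1 by (simp add: W_def scalar_prod_def lessThan_atLeast0)
    also have "\<dots> = X $$ (i, j)"
      unfolding sum_Suc_lessThan[of "\<lambda>k. complex_of_real (f k) * v k i * cnj (v k j)"]
      using eigensystem_spectral_sum[OF assms ij] by simp
    finally show ?case .
  qed (use X in \<open>simp_all add: V_def W_def D_def\<close>)
  then have "similar_mat_wit X D V W"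
    using c X VW WV by (intro similar_mat_witI[of _ _ n]) auto
  then have "char_poly X = char_poly D" by (intro char_poly_similar) (auto simp: similar_mat_def)
  also have "\<dots> = (\<Prod>a\<leftarrow>diag_mat D. [:- a, 1:])"
    by (rule char_poly_upper_triangular[OF c(3)]) (auto simp: D_def)
  also have "\<dots> = (\<Prod>k<n. [:- complex_of_real (f (Suc k)), 1:])"
  proof -
    have "diag_mat D = map (\<lambda>k. complex_of_real (f (Suc k))) [0..<n]"
      by (auto simp: diag_mat_def D_def)
    then show ?thesis
      by (simp add: prod.distinct_set_conv_list[symmetric] lessThan_atLeast0 comp_def)
  qed
  also have "\<dots> = (\<Prod>k\<in>{1..n}. [:- complex_of_real (f k), 1:])"
    by (rule prod.reindex_bij_witness[of _ "\<lambda>k. k - 1" Suc]) auto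
  finally show ?thesis .
qed

text \<open>The largest value of each family is a root of the other product, so the two largest
  values agree; that factor is cancelled and the argument repeated.\<close>

lemma sorted_roots_unique:
  fixes f g :: "nat \<Rightarrow> real"
  assumes "\<And>i j. 1 \<le> i \<Longrightarrow> i \<le> j \<Longrightarrow> j \<le> n \<Longrightarrow> f i \<le> f j"
    and "\<And>i j. 1 \<le> i \<Longrightarrow> i \<le> j \<Longrightarrow> j \<le> n \<Longrightarrow> g i \<le> g j"
    and "(\<Prod>i\<in>{1..n}. [:- complex_of_real (f i), 1:]) = (\<Prod>i\<in>{1..n}. [:- complex_of_real (g i), 1:])"
    and "k \<in> {1..n}"
  shows "f k = g k"
  using assms
proof (induction n)
  case 0
  then show ?case by simp
next
  case (Suc n)
  have root: "\<exists>i\<in>{1..Suc n}. h i = t"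
    if "poly (\<Prod>i\<in>{1..Suc n}. [:- complex_of_real (h i), 1:]) (complex_of_real t) = 0" for h t
  proof -
    have "(\<Prod>i\<in>{1..Suc n}. complex_of_real t - complex_of_real (h i)) = 0"
      using that by (simp only: poly_prod) simp
    then have "\<exists>i\<in>{1..Suc n}. complex_of_real t - complex_of_real (h i) = 0"
      by (subst (asm) prod_zero_iff) simp_all
    then show ?thesis by auto
  qed
  have zero: "poly (\<Prod>i\<in>{1..Suc n}. [:- complex_of_real (h i), 1:]) (complex_of_real (h (Suc n))) = 0" for h
    by simp
  have "\<exists>i\<in>{1..Suc n}. g i = f (Suc n)"
    using zero[of f] unfolding Suc.prems(3) by (rule root)
  moreover have "\<exists>i\<in>{1..Suc n}. f i = g (Suc n)"
    using zero[of g] unfolding Suc.prems(3)[symmetric] by (rule root)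
  ultimately have eq: "f (Suc n) = g (Suc n)"
    using Suc.prems(1,2)[of _ "Suc n"] by (metis antisym atLeastAtMost_iff order_refl)
  show ?case
  proof (cases "k = Suc n")
    case True
    then show ?thesis using eq by simp
  next
    case False
    have "(\<Prod>i\<in>{1..n}. [:- complex_of_real (f i), 1:]) = (\<Prod>i\<in>{1..n}. [:- complex_of_real (g i), 1:])"
      using Suc.prems(3) unfolding prod.cl_ivl_Suc eq by (simp del: mult_pCons_right)
    then show ?thesis using Suc False by auto
  qed
qed

text \<open>Resolves the definite description in \<open>ord_eig\<close>: sorted roots are unique on
  \<open>{1..n}\<close>, and the prescribed value 0 settles the other indices.\<close>

lemma ord_eig_eqI:
  fixes f :: "nat \<Rightarrow> real"
  assumes "X \<in> carrier_mat n n" and "char_poly X = (\<Prod>i\<in>{1..n}. [:- complex_of_real (f i), 1:])"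
    and "\<And>i j. 1 \<le> i \<Longrightarrow> i \<le> j \<Longrightarrow> j \<le> n \<Longrightarrow> f i \<le> f j"
  shows "ord_eig X = (\<lambda>i. if i \<in> {1..n} then f i else 0)"
proof -
  let ?f = "\<lambda>i. if i \<in> {1..n} then f i else 0"
  have d: "dim_row X = n" using assms by auto
  have c: "char_poly X = (\<Prod>i\<in>{1..n}. [:- complex_of_real (?f i), 1:])"
    using assms(2) by simp
  show ?thesis unfolding ord_eig_def d
  proof (rule the_equality, goal_cases)
    case 1
    then show ?case using assms(3) c by auto
  next
    case (2 g)
    show ?case
    proof
      fix i show "g i = ?f i"
        using 2 assms(2,3) sorted_roots_unique[of n g f i] by auto
    qed
  qed
qed

lemma eigensystem_ord_eig:
  assumes "eigensystem n X f v"
  shows "ord_eig X = (\<lambda>i. if i \<in> {1..n} then f i else 0)"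
  using assms by (intro ord_eig_eqI eigensystem_char_poly[OF assms]) (auto simp: eigensystem_def)

lemma ex_sorting_bij:
  fixes f :: "nat \<Rightarrow> real"
  shows "\<exists>p. bij_betw p {1..n} {1..n} \<and> (\<forall>i j. 1 \<le> i \<longrightarrow> i \<le> j \<longrightarrow> j \<le> n \<longrightarrow> f (p i) \<le> f (p j))"
proof -
  define xs where "xs = sort_key f [1..<Suc n]"
  have xs: "length xs = n" "distinct xs" "set xs = {1..n}" "sorted (map f xs)"
    by (auto simp: xs_def)
  have "bij_betw ((!) xs \<circ> (\<lambda>i. i - 1)) {1..n} {1..n}"
  proof (rule bij_betw_trans)
    show "bij_betw (\<lambda>i. i - 1) {1..n} {..<n}" by (rule bij_betw_byWitness[of _ Suc]) auto
    show "bij_betw ((!) xs) {..<n} {1..n}" by (rule bij_betw_nth) (use xs in auto)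
  qed
  moreover have "f (xs ! (i - 1)) \<le> f (xs ! (j - 1))" if "1 \<le> i" "i \<le> j" "j \<le> n" for i j
    using sorted_nth_mono[OF xs(4), of "i - 1" "j - 1"] that xs(1) by simp
  ultimately show ?thesis by (intro exI[of _ "(!) xs \<circ> (\<lambda>i. i - 1)"]) auto
qed

lemma hermitian_eigensystem:
  assumes "hermitian_mat n X"
  shows "\<exists>v. eigensystem n X (ord_eig X) v"
proof -
  let ?A = "\<lambda>i j. X $$ (i,j)"
  have A: "?A i j = cnj (?A j i)" if "i < n" "j < n" for i j
    using assms that unfolding hermitian_mat_def by blast
  from hermitian_orthonormal_eigenvectors[of n ?A, OF A order_refl] obtain v f where
    v: "orthonormal_sys n v {1..n}"
    and f: "\<And>k. k \<in> {1..n} \<Longrightarrow> mv n ?A (v k) = (\<lambda>i. complex_of_real (f k) * v k i)" by blast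
  obtain p where p: "bij_betw p {1..n} {1..n}"
    and s: "\<And>i j. 1 \<le> i \<Longrightarrow> i \<le> j \<Longrightarrow> j \<le> n \<Longrightarrow> f (p i) \<le> f (p j)"
    using ex_sorting_bij[of n f] by auto
  have pk: "p k \<in> {1..n}" if "k \<in> {1..n}" for k using p that by (rule bij_betw_apply)
  have inj: "p k = p l \<longleftrightarrow> k = l" if "k \<in> {1..n}" "l \<in> {1..n}" for k l
    by (rule inj_on_eq_iff[OF bij_betw_imp_inj_on[OF p] that])
  have e: "eigensystem n X (f \<circ> p) (v \<circ> p)"
  proof -
    have "orthonormal_sys n (v \<circ> p) {1..n}"
      unfolding orthonormal_sys_def
    proof (intro ballI)
      fix k l assume kl: "k \<in> {1..n}" "l \<in> {1..n}"
      have "cip n (v (p k)) (v (p l)) = (if p k = p l then 1 else 0)"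
        using v pk[OF kl(1)] pk[OF kl(2)] unfolding orthonormal_sys_def by blast
      then show "cip n ((v \<circ> p) k) ((v \<circ> p) l) = (if k = l then 1 else 0)"
        using inj[OF kl] by simp
    qed
    moreover have "(\<Sum>j<n. X $$ (i,j) * (v \<circ> p) k j) = complex_of_real ((f \<circ> p) k) * (v \<circ> p) k i"
      if "k \<in> {1..n}" "i < n" for k i
      using fun_cong[OF f[OF pk[OF that(1)]], of i] that(2) by (simp add: mv_def)
    moreover have "X \<in> carrier_mat n n" using assms by (simp add: hermitian_mat_def)
    ultimately show ?thesis using s by (simp add: eigensystem_def)
  qed
  have "eigensystem n X (ord_eig X) (v \<circ> p)"
    using e unfolding eigensystem_ord_eig[OF e] eigensystem_def by simp
  then show ?thesis by blast
qed

lemma hermitian_ord_eig_mono: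
  assumes "hermitian_mat n X" "1 \<le> i" "i \<le> j" "j \<le> n"
  shows "ord_eig X i \<le> ord_eig X j"
  using hermitian_eigensystem[OF assms(1)] assms(2-) by (auto simp: eigensystem_def)

text \<open>Negation reverses the order, hence the reflection \<open>Suc n - k\<close>. It converts
  counts below a point into counts above it, both for \<open>perturbed_count_ge\<close> and for the
  passage to the upper edge.\<close>

lemma eigensystem_uminus:
  assumes "eigensystem n X f v"
  shows "eigensystem n (mat n n (\<lambda>(i,j). - X $$ (i,j))) (\<lambda>k. - f (Suc n - k)) (\<lambda>k. v (Suc n - k))"
proof -
  have r: "Suc n - k \<in> {1..n}" if "k \<in> {1..n}" for k using that by auto
  have e: "Suc n - k = Suc n - l \<longleftrightarrow> k = l" if "k \<in> {1..n}" "l \<in> {1..n}" for k l using that by auto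
  have ev: "(\<Sum>j<n. X $$ (i,j) * v k j) = complex_of_real (f k) * v k i" if "k \<in> {1..n}" "i < n" for k i
    using assms that by (simp add: eigensystem_def)
  have "orthonormal_sys n (\<lambda>k. v (Suc n - k)) {1..n}"
    using assms r e unfolding eigensystem_def orthonormal_sys_def by metis
  moreover have "(\<Sum>j<n. mat n n (\<lambda>(i,j). - X $$ (i,j)) $$ (i,j) * v (Suc n - k) j)
      = complex_of_real (- f (Suc n - k)) * v (Suc n - k) i" if "k \<in> {1..n}" "i < n" for k i
    using ev[OF r[OF that(1)] that(2)] that(2) by (simp add: sum_negf)
  moreover have "- f (Suc n - i) \<le> - f (Suc n - j)" if "1 \<le> i" "i \<le> j" "j \<le> n" for i j
    using assms that by (auto simp: eigensystem_def)
  ultimately show ?thesis unfolding eigensystem_def by simp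
qed

lemma ord_eig_uminus:
  assumes "hermitian_mat n X" "k \<in> {1..n}"
  shows "ord_eig (mat n n (\<lambda>(i,j). - X $$ (i,j))) k = - ord_eig X (Suc n - k)"
proof -
  from hermitian_eigensystem[OF assms(1)] obtain v where "eigensystem n X (ord_eig X) v" by blast
  from eigensystem_ord_eig[OF eigensystem_uminus[OF this]] assms(2) show ?thesis by simp
qed

lemma hermitian_perturbed:
  assumes "hermitian_mat n X"
  shows "hermitian_mat n (perturbed n X r \<theta> u)"
proof -
  have "X $$ (i,j) + (\<Sum>k\<in>{1..r}. complex_of_real (\<theta> k) * u k i * cnj (u k j))
      = cnj (X $$ (j,i) + (\<Sum>k\<in>{1..r}. complex_of_real (\<theta> k) * u k j * cnj (u k i)))"
    if "i < n" "j < n" for i j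
  proof -
    have "X $$ (i,j) = cnj (X $$ (j,i))" using assms that unfolding hermitian_mat_def by blast
    then show ?thesis by (simp add: mult_ac)
  qed
  then show ?thesis by (simp add: hermitian_mat_def perturbed_def)
qed

section \<open>Inertia and interlacing of finite-rank perturbations\<close>

lemma cip_parseval:
  assumes "orthonormal_sys n v {1..n}"
  shows "cip n x y = (\<Sum>k\<in>{1..n}. cip n x (v k) * cip n (v k) y)"
proof -
  have "(\<Sum>k\<in>{1..n}. cip n x (v k) * cip n (v k) y)
      = (\<Sum>k\<in>{1..n}. \<Sum>i<n. \<Sum>j<n. cnj (x i) * y j * (v k i * cnj (v k j)))"
    unfolding cip_def sum_product by (simp only: mult_ac)
  also have "\<dots> = (\<Sum>i<n. \<Sum>k\<in>{1..n}. \<Sum>j<n. cnj (x i) * y j * (v k i * cnj (v k j)))" by (rule sum.swap)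
  also have "\<dots> = (\<Sum>i<n. \<Sum>j<n. \<Sum>k\<in>{1..n}. cnj (x i) * y j * (v k i * cnj (v k j)))"
    by (intro sum.cong refl sum.swap)
  also have "\<dots> = (\<Sum>i<n. \<Sum>j<n. if j = i then cnj (x i) * y j else 0)"
    unfolding sum_distrib_left[symmetric]
    by (intro sum.cong refl) (simp add: orthonormal_sys_complete[OF assms] del: One_nat_def)
  also have "\<dots> = cip n x y" by (simp add: cip_def)
  finally show ?thesis by simp
qed

lemma cip_mult_cnj: "cip n y x * cip n x y = complex_of_real ((cmod (cip n x y))\<^sup>2)"
  by (subst cip_cnj[symmetric]) (simp only: complex_norm_square mult.commute)

lemma sum_cmod_coords:
  assumes "orthonormal_sys n v {1..n}"
  shows "(\<Sum>k\<in>{1..n}. (cmod (cip n (v k) y))\<^sup>2) = (\<Sum>i<n. (cmod (y i))\<^sup>2)"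
proof -
  have "complex_of_real (\<Sum>k\<in>{1..n}. (cmod (cip n (v k) y))\<^sup>2) = (\<Sum>k\<in>{1..n}. cip n y (v k) * cip n (v k) y)"
    unfolding of_real_sum by (simp only: cip_mult_cnj)
  also have "\<dots> = complex_of_real (\<Sum>i<n. (cmod (y i))\<^sup>2)"
    using cip_parseval[OF assms, of y y] cip_self[of n y] by simp
  finally show ?thesis by (simp only: of_real_eq_iff)
qed

lemma sum_rank_one_form:
  "(\<Sum>i<n. \<Sum>j<n. \<Sum>k\<in>K. c k * (cnj (x i) * a k i) * (cnj (a k j) * y j))
    = (\<Sum>k\<in>K. c k * (cip n x (a k) * cip n (a k) y))"
proof -
  have "(\<Sum>i<n. \<Sum>j<n. \<Sum>k\<in>K. c k * (cnj (x i) * a k i) * (cnj (a k j) * y j))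
      = (\<Sum>i<n. \<Sum>k\<in>K. \<Sum>j<n. c k * (cnj (x i) * a k i) * (cnj (a k j) * y j))"
    by (intro sum.cong refl sum.swap)
  also have "\<dots> = (\<Sum>k\<in>K. \<Sum>i<n. \<Sum>j<n. c k * (cnj (x i) * a k i) * (cnj (a k j) * y j))"
    by (rule sum.swap)
  also have "\<dots> = (\<Sum>k\<in>K. c k * (cip n x (a k) * cip n (a k) y))"
    unfolding cip_def sum_product unfolding sum_distrib_left by (simp only: mult_ac)
  finally show ?thesis .
qed

lemma eigensystem_quadratic_form:
  assumes "eigensystem n X f v"
  shows "(\<Sum>i<n. \<Sum>j<n. cnj (y i) * X $$ (i,j) * y j)
    = complex_of_real (\<Sum>k\<in>{1..n}. f k * (cmod (cip n (v k) y))\<^sup>2)"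
proof -
  have "(\<Sum>i<n. \<Sum>j<n. cnj (y i) * X $$ (i,j) * y j)
      = (\<Sum>i<n. \<Sum>j<n. \<Sum>k\<in>{1..n}. complex_of_real (f k) * (cnj (y i) * v k i) * (cnj (v k j) * y j))"
    by (intro sum.cong refl)
       (simp add: eigensystem_spectral_sum[OF assms] sum_distrib_left sum_distrib_right mult_ac)
  also have "\<dots> = (\<Sum>k\<in>{1..n}. complex_of_real (f k) * (cip n y (v k) * cip n (v k) y))"
    by (rule sum_rank_one_form)
  also have "\<dots> = complex_of_real (\<Sum>k\<in>{1..n}. f k * (cmod (cip n (v k) y))\<^sup>2)"
    unfolding of_real_sum of_real_mult by (simp only: cip_mult_cnj)
  finally show ?thesis .
qed

lemma perturbed_quadratic_form:
  assumes X: "eigensystem n X f v" and Y: "eigensystem n (perturbed n X r \<theta> u) g w"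
  shows "(\<Sum>k\<in>{1..n}. g k * (cmod (cip n (w k) y))\<^sup>2)
    = (\<Sum>k\<in>{1..n}. f k * (cmod (cip n (v k) y))\<^sup>2) + (\<Sum>l\<in>{1..r}. \<theta> l * (cmod (cip n (u l) y))\<^sup>2)"
proof -
  let ?Y = "perturbed n X r \<theta> u"
  have "complex_of_real (\<Sum>k\<in>{1..n}. g k * (cmod (cip n (w k) y))\<^sup>2)
      = (\<Sum>i<n. \<Sum>j<n. cnj (y i) * ?Y $$ (i,j) * y j)"
    by (rule eigensystem_quadratic_form[OF Y, symmetric])
  also have "\<dots> = (\<Sum>i<n. \<Sum>j<n. cnj (y i) * X $$ (i,j) * y j
        + (\<Sum>l\<in>{1..r}. complex_of_real (\<theta> l) * (cnj (y i) * u l i) * (cnj (u l j) * y j)))"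
    by (intro sum.cong refl) (simp add: perturbed_def sum_distrib_left sum_distrib_right algebra_simps)
  also have "\<dots> = (\<Sum>i<n. \<Sum>j<n. cnj (y i) * X $$ (i,j) * y j)
        + (\<Sum>i<n. \<Sum>j<n. \<Sum>l\<in>{1..r}. complex_of_real (\<theta> l) * (cnj (y i) * u l i) * (cnj (u l j) * y j))"
    by (simp only: sum.distrib)
  also have "(\<Sum>i<n. \<Sum>j<n. \<Sum>l\<in>{1..r}. complex_of_real (\<theta> l) * (cnj (y i) * u l i) * (cnj (u l j) * y j))
      = (\<Sum>l\<in>{1..r}. complex_of_real (\<theta> l) * (cip n y (u l) * cip n (u l) y))"
    by (rule sum_rank_one_form)
  also have "\<dots> = complex_of_real (\<Sum>l\<in>{1..r}. \<theta> l * (cmod (cip n (u l) y))\<^sup>2)"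
    unfolding of_real_sum of_real_mult by (simp only: cip_mult_cnj)
  also have "(\<Sum>i<n. \<Sum>j<n. cnj (y i) * X $$ (i,j) * y j)
      = complex_of_real (\<Sum>k\<in>{1..n}. f k * (cmod (cip n (v k) y))\<^sup>2)"
    by (rule eigensystem_quadratic_form[OF X])
  finally show ?thesis by (simp only: of_real_add[symmetric] of_real_eq_iff)
qed

text \<open>Serves both completions of the square in \<open>perturbed_inertia\<close>.\<close>

lemma cmod_diff_scaled_sq:
  fixes a c :: complex and t :: real
  shows "(cmod (c - complex_of_real t * a))\<^sup>2 = (cmod c)\<^sup>2 - 2 * t * Re (cnj a * c) + t\<^sup>2 * (cmod a)\<^sup>2"
  unfolding cmod_power2 by (simp add: power2_eq_square algebra_simps)

lemma coords_of_combination: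
  assumes "orthonormal_sys n w {1..n}" "J \<subseteq> {1..n}" "k \<in> {1..n}"
  shows "cip n (w k) (\<lambda>i. \<Sum>j\<in>J. t j * w j i) = (if k \<in> J then t k else 0)"
proof -
  have "finite J" using assms(2) finite_subset by blast
  have "cip n (w k) (\<lambda>i. \<Sum>j\<in>J. t j * w j i) = (\<Sum>j\<in>J. t j * cip n (w k) (w j))"
    by (rule cip_sum_right)
  also have "\<dots> = (\<Sum>j\<in>J. if j = k then t j else 0)"
    using assms by (intro sum.cong refl) (auto simp: orthonormal_sys_def)
  also have "\<dots> = (if k \<in> J then t k else 0)" using \<open>finite J\<close> by simp
  finally show ?thesis .
qed

text \<open>Haynsworth inertia additivity for the bordered matrix with blocks \<open>X - z\<close>, \<open>U\<close> and
  \<open>- \<Theta>\<inverse>\<close>: its quadratic form \<open>B(y, c)\<close> is diagonalized by completing the square either in \<open>c\<close>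
  or in \<open>y\<close>, and a dimension count rules out that the two signatures disagree.\<close>

lemma perturbed_inertia:
  assumes X: "eigensystem n X f v" and Y: "eigensystem n (perturbed n X r \<theta> u) g w"
    and z: "\<And>k. k \<in> {1..n} \<Longrightarrow> f k \<noteq> z"
    and \<theta>: "\<And>l. l \<in> {1..r} \<Longrightarrow> \<theta> l \<noteq> 0" and N: "N \<subseteq> {1..r}"
    and pos: "\<And>c. (\<forall>l\<in>N. c l = 0) \<Longrightarrow> (\<Sum>l\<in>{1..r}. (cmod (c l))\<^sup>2 / \<theta> l)
        \<le> (\<Sum>k\<in>{1..n}. (cmod (\<Sum>l\<in>{1..r}. cip n (v k) (u l) * c l))\<^sup>2 / (z - f k))"
  shows "card {j\<in>{1..n}. g j < z} + card {l\<in>{1..r}. 0 < \<theta> l} \<le> card {k\<in>{1..n}. f k < z} + card N"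
proof (rule ccontr)
  assume less: "\<not> ?thesis"
  define J1 where "J1 = {j\<in>{1..n}. g j < z}"
  define K1 where "K1 = {k\<in>{1..n}. f k < z}"
  define R where "R = {l\<in>{1..r}. \<theta> l < 0}"
  have fin: "finite J1" "finite K1" "finite R" "finite N"
    using N by (auto simp: J1_def K1_def R_def intro: finite_subset)
  have "{1..r} = R \<union> {l\<in>{1..r}. 0 < \<theta> l}" using \<theta> by (force simp: R_def)
  then have "card {1..r} = card (R \<union> {l\<in>{1..r}. 0 < \<theta> l})" by (rule arg_cong)
  also have "\<dots> = card R + card {l\<in>{1..r}. 0 < \<theta> l}"
    by (rule card_Un_disjoint) (auto simp: R_def)
  finally have "card (K1 <+> (N <+> R)) < card (J1 <+> {1..r})"
    using less fin by (simp add: card_Plus J1_def K1_def)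
  \<comment> \<open>The unknowns are the coefficients of \<open>y\<close> on the eigenvectors of the
    perturbed matrix with eigenvalue below \<open>z\<close> (\<open>Inl\<close>) and the vector
    \<open>c\<close> (\<open>Inr\<close>). The three blocks of equations express \<open>c1\<close>,
    \<open>c2\<close> and \<open>c3\<close> below: they remove the squares of the wrong sign from
    the two diagonalizations and make \<open>pos\<close> applicable to \<open>c\<close>.\<close>
  define A where "A = (\<lambda>i j. case i of
       Inl k \<Rightarrow> (case j of Inl j \<Rightarrow> complex_of_real (z - f k) * cip n (v k) (w j) | Inr l \<Rightarrow> - cip n (v k) (u l))
     | Inr (Inl l) \<Rightarrow> (case j of Inl j \<Rightarrow> 0 | Inr l' \<Rightarrow> if l' = l then 1 else 0)
     | Inr (Inr l) \<Rightarrow> (case j of Inl j \<Rightarrow> complex_of_real (\<theta> l) * cip n (u l) (w j) | Inr l' \<Rightarrow> if l' = l then - 1 else 0))"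
  obtain t where t: "\<exists>j\<in>J1 <+> {1..r}. t j \<noteq> 0"
      "\<forall>i\<in>K1 <+> (N <+> R). (\<Sum>j\<in>J1 <+> {1..r}. A i j * t j) = 0"
    using underdetermined_system[OF _ _ \<open>card _ < card _\<close>, of A] fin by auto
  define y where "y = (\<lambda>i. \<Sum>j\<in>J1. t (Inl j) * w j i)"
  define c where "c = (\<lambda>l. t (Inr l))"
  define a where "a = (\<lambda>l. cip n (u l) y)"
  define b where "b = (\<lambda>k. cip n (v k) y)"
  define s where "s = (\<lambda>k. \<Sum>l\<in>{1..r}. cip n (v k) (u l) * c l)"
  have cy: "cip n x y = (\<Sum>j\<in>J1. t (Inl j) * cip n x (w j))" for x
    unfolding y_def by (rule cip_sum_right)
  have c1: "s k = complex_of_real (z - f k) * b k" if "k \<in> K1" for k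
  proof -
    have "(\<Sum>j\<in>J1 <+> {1..r}. A (Inl k) j * t j) = 0" using t(2) that by blast
    then have "(\<Sum>j\<in>J1. complex_of_real (z - f k) * cip n (v k) (w j) * t (Inl j))
       + (\<Sum>l\<in>{1..r}. - cip n (v k) (u l) * t (Inr l)) = 0"
      using fin by (simp add: sum.Plus A_def comp_def)
    then show ?thesis
      by (simp add: s_def b_def c_def cy sum_distrib_left sum_negf mult_ac)
  qed
  have c2: "c l = 0" if "l \<in> N" for l
  proof -
    have "(\<Sum>j\<in>J1 <+> {1..r}. A (Inr (Inl l)) j * t j) = 0" using t(2) that by blast
    moreover have "l \<in> {1..r}" using N that by blast
    ultimately show ?thesis
      using fin by (simp add: sum.Plus A_def comp_def c_def mult_delta_left)
  qed
  have c3: "c l = complex_of_real (\<theta> l) * a l" if "l \<in> R" for l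
  proof -
    have "(\<Sum>j\<in>J1 <+> {1..r}. A (Inr (Inr l)) j * t j) = 0" using t(2) that by blast
    then have "(\<Sum>j\<in>J1. complex_of_real (\<theta> l) * cip n (u l) (w j) * t (Inl j))
       + (\<Sum>l'\<in>{1..r}. if l' = l then - t (Inr l') else 0) = 0"
      using fin by (simp add: sum.Plus A_def comp_def if_distrib if_distribR cong: if_cong)
    moreover have "l \<in> {1..r}" using that by (simp add: R_def)
    ultimately show ?thesis
      by (simp add: a_def c_def cy sum_distrib_left mult_ac)
  qed
  have onv: "orthonormal_sys n v {1..n}" and onw: "orthonormal_sys n w {1..n}"
    using X Y by (auto simp: eigensystem_def)
  define B where "B = (\<Sum>k\<in>{1..n}. (f k - z) * (cmod (b k))\<^sup>2) + 2 * Re (\<Sum>l\<in>{1..r}. cnj (a l) * c l)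
     - (\<Sum>l\<in>{1..r}. (cmod (c l))\<^sup>2 / \<theta> l)"
  have cross: "(\<Sum>l\<in>{1..r}. cnj (a l) * c l) = (\<Sum>k\<in>{1..n}. cnj (b k) * s k)"
  proof -
    have "(\<Sum>l\<in>{1..r}. cnj (a l) * c l) = (\<Sum>l\<in>{1..r}. \<Sum>k\<in>{1..n}. cnj (b k) * cip n (v k) (u l) * c l)"
      unfolding a_def b_def cip_cnj
      by (subst cip_parseval[OF onv]) (simp only: sum_distrib_right)
    also have "\<dots> = (\<Sum>k\<in>{1..n}. \<Sum>l\<in>{1..r}. cnj (b k) * cip n (v k) (u l) * c l)" by (rule sum.swap)
    finally show ?thesis by (simp only: s_def sum_distrib_left mult.assoc)
  qed
  \<comment> \<open>Completing the square in \<open>y\<close>: the squares with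
    \<open>f k < z\<close> vanish by \<open>c1\<close>, those with \<open>f k > z\<close> are
    nonnegative, and the remainder is nonnegative by \<open>pos\<close>.\<close>
  have "B \<ge> 0"
  proof -
    have "(cmod (s k))\<^sup>2 / (z - f k) \<le> (f k - z) * (cmod (b k))\<^sup>2 + 2 * Re (cnj (b k) * s k)"
      if k: "k \<in> {1..n}" for k
    proof -
      have fz: "f k - z \<noteq> 0" using z[OF k] by simp
      have eq: "(f k - z) * (cmod (b k))\<^sup>2 + 2 * Re (cnj (b k) * s k) - (cmod (s k))\<^sup>2 / (z - f k)
         = (cmod (s k - complex_of_real (z - f k) * b k))\<^sup>2 / (f k - z)"
        using fz unfolding cmod_diff_scaled_sq
        by (simp add: divide_simps) (simp add: power2_eq_square algebra_simps)
      have "(cmod (s k - complex_of_real (z - f k) * b k))\<^sup>2 / (f k - z) \<ge> 0"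
      proof (cases "k \<in> K1")
        case True
        then show ?thesis using c1 by simp
      next
        case False
        then have "f k - z > 0" using k z[OF k] by (simp add: K1_def)
        then show ?thesis by simp
      qed
      then show ?thesis using eq by linarith
    qed
    then have "(\<Sum>k\<in>{1..n}. (cmod (s k))\<^sup>2 / (z - f k))
       \<le> (\<Sum>k\<in>{1..n}. (f k - z) * (cmod (b k))\<^sup>2 + 2 * Re (cnj (b k) * s k))" by (rule sum_mono)
    also have "\<dots> = (\<Sum>k\<in>{1..n}. (f k - z) * (cmod (b k))\<^sup>2) + 2 * Re (\<Sum>k\<in>{1..n}. cnj (b k) * s k)"
      by (simp only: sum.distrib sum_distrib_left Re_sum)
    finally show ?thesis using pos[of c] c2 unfolding B_def cross s_def by simp
  qed
  \<comment> \<open>Completing the square in \<open>c\<close> instead shows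
    \<open>B \<le> 0\<close>: the eigenvalues involved lie below \<open>z\<close>, and the terms
    with negative \<open>\<theta> l\<close> vanish by \<open>c3\<close>. Hence every summand is
    zero.\<close>
  moreover have Beq: "B = (\<Sum>j\<in>J1. (g j - z) * (cmod (t (Inl j)))\<^sup>2)
      - (\<Sum>l\<in>{1..r}. (cmod (c l - complex_of_real (\<theta> l) * a l))\<^sup>2 / \<theta> l)"
  proof -
    have "(\<Sum>l\<in>{1..r}. (cmod (c l - complex_of_real (\<theta> l) * a l))\<^sup>2 / \<theta> l)
       = (\<Sum>l\<in>{1..r}. (cmod (c l))\<^sup>2 / \<theta> l - 2 * Re (cnj (a l) * c l) + \<theta> l * (cmod (a l))\<^sup>2)"
      unfolding cmod_diff_scaled_sq
      by (intro sum.cong refl) (simp add: \<theta> add_divide_distrib diff_divide_distrib power2_eq_square)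
    also have "\<dots> = (\<Sum>l\<in>{1..r}. (cmod (c l))\<^sup>2 / \<theta> l) - 2 * Re (\<Sum>l\<in>{1..r}. cnj (a l) * c l)
       + (\<Sum>l\<in>{1..r}. \<theta> l * (cmod (a l))\<^sup>2)"
      by (simp only: sum.distrib sum_subtractf sum_distrib_left Re_sum)
    finally have 1: "B + (\<Sum>l\<in>{1..r}. (cmod (c l - complex_of_real (\<theta> l) * a l))\<^sup>2 / \<theta> l)
       = (\<Sum>k\<in>{1..n}. (f k - z) * (cmod (b k))\<^sup>2) + (\<Sum>l\<in>{1..r}. \<theta> l * (cmod (a l))\<^sup>2)"
      unfolding B_def by simp
    also have "\<dots> = (\<Sum>k\<in>{1..n}. (g k - z) * (cmod (cip n (w k) y))\<^sup>2)"
      using perturbed_quadratic_form[OF X Y, of y] sum_cmod_coords[OF onv, of y] sum_cmod_coords[OF onw, of y]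
      by (simp add: a_def b_def left_diff_distrib sum_subtractf sum_distrib_left[symmetric])
    also have "\<dots> = (\<Sum>k\<in>{1..n}. if k \<in> J1 then (g k - z) * (cmod (t (Inl k)))\<^sup>2 else 0)"
      unfolding y_def
      by (intro sum.cong refl, subst coords_of_combination[OF onw]) (auto simp: J1_def)
    also have "\<dots> = (\<Sum>j\<in>J1. (g j - z) * (cmod (t (Inl j)))\<^sup>2)"
      by (subst sum.inter_filter[symmetric]) (auto simp: J1_def intro!: sum.cong)
    finally show ?thesis by simp
  qed
  moreover have t1: "(g j - z) * (cmod (t (Inl j)))\<^sup>2 \<le> 0" if "j \<in> J1" for j
    using that by (intro mult_nonpos_nonneg) (auto simp: J1_def)
  moreover have t2: "(cmod (c l - complex_of_real (\<theta> l) * a l))\<^sup>2 / \<theta> l \<ge> 0" if "l \<in> {1..r}" for l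
  proof (cases "l \<in> R")
    case True
    then show ?thesis using c3 by simp
  next
    case False
    then have "\<theta> l > 0" using that \<theta>[OF that] by (simp add: R_def)
    then show ?thesis by simp
  qed
  ultimately have "(\<Sum>j\<in>J1. (g j - z) * (cmod (t (Inl j)))\<^sup>2) = 0"
     "(\<Sum>l\<in>{1..r}. (cmod (c l - complex_of_real (\<theta> l) * a l))\<^sup>2 / \<theta> l) = 0"
    using sum_nonpos[of J1 "\<lambda>j. (g j - z) * (cmod (t (Inl j)))\<^sup>2"]
      sum_nonneg[of "{1..r}" "\<lambda>l. (cmod (c l - complex_of_real (\<theta> l) * a l))\<^sup>2 / \<theta> l"] by auto
  then have "(\<Sum>j\<in>J1. - ((g j - z) * (cmod (t (Inl j)))\<^sup>2)) = 0"
    "(\<Sum>l\<in>{1..r}. (cmod (c l - complex_of_real (\<theta> l) * a l))\<^sup>2 / \<theta> l) = 0"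
    by (simp_all add: sum_negf)
  then have e1: "\<And>j. j \<in> J1 \<Longrightarrow> - ((g j - z) * (cmod (t (Inl j)))\<^sup>2) = 0"
    and e2: "\<And>l. l \<in> {1..r} \<Longrightarrow> (cmod (c l - complex_of_real (\<theta> l) * a l))\<^sup>2 / \<theta> l = 0"
    using fin t1 t2 by (subst (asm) sum_nonneg_eq_0_iff; auto)+
  \<comment> \<open>The inequality \<open>g j < z\<close> is strict on \<open>J1\<close>, so the
    \<open>y\<close> part vanishes; then \<open>a = 0\<close>, and the vanishing squares give
    \<open>c = 0\<close>, contrary to the choice of \<open>t\<close>.\<close>
  have z1: "t (Inl j) = 0" if "j \<in> J1" for j
    using e1[OF that] that by (auto simp: J1_def)
  then have "a l = 0" for l by (simp add: a_def cy)
  then have "t (Inr l) = 0" if "l \<in> {1..r}" for l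
    using e2[OF that] \<theta>[OF that] by (simp add: c_def)
  with z1 t(1) show False by auto
qed

text \<open>Courant-Fischer by a dimension count: in the span of \<open>w j, ..., w n\<close>, of
  dimension \<open>n - j + 1\<close>, the \<open>n - j\<close> conditions of orthogonality to the
  last \<open>v k\<close> and to all \<open>u l\<close> leave a nonzero vector, on which the two
  quadratic forms coincide.\<close>

lemma perturbed_interlacing:
  assumes X: "eigensystem n X f v" and Y: "eigensystem n (perturbed n X r \<theta> u) g w"
    and j: "1 \<le> j" "j + r \<le> n"
  shows "g j \<le> f (j + r)"
proof -
  define A where "A = (\<lambda>i k. case i of Inl l \<Rightarrow> cip n (v l) (w k) | Inr l \<Rightarrow> cip n (u l) (w k))"
  have "card ({j+r+1..n} <+> {1..r}) < card {j..n}" using j by (simp add: card_Plus)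
  from underdetermined_system[OF _ _ this, of A] obtain t where
    t: "\<exists>k\<in>{j..n}. t k \<noteq> 0" "\<forall>i\<in>{j+r+1..n} <+> {1..r}. (\<Sum>k\<in>{j..n}. A i k * t k) = 0" by auto
  define y where "y = (\<lambda>i. \<Sum>k\<in>{j..n}. t k * w k i)"
  have onv: "orthonormal_sys n v {1..n}" and onw: "orthonormal_sys n w {1..n}"
    using X Y by (auto simp: eigensystem_def)
  have cy: "cip n x y = (\<Sum>k\<in>{j..n}. cip n x (w k) * t k)" for x
    unfolding y_def cip_sum_right by (simp only: mult.commute)
  have v0: "cip n (v k) y = 0" if "k \<in> {j+r+1..n}" for k
  proof -
    have "(\<Sum>i\<in>{j..n}. A (Inl k) i * t i) = 0" using t(2) that by blast
    then show ?thesis by (simp add: cy A_def)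
  qed
  have u0: "cip n (u l) y = 0" if "l \<in> {1..r}" for l
  proof -
    have "(\<Sum>i\<in>{j..n}. A (Inr l) i * t i) = 0" using t(2) that by blast
    then show ?thesis by (simp add: cy A_def)
  qed
  have wy: "cip n (w k) y = (if k \<in> {j..n} then t k else 0)" if "k \<in> {1..n}" for k
    unfolding y_def by (rule coords_of_combination[OF onw _ that]) (use j in auto)
  have fm: "f k \<le> f l" and gm: "g k \<le> g l" if "1 \<le> k" "k \<le> l" "l \<le> n" for k l
    using X Y that by (auto simp: eigensystem_def)
  define S where "S = (\<Sum>k\<in>{1..n}. (cmod (cip n (w k) y))\<^sup>2)"
  have "S > 0"
  proof -
    from t(1) obtain k where k: "k \<in> {j..n}" "t k \<noteq> 0" by blast
    then have "0 < (cmod (cip n (w k) y))\<^sup>2" using wy[of k] j by simp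
    also have "\<dots> \<le> S" unfolding S_def by (rule member_le_sum) (use k j in auto)
    finally show ?thesis .
  qed
  have "g j * S = (\<Sum>k\<in>{1..n}. g j * (cmod (cip n (w k) y))\<^sup>2)" by (simp add: S_def sum_distrib_left)
  also have "\<dots> \<le> (\<Sum>k\<in>{1..n}. g k * (cmod (cip n (w k) y))\<^sup>2)"
  proof (rule sum_mono)
    fix k assume k: "k \<in> {1..n}"
    show "g j * (cmod (cip n (w k) y))\<^sup>2 \<le> g k * (cmod (cip n (w k) y))\<^sup>2"
    proof (cases "k \<ge> j")
      case True
      then show ?thesis using gm[of j k] j k by (intro mult_right_mono) auto
    next
      case False
      then show ?thesis using wy[OF k] by simp
    qed
  qed
  also have "\<dots> = (\<Sum>k\<in>{1..n}. f k * (cmod (cip n (v k) y))\<^sup>2)"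
    unfolding perturbed_quadratic_form[OF X Y] using u0 by simp
  also have "\<dots> \<le> (\<Sum>k\<in>{1..n}. f (j + r) * (cmod (cip n (v k) y))\<^sup>2)"
  proof (rule sum_mono)
    fix k assume k: "k \<in> {1..n}"
    show "f k * (cmod (cip n (v k) y))\<^sup>2 \<le> f (j + r) * (cmod (cip n (v k) y))\<^sup>2"
    proof (cases "k \<le> j + r")
      case True
      then show ?thesis using fm[of k "j + r"] j k by (intro mult_right_mono) auto
    next
      case False
      then show ?thesis using v0[of k] k by simp
    qed
  qed
  also have "\<dots> = f (j + r) * S"
    unfolding S_def using sum_cmod_coords[OF onv, of y] sum_cmod_coords[OF onw, of y]
    by (simp add: sum_distrib_left[symmetric])
  finally show ?thesis using \<open>S > 0\<close> by simp
qed

section \<open>Fourth moments and concentration of quadratic forms\<close>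

text \<open>With \<open>m\<^sup>2 = \<integral> f\<^sup>2\<close>, integrate \<open>f\<^sup>2 ln (f\<^sup>2 / m\<^sup>2) \<ge> 2 (f\<^sup>2 - m f)\<close>, which is \<open>ln t \<ge> 1 - 1 / t\<close>
  at \<open>t = f / m\<close>.\<close>

lemma entropy_sq_ge_variance:
  fixes f :: "complex \<Rightarrow> real"
  assumes "prob_space \<nu>" and [measurable]: "f \<in> borel_measurable \<nu>"
    and f: "\<And>z. 0 \<le> f z" "\<And>z. f z \<le> B"
  shows "(\<integral>z. (f z)\<^sup>2 \<partial>\<nu>) - (\<integral>z. f z \<partial>\<nu>)\<^sup>2 \<le> Defs.entropy \<nu> (\<lambda>z. (f z)\<^sup>2)"
proof -
  interpret prob_space \<nu> by fact
  have B: "B \<ge> 0" using f[of undefined] by linarith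
  have int: "integrable \<nu> f" "integrable \<nu> (\<lambda>z. (f z)\<^sup>2)"
  proof -
    show "integrable \<nu> f" by (rule integrable_const_bound[where B = B]) (use f in auto)
    have "(f z)\<^sup>2 \<le> B\<^sup>2" for z using f[of z] by (intro power_mono) auto
    then show "integrable \<nu> (\<lambda>z. (f z)\<^sup>2)" by (intro integrable_const_bound[where B = "B\<^sup>2"]) auto
  qed
  have tlt: "\<bar>t * ln t\<bar> \<le> 1 + t\<^sup>2" if "t \<ge> 0" for t :: real
  proof (cases "t = 0")
    case False
    with that have t: "t > 0" by simp
    have "t * ln t \<le> t * (t - 1)" using t ln_le_minus_one by (intro mult_left_mono) auto
    moreover have "ln (inverse t) \<le> inverse t - 1" using t by (intro ln_le_minus_one) auto
    then have "t * (- ln t) \<le> t * (inverse t - 1)" using t by (intro mult_left_mono) (auto simp: ln_inverse)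
    then have "- (t * ln t) \<le> 1 - t" using t by (simp add: algebra_simps)
    ultimately show ?thesis using t by (simp add: abs_le_iff power2_eq_square algebra_simps) (smt (verit) zero_le_square)
  qed simp
  have int2: "integrable \<nu> (\<lambda>z. (f z)\<^sup>2 * ln ((f z)\<^sup>2))"
  proof (rule integrable_const_bound[where B = "1 + (B\<^sup>2)\<^sup>2"])
    have "\<bar>(f z)\<^sup>2 * ln ((f z)\<^sup>2)\<bar> \<le> 1 + ((f z)\<^sup>2)\<^sup>2" for z by (intro tlt) auto
    moreover have "((f z)\<^sup>2)\<^sup>2 \<le> (B\<^sup>2)\<^sup>2" for z using f[of z] by (intro power_mono) auto
    ultimately show "AE z in \<nu>. norm ((f z)\<^sup>2 * ln ((f z)\<^sup>2)) \<le> 1 + (B\<^sup>2)\<^sup>2"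
      by (intro AE_I2) (smt (verit) real_norm_def)
  qed simp
  define V where "V = (\<integral>z. (f z)\<^sup>2 \<partial>\<nu>)"
  define I where "I = (\<integral>z. f z \<partial>\<nu>)"
  have I: "I \<ge> 0" unfolding I_def using f by (intro integral_nonneg_AE) auto
  have V: "V \<ge> 0" unfolding V_def by (intro integral_nonneg_AE) auto
  show ?thesis
  proof (cases "V = 0")
    case True
    have "AE z in \<nu>. (f z)\<^sup>2 = 0"
      using True int(2) unfolding V_def by (subst (asm) integral_nonneg_eq_0_iff_AE) auto
    then have "AE z in \<nu>. (f z)\<^sup>2 * ln ((f z)\<^sup>2) = 0" by eventually_elim simp
    then have "(\<integral>z. (f z)\<^sup>2 * ln ((f z)\<^sup>2) \<partial>\<nu>) = 0"
      by (subst integral_cong_AE[where g = "\<lambda>_. 0"]) auto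
    then have "Defs.entropy \<nu> (\<lambda>z. (f z)\<^sup>2) = 0"
      using True unfolding Defs.entropy_def V_def by simp
    then show ?thesis using True V_def by simp
  next
    case False
    with V have V: "V > 0" by simp
    define m where "m = sqrt V"
    have m: "m > 0" "m\<^sup>2 = V" using V by (auto simp: m_def)
    have pt: "(f z)\<^sup>2 * ln ((f z)\<^sup>2) \<ge> (f z)\<^sup>2 * ln V + 2 * ((f z)\<^sup>2 - m * f z)" for z
    proof (cases "f z = 0")
      case False
      with f[of z] have fz: "f z > 0" by (simp add: less_le)
      have "ln (m / f z) \<le> m / f z - 1" using fz m by (intro ln_le_minus_one) auto
      then have "ln (f z) - ln m \<ge> 1 - m / f z" using fz m by (simp add: ln_div)
      then have "(f z)\<^sup>2 * (ln (f z) - ln m) \<ge> (f z)\<^sup>2 * (1 - m / f z)" by (intro mult_left_mono) auto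
      also have "(f z)\<^sup>2 * (1 - m / f z) = (f z)\<^sup>2 - m * f z" using fz by (simp add: field_simps power2_eq_square)
      finally have "(f z)\<^sup>2 * (ln (f z) - ln m) \<ge> (f z)\<^sup>2 - m * f z" .
      moreover have "ln V = 2 * ln m" using m by (simp add: m(2)[symmetric] ln_realpow)
      moreover have "ln ((f z)\<^sup>2) = 2 * ln (f z)" using fz by (simp add: ln_realpow)
      ultimately show ?thesis by (simp add: algebra_simps)
    qed simp
    have "(\<integral>z. (f z)\<^sup>2 * ln V + 2 * ((f z)\<^sup>2 - m * f z) \<partial>\<nu>) \<le> (\<integral>z. (f z)\<^sup>2 * ln ((f z)\<^sup>2) \<partial>\<nu>)"
      using int int2 by (intro integral_mono pt) auto
    also have "(\<integral>z. (f z)\<^sup>2 * ln V + 2 * ((f z)\<^sup>2 - m * f z) \<partial>\<nu>) = V * ln V + 2 * (V - m * I)"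
      using int unfolding V_def I_def by simp
    finally have 1: "Defs.entropy \<nu> (\<lambda>z. (f z)\<^sup>2) \<ge> 2 * (V - m * I)"
      unfolding Defs.entropy_def V_def[symmetric] by simp
    \<comment> \<open>This square is exactly the difference between \<open>2 * (V - m * I)\<close>
      and the variance \<open>V - I^2\<close>.\<close>
    have "(m - I)\<^sup>2 \<ge> 0" by simp
    then show ?thesis using 1 m(2) unfolding V_def[symmetric] I_def[symmetric]
      by (simp add: power2_eq_square algebra_simps)
  qed
qed

text \<open>Testing the inequality on \<open>f z = (cmod z)\<^sup>2 / (1 + e (cmod z)\<^sup>2)\<close>, whose variance is
  controlled because \<open>\<bar>\<nabla> f z\<bar> \<le> 2 cmod z\<close>, and letting \<open>e\<close> tend to \<open>0\<close>.\<close>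

lemma log_sobolev_fourth_moment:
  assumes A1: "assumption_A1 \<nu>"
  shows "integrable \<nu> (\<lambda>z. (cmod z) ^ 4)"
proof -
  interpret prob_space \<nu> using A1 by (simp add: assumption_A1_def)
  have sets[measurable_cong]: "sets \<nu> = sets borel" using A1 by (simp add: assumption_A1_def)
  have i2: "integrable \<nu> (\<lambda>z. (cmod z)\<^sup>2)" and e2: "(\<integral>z. (cmod z)\<^sup>2 \<partial>\<nu>) = 1"
    using A1 by (auto simp: assumption_A1_def)
  obtain c where c: "c > 0" and lsi: "\<And>f D. (\<And>z. (f has_derivative D z) (at z)) \<Longrightarrow> bounded (range f) \<Longrightarrow>
     bounded ((\<lambda>z. onorm (D z)) ` UNIV) \<Longrightarrow>
     Defs.entropy \<nu> (\<lambda>z. (f z)\<^sup>2) \<le> 2 * c * (\<integral>z. (onorm (D z))\<^sup>2 \<partial>\<nu>)"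
    using A1 by (auto simp: assumption_A1_def log_sobolev_def)
  \<comment> \<open>The constant: the entropy is at most \<open>2 * c\<close> times the integral of
    \<open>4 * (cmod z)^2\<close>, that is \<open>8 * c\<close>, and the squared mean of the test
    function is at most 1. It does not depend on \<open>e\<close>.\<close>
  have bound: "(\<integral>z. ((cmod z)\<^sup>2 / (1 + e * (cmod z)\<^sup>2))\<^sup>2 \<partial>\<nu>) \<le> 8 * c + 1" if e: "e > 0" for e :: real
  proof -
    define f where "f = (\<lambda>z. (cmod z)\<^sup>2 / (1 + e * (cmod z)\<^sup>2))"
    define D where "D = (\<lambda>(z::complex) h. 2 * inner z h / (1 + e * (cmod z)\<^sup>2)\<^sup>2)"
    have pos: "1 + e * (cmod z)\<^sup>2 \<ge> 1" for z using e by simp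
    have pos': "1 + e * (cmod z)\<^sup>2 \<noteq> 0" for z using pos[of z] by linarith
    have f0: "0 \<le> f z" for z using pos[of z] by (simp add: f_def)
    have f1: "f z \<le> 1 / e" for z
      unfolding f_def by (rule mult_imp_div_pos_le) (use e in \<open>simp_all add: distrib_left add_pos_nonneg\<close>)
    have f2: "f z \<le> (cmod z)\<^sup>2" for z
      unfolding f_def using divide_left_mono[of 1 "1 + e * (cmod z)\<^sup>2" "(cmod z)\<^sup>2"] pos[of z] by simp
    have [measurable]: "f \<in> borel_measurable \<nu>" unfolding f_def by measurable
    have der: "(f has_derivative D z) (at z)" for z
    proof -
      have d: "((\<lambda>z. (cmod z)\<^sup>2) has_derivative (\<lambda>h. 2 * inner z h)) (at z)"
        unfolding power2_norm_eq_inner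
        by (auto intro!: derivative_eq_intros simp: inner_commute)
      have "(f has_derivative (\<lambda>h. (- (cmod z)\<^sup>2 * (inverse (1 + e * (cmod z)\<^sup>2) * (e * (2 * inner z h)) * inverse (1 + e * (cmod z)\<^sup>2)) + 2 * inner z h / (1 + e * (cmod z)\<^sup>2)))) (at z)"
        unfolding f_def
        by (rule has_derivative_eq_rhs, rule has_derivative_divide[OF d], rule has_derivative_add[OF has_derivative_const],
            rule has_derivative_mult_right[OF d], rule pos') simp
      moreover have "(- (cmod z)\<^sup>2 * (inverse (1 + e * (cmod z)\<^sup>2) * (e * (2 * inner z h)) * inverse (1 + e * (cmod z)\<^sup>2)) + 2 * inner z h / (1 + e * (cmod z)\<^sup>2)) = D z h" for h
        unfolding D_def using pos'[of z] by (simp add: divide_simps power2_eq_square) (simp add: algebra_simps)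
      ultimately show ?thesis by simp
    qed
    have on0: "0 \<le> onorm (D z)" for z
      using der[of z] by (intro onorm_pos_le) (rule has_derivative_bounded_linear)
    have on: "onorm (D z) \<le> 2 * cmod z / (1 + e * (cmod z)\<^sup>2)\<^sup>2" for z
    proof (rule onorm_bound)
      fix h
      have "\<bar>inner z h\<bar> \<le> cmod z * cmod h" by (rule Cauchy_Schwarz_ineq2)
      then show "norm (D z h) \<le> 2 * cmod z / (1 + e * (cmod z)\<^sup>2)\<^sup>2 * norm h"
        by (simp add: D_def abs_mult divide_right_mono)
    qed simp
    have pos2: "1 \<le> (1 + e * (cmod z)\<^sup>2)\<^sup>2" for z using pos[of z] by (simp add: one_le_power)
    have on1: "onorm (D z) \<le> 2 * cmod z" for z
      using on[of z] divide_left_mono[of 1 "(1 + e * (cmod z)\<^sup>2)\<^sup>2" "2 * cmod z"] pos2[of z] pos'[of z] by simp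
    \<comment> \<open>This bound depends on \<open>e\<close> and only makes \<open>f\<close>
      admissible as a test function; the estimate itself uses \<open>on1\<close>, which is free of
      \<open>e\<close>.\<close>
    have on2: "onorm (D z) \<le> 2 + 2 / e" for z
    proof (cases "cmod z \<le> 1")
      case True
      moreover have "0 < 2 / e" using e by simp
      ultimately show ?thesis using on1[of z] by linarith
    next
      case False
      have "2 * cmod z / (1 + e * (cmod z)\<^sup>2)\<^sup>2 \<le> 2 * (cmod z)\<^sup>2 / (1 + e * (cmod z)\<^sup>2)"
      proof (rule frac_le)
        show "2 * cmod z \<le> 2 * (cmod z)\<^sup>2" using False self_le_power[of "cmod z" 2] by simp
        show "1 + e * (cmod z)\<^sup>2 \<le> (1 + e * (cmod z)\<^sup>2)\<^sup>2" using pos[of z] by (simp add: power2_eq_square)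
      qed (use pos[of z] in auto)
      then show ?thesis using on[of z] f1[of z] by (simp add: f_def)
    qed
    have "Defs.entropy \<nu> (\<lambda>z. (f z)\<^sup>2) \<le> 2 * c * (\<integral>z. (onorm (D z))\<^sup>2 \<partial>\<nu>)"
    proof (rule lsi[OF der])
      show "bounded (range f)" by (rule boundedI[of _ "1 / e"]) (use f0 f1 in auto)
      show "bounded (range (\<lambda>z. onorm (D z)))" by (rule boundedI[of _ "2 + 2 / e"]) (use on0 on2 in auto)
    qed
    also have "(\<integral>z. (onorm (D z))\<^sup>2 \<partial>\<nu>) \<le> (\<integral>z. 4 * (cmod z)\<^sup>2 \<partial>\<nu>)"
    proof (rule integral_mono')
      fix z show "(onorm (D z))\<^sup>2 \<le> 4 * (cmod z)\<^sup>2"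
        using power_mono[OF on1[of z] on0[of z], of 2] by (simp add: power_mult_distrib)
    qed (use i2 in auto)
    finally have ent: "Defs.entropy \<nu> (\<lambda>z. (f z)\<^sup>2) \<le> 8 * c" using c e2 by simp
    have "(\<integral>z. f z \<partial>\<nu>) \<le> (\<integral>z. (cmod z)\<^sup>2 \<partial>\<nu>)"
      using i2 f2 f0 by (intro integral_mono') auto
    moreover have "(\<integral>z. f z \<partial>\<nu>) \<ge> 0" using f0 by (intro integral_nonneg_AE) auto
    ultimately have "(\<integral>z. f z \<partial>\<nu>)\<^sup>2 \<le> 1" using e2 by (simp add: power_le_one)
    moreover have "(\<integral>z. (f z)\<^sup>2 \<partial>\<nu>) - (\<integral>z. f z \<partial>\<nu>)\<^sup>2 \<le> Defs.entropy \<nu> (\<lambda>z. (f z)\<^sup>2)"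
      by (rule entropy_sq_ge_variance[OF prob_space_axioms _ f0 f1]) simp
    ultimately show ?thesis using ent unfolding f_def by simp
  qed
  define F where "F = (\<lambda>k z. ((cmod z)\<^sup>2 / (1 + 1 / real (Suc k) * (cmod z)\<^sup>2))\<^sup>2)"
  have [measurable]: "F k \<in> borel_measurable \<nu>" for k unfolding F_def by measurable
  have lim: "(\<lambda>k. F k z) \<longlonglongrightarrow> (cmod z) ^ 4" for z
  proof -
    have "(\<lambda>k. F k z) \<longlonglongrightarrow> ((cmod z)\<^sup>2 / (1 + 0 * (cmod z)\<^sup>2))\<^sup>2"
      unfolding F_def by (intro tendsto_intros LIMSEQ_Suc[OF lim_1_over_n]) auto
    then show ?thesis by simp
  qed
  \<comment> \<open>Fatou's lemma along \<open>e = 1 / Suc k\<close>.\<close>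
  have "(\<integral>\<^sup>+ z. ennreal (norm ((cmod z) ^ 4)) \<partial>\<nu>) = (\<integral>\<^sup>+ z. liminf (\<lambda>k. ennreal (F k z)) \<partial>\<nu>)"
  proof (rule nn_integral_cong)
    fix z
    have "(\<lambda>k. ennreal (F k z)) \<longlonglongrightarrow> ennreal ((cmod z) ^ 4)" using lim by (rule tendsto_ennrealI)
    then show "ennreal (norm ((cmod z) ^ 4)) = liminf (\<lambda>k. ennreal (F k z))"
      by (simp add: lim_imp_Liminf)
  qed
  also have "\<dots> \<le> liminf (\<lambda>k. \<integral>\<^sup>+ z. ennreal (F k z) \<partial>\<nu>)"
    by (rule nn_integral_liminf) simp
  also have "\<dots> \<le> ennreal (8 * c + 1)"
  proof (rule Liminf_le[OF sequentially_bot always_eventually], rule allI)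
    fix k
    let ?e = "1 / real (Suc k)"
    have "F k z \<le> (real (Suc k))\<^sup>2" for z
    proof -
      have "(cmod z)\<^sup>2 / (1 + ?e * (cmod z)\<^sup>2) \<le> real (Suc k)"
        by (rule mult_imp_div_pos_le) (simp_all add: distrib_left add_pos_nonneg)
      then show ?thesis unfolding F_def by (intro power_mono) (auto simp: add_nonneg_nonneg)
    qed
    then have "integrable \<nu> (F k)"
      by (intro integrable_const_bound[where B = "(real (Suc k))\<^sup>2"]) (auto simp: F_def)
    then have "(\<integral>\<^sup>+ z. ennreal (F k z) \<partial>\<nu>) = ennreal (\<integral>z. F k z \<partial>\<nu>)"
      by (intro nn_integral_eq_integral) (auto simp: F_def)
    also have "\<dots> \<le> ennreal (8 * c + 1)" unfolding F_def by (intro ennreal_leI bound) simp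
    finally show "(\<integral>\<^sup>+ z. ennreal (F k z) \<partial>\<nu>) \<le> ennreal (8 * c + 1)" .
  qed
  also have "\<dots> < \<infinity>" by simp
  finally show ?thesis by (intro integrableI_bounded) auto
qed


section \<open>Mixed fourth moments of independent entries\<close>

lemma measurable_if_const:
  "(\<lambda>t. if P then t else 1) \<in> borel_measurable (borel :: complex measure)"
  "(\<lambda>t. if P then cnj t else 1) \<in> borel_measurable borel"
  by (cases P; auto intro!: borel_measurable_continuous_onI continuous_intros)+

text \<open>The value of E X^2 is left free, so that real and complex laws are covered at once. For
  this reason the reversed pair \<open>(b, a)\<close> is excluded alongside \<open>(a, b)\<close> in
  \<open>expectation_dev_eq_0\<close>.\<close>

locale iid_entries = prob_space M for M :: "'w measure" +
  fixes X :: "'i \<Rightarrow> 'w \<Rightarrow> complex" and I :: "'i set" and \<kappa> :: real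
  assumes indep: "indep_vars (\<lambda>_. borel) X I"
    and mean: "\<And>a. a \<in> I \<Longrightarrow> expectation (X a) = 0"
    and var: "\<And>a. a \<in> I \<Longrightarrow> expectation (\<lambda>w. (cmod (X a w))\<^sup>2) = 1"
    and int4: "\<And>a. a \<in> I \<Longrightarrow> integrable M (\<lambda>w. (cmod (X a w)) ^ 4)"
    and fourth: "\<And>a. a \<in> I \<Longrightarrow> expectation (\<lambda>w. (cmod (X a w)) ^ 4) \<le> \<kappa>"
begin

lemma measurable_entries [measurable]: "a \<in> I \<Longrightarrow> X a \<in> borel_measurable M"
  using indep by (simp add: indep_vars_def2)

text \<open>Grouping the factors of a mixed fourth moment by index makes its expectation factorize,
  whatever coincidences there are among the four indices.\<close>

definition fac :: "'i \<Rightarrow> 'i \<Rightarrow> 'i \<Rightarrow> 'i \<Rightarrow> 'i \<Rightarrow> complex \<Rightarrow> complex" where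
  "fac a b a' b' c t = (if c = a then cnj t else 1) * (if c = b then t else 1)
     * (if c = a' then t else 1) * (if c = b' then cnj t else 1)"

lemma measurable_fac [measurable]: "fac a b a' b' c \<in> borel_measurable borel"
  unfolding fac_def by (intro borel_measurable_times measurable_if_const)

lemma cmod_fac_le: "cmod (fac a b a' b' c t) \<le> 1 + (cmod t) ^ 4"
proof -
  define s where "s = max 1 (cmod t)"
  have s: "1 \<le> s" "cmod t \<le> s" by (auto simp: s_def)
  have f: "0 \<le> cmod (if P then t else 1)" "cmod (if P then t else 1) \<le> s"
    "0 \<le> cmod (if P then cnj t else 1)" "cmod (if P then cnj t else 1) \<le> s" for P
    using s by auto
  have "cmod (fac a b a' b' c t) \<le> s * s * s * s"
    unfolding fac_def norm_mult by (intro mult_mono f mult_nonneg_nonneg) (use s in auto)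
  also have "\<dots> = s ^ 4" by (simp add: power4_eq_xxxx)
  also have "\<dots> \<le> 1 + (cmod t) ^ 4" by (simp add: s_def max_def)
  finally show ?thesis .
qed

lemma
  assumes J: "finite J" "J \<subseteq> I" and \<phi>: "\<And>c. \<phi> c \<in> borel_measurable borel"
    and le: "\<And>c t. cmod (\<phi> c t) \<le> 1 + (cmod t) ^ 4"
  shows integrable_prod_entries: "integrable M (\<lambda>w. \<Prod>c\<in>J. \<phi> c (X c w))"
    and expectation_prod_entries: "expectation (\<lambda>w. \<Prod>c\<in>J. \<phi> c (X c w)) = (\<Prod>c\<in>J. expectation (\<lambda>w. \<phi> c (X c w)))"
proof -
  have ind: "indep_vars (\<lambda>_. borel) (\<lambda>c w. \<phi> c (X c w)) J"
    using indep_vars_subset[OF indep J(2)] \<phi> by (rule indep_vars_compose2)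
  have int: "integrable M (\<lambda>w. \<phi> c (X c w))" if "c \<in> J" for c
  proof (rule Bochner_Integration.integrable_bound)
    have c: "c \<in> I" using that J by blast
    then show "integrable M (\<lambda>w. 1 + (cmod (X c w)) ^ 4)" using int4 by simp
    show "(\<lambda>w. \<phi> c (X c w)) \<in> borel_measurable M" by (rule measurable_compose[OF measurable_entries[OF c] \<phi>])
    show "AE w in M. norm (\<phi> c (X c w)) \<le> norm (1 + (cmod (X c w)) ^ 4)"
      using le by (intro AE_I2) simp
  qed
  show "integrable M (\<lambda>w. \<Prod>c\<in>J. \<phi> c (X c w))" by (rule indep_vars_integrable[OF J(1) ind int])
  show "expectation (\<lambda>w. \<Prod>c\<in>J. \<phi> c (X c w)) = (\<Prod>c\<in>J. expectation (\<lambda>w. \<phi> c (X c w)))"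
    by (rule indep_vars_lebesgue_integral[OF J(1) ind int])
qed

lemma prod_fac:
  assumes "finite J" "{a, b, a', b'} \<subseteq> J"
  shows "(\<Prod>c\<in>J. fac a b a' b' c (X c w)) = cnj (X a w) * X b w * X a' w * cnj (X b' w)"
  using assms unfolding fac_def by (simp add: prod.distrib)

lemma
  assumes I: "a \<in> I" "b \<in> I" "a' \<in> I" "b' \<in> I"
  shows integrable_mixed: "integrable M (\<lambda>w. cnj (X a w) * X b w * X a' w * cnj (X b' w))"
    and expectation_mixed: "expectation (\<lambda>w. cnj (X a w) * X b w * X a' w * cnj (X b' w))
          = (\<Prod>c\<in>{a, b, a', b'}. expectation (\<lambda>w. fac a b a' b' c (X c w)))"
proof -
  have J: "finite {a, b, a', b'}" "{a, b, a', b'} \<subseteq> I" using I by auto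
  note h = J measurable_fac cmod_fac_le
  show "integrable M (\<lambda>w. cnj (X a w) * X b w * X a' w * cnj (X b' w))"
    using integrable_prod_entries[where \<phi> = "fac a b a' b'", OF h]
    by (simp only: prod_fac[OF J(1) order_refl])
  show "expectation (\<lambda>w. cnj (X a w) * X b w * X a' w * cnj (X b' w))
          = (\<Prod>c\<in>{a, b, a', b'}. expectation (\<lambda>w. fac a b a' b' c (X c w)))"
    using expectation_prod_entries[where \<phi> = "fac a b a' b'", OF h]
    by (simp only: prod_fac[OF J(1) order_refl])
qed

lemma expectation_cnj_mean: "a \<in> I \<Longrightarrow> expectation (\<lambda>w. cnj (X a w)) = 0"
  by (simp add: mean)

text \<open>An index that occurs exactly once contributes the mean of its entry, or the conjugate of
  the mean, as a factor of the product.\<close>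

lemma expectation_mixed_eq_0:
  assumes I: "a \<in> I" "b \<in> I" "a' \<in> I" "b' \<in> I"
    and single: "\<exists>c\<in>{a, b, a', b'}. (c = a \<and> c \<noteq> b \<and> c \<noteq> a' \<and> c \<noteq> b') \<or> (c = b \<and> c \<noteq> a \<and> c \<noteq> a' \<and> c \<noteq> b')
       \<or> (c = a' \<and> c \<noteq> a \<and> c \<noteq> b \<and> c \<noteq> b') \<or> (c = b' \<and> c \<noteq> a \<and> c \<noteq> b \<and> c \<noteq> a')"
  shows "expectation (\<lambda>w. cnj (X a w) * X b w * X a' w * cnj (X b' w)) = 0"
proof -
  from single obtain c where c: "c \<in> {a, b, a', b'}"
    "(c = a \<and> c \<noteq> b \<and> c \<noteq> a' \<and> c \<noteq> b') \<or> (c = b \<and> c \<noteq> a \<and> c \<noteq> a' \<and> c \<noteq> b')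
       \<or> (c = a' \<and> c \<noteq> a \<and> c \<noteq> b \<and> c \<noteq> b') \<or> (c = b' \<and> c \<noteq> a \<and> c \<noteq> b \<and> c \<noteq> a')" by blast
  have cI: "c \<in> I" using c(1) I by auto
  have "expectation (\<lambda>w. fac a b a' b' c (X c w)) = 0"
    using c(2) mean[OF cI] expectation_cnj_mean[OF cI] unfolding fac_def by (elim disjE conjE) simp_all
  then show ?thesis unfolding expectation_mixed[OF I] using c(1) by (intro prod_zero) auto
qed

lemma expectation_abs_sq: "a \<in> I \<Longrightarrow> expectation (\<lambda>w. cnj (X a w) * X a w) = 1"
proof -
  assume a: "a \<in> I"
  have "expectation (\<lambda>w. cnj (X a w) * X a w) = expectation (\<lambda>w. complex_of_real ((cmod (X a w))\<^sup>2))"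
    by (simp only: complex_norm_square mult.commute)
  then show ?thesis by (simp only: integral_complex_of_real var[OF a] of_real_1)
qed

lemma
  assumes I: "a \<in> I" "b \<in> I"
  shows integrable_pair: "integrable M (\<lambda>w. cnj (X a w) * X b w)"
    and expectation_pair: "expectation (\<lambda>w. cnj (X a w) * X b w) = (if a = b then 1 else 0)"
proof -
  let ?f = "\<lambda>c t. (if c = a then cnj t else 1) * (if c = b then t else 1)"
  have \<phi>: "?f c \<in> borel_measurable borel" for c
    by (intro borel_measurable_times measurable_if_const)
  have le: "cmod (?f c t) \<le> 1 + (cmod t) ^ 4" for c t
  proof -
    define s where "s = max 1 (cmod t)"
    have s: "1 \<le> s" "cmod t \<le> s" by (auto simp: s_def)
    have "cmod (?f c t) \<le> s * s" using s unfolding norm_mult by (intro mult_mono) auto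
    also have "\<dots> \<le> s ^ 4" using power_increasing[of 2 4 s] s by (simp add: power2_eq_square)
    also have "\<dots> \<le> 1 + (cmod t) ^ 4" by (simp add: s_def max_def)
    finally show ?thesis .
  qed
  have J: "finite {a, b}" "{a, b} \<subseteq> I" using I by auto
  have pr: "(\<Prod>c\<in>{a, b}. ?f c (X c w)) = cnj (X a w) * X b w" for w by (simp add: prod.distrib)
  show "integrable M (\<lambda>w. cnj (X a w) * X b w)"
    using integrable_prod_entries[where \<phi> = ?f, OF J \<phi> le] unfolding pr .
  show "expectation (\<lambda>w. cnj (X a w) * X b w) = (if a = b then 1 else 0)"
  proof (cases "a = b")
    case True
    then show ?thesis using expectation_abs_sq I by simp
  next
    case False
    have "expectation (\<lambda>w. cnj (X a w) * X b w) = (\<Prod>c\<in>{a, b}. expectation (\<lambda>w. ?f c (X c w)))"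
      using expectation_prod_entries[where \<phi> = ?f, OF J \<phi> le] unfolding pr .
    also have "\<dots> = 0" using False mean[OF I(2)] by simp
    finally show ?thesis using False by simp
  qed
qed

text \<open>The product is centred by its expectation, so that a quadratic form minus its trace is a
  linear combination of these variables.\<close>

definition dev :: "'i \<Rightarrow> 'i \<Rightarrow> 'w \<Rightarrow> complex" where
  "dev a b w = cnj (X a w) * X b w - (if a = b then 1 else 0)"

lemma dev_mult_cnj:
  "dev a b w * cnj (dev a' b' w) = cnj (X a w) * X b w * X a' w * cnj (X b' w)
     - (if a' = b' then 1 else 0) * (cnj (X a w) * X b w) - (if a = b then 1 else 0) * (cnj (X b' w) * X a' w)
     + (if a = b then 1 else 0) * (if a' = b' then 1 else 0)" by (simp add: dev_def algebra_simps)

lemma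
  assumes I: "a \<in> I" "b \<in> I" "a' \<in> I" "b' \<in> I"
  shows integrable_dev: "integrable M (\<lambda>w. dev a b w * cnj (dev a' b' w))"
    and expectation_dev: "expectation (\<lambda>w. dev a b w * cnj (dev a' b' w))
      = expectation (\<lambda>w. cnj (X a w) * X b w * X a' w * cnj (X b' w)) - (if a = b \<and> a' = b' then 1 else 0)"
proof -
  note [simp] = integrable_mixed[OF I] integrable_pair[OF I(1,2)] integrable_pair[OF I(4,3)]
    expectation_pair[OF I(1,2)] expectation_pair[OF I(4,3)]
  show "integrable M (\<lambda>w. dev a b w * cnj (dev a' b' w))"
    unfolding dev_mult_cnj by simp
  show "expectation (\<lambda>w. dev a b w * cnj (dev a' b' w))
      = expectation (\<lambda>w. cnj (X a w) * X b w * X a' w * cnj (X b' w)) - (if a = b \<and> a' = b' then 1 else 0)"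
    unfolding dev_mult_cnj by (auto simp: prob_space)
qed

text \<open>If both pairs are diagonal, they are distinct and the mixed moment factorizes as 1,
  which cancels the centring. Otherwise some index occurs exactly once among the four.\<close>

lemma expectation_dev_eq_0:
  assumes I: "a \<in> I" "b \<in> I" "a' \<in> I" "b' \<in> I"
    and ne: "(a', b') \<noteq> (a, b)" "(a', b') \<noteq> (b, a)"
  shows "expectation (\<lambda>w. dev a b w * cnj (dev a' b' w)) = 0"
proof (cases "a = b \<and> a' = b'")
  case True
  then have aa': "a \<noteq> a'" using ne by auto
  have "expectation (\<lambda>w. cnj (X a w) * X b w * X a' w * cnj (X b' w))
      = expectation (\<lambda>w. fac a a a' a' a (X a w)) * expectation (\<lambda>w. fac a a a' a' a' (X a' w))"
    unfolding expectation_mixed[OF I] using True aa' by simp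
  also have "expectation (\<lambda>w. fac a a a' a' a (X a w)) = 1"
    using aa' expectation_abs_sq[OF I(1)] by (simp add: fac_def)
  also have "expectation (\<lambda>w. fac a a a' a' a' (X a' w)) = 1"
    using aa' expectation_abs_sq[OF I(3)] by (simp add: fac_def mult.commute)
  finally show ?thesis unfolding expectation_dev[OF I] using True by simp
next
  case False
  have "expectation (\<lambda>w. cnj (X a w) * X b w * X a' w * cnj (X b' w)) = 0"
    by (rule expectation_mixed_eq_0[OF I]) (use False ne in auto)
  then show ?thesis unfolding expectation_dev[OF I] using False by auto
qed

lemma cmod_dev_sq_le: "(cmod (dev a b w))\<^sup>2 \<le> (cmod (X a w)) ^ 4 + (cmod (X b w)) ^ 4 + 2"
proof -
  have "cmod (dev a b w) \<le> cmod (cnj (X a w) * X b w) + cmod (if a = b then 1 else 0)"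
    unfolding dev_def by (rule norm_triangle_ineq4)
  also have "\<dots> \<le> cmod (X a w) * cmod (X b w) + 1" by (simp add: norm_mult)
  finally have "(cmod (dev a b w))\<^sup>2 \<le> (cmod (X a w) * cmod (X b w) + 1)\<^sup>2" by (intro power_mono) auto
  also have "\<dots> \<le> 2 * ((cmod (X a w))\<^sup>2 * (cmod (X b w))\<^sup>2) + 2"
    using zero_le_power2[of "cmod (X a w) * cmod (X b w) - 1"] by (simp add: power2_eq_square algebra_simps)
  also have "2 * ((cmod (X a w))\<^sup>2 * (cmod (X b w))\<^sup>2) \<le> (cmod (X a w)) ^ 4 + (cmod (X b w)) ^ 4"
    using zero_le_power2[of "(cmod (X a w))\<^sup>2 - (cmod (X b w))\<^sup>2"]
    by (simp add: power2_eq_square power4_eq_xxxx algebra_simps)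
  finally show ?thesis by simp
qed

text \<open>Bounding a product of moduli by half the sum of squares, and each square by
  \<open>cmod_dev_sq_le\<close>, gives the average of two terms at most
  \<open>2 * \<kappa> + 2\<close>.\<close>

lemma cmod_expectation_dev_le:
  assumes I: "a \<in> I" "b \<in> I" "a' \<in> I" "b' \<in> I"
  shows "cmod (expectation (\<lambda>w. dev a b w * cnj (dev a' b' w))) \<le> 2 * \<kappa> + 2"
proof -
  have "cmod (expectation (\<lambda>w. dev a b w * cnj (dev a' b' w)))
      \<le> expectation (\<lambda>w. cmod (dev a b w * cnj (dev a' b' w)))"
    by (rule integral_norm_bound)
  also have "\<dots> \<le> expectation (\<lambda>w. ((cmod (X a w)) ^ 4 + (cmod (X b w)) ^ 4 + 2 + ((cmod (X a' w)) ^ 4 + (cmod (X b' w)) ^ 4 + 2)) / 2)"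
  proof (rule integral_mono')
    show "integrable M (\<lambda>w. ((cmod (X a w)) ^ 4 + (cmod (X b w)) ^ 4 + 2 + ((cmod (X a' w)) ^ 4 + (cmod (X b' w)) ^ 4 + 2)) / 2)"
      using int4 I by simp
    fix w
    have "0 \<le> (cmod (dev a b w) - cmod (dev a' b' w))\<^sup>2" by simp
    then have "cmod (dev a b w * cnj (dev a' b' w)) \<le> ((cmod (dev a b w))\<^sup>2 + (cmod (dev a' b' w))\<^sup>2) / 2"
      by (simp add: norm_mult power2_eq_square algebra_simps)
    then show "cmod (dev a b w * cnj (dev a' b' w))
       \<le> ((cmod (X a w)) ^ 4 + (cmod (X b w)) ^ 4 + 2 + ((cmod (X a' w)) ^ 4 + (cmod (X b' w)) ^ 4 + 2)) / 2"
      using cmod_dev_sq_le[of a b w] cmod_dev_sq_le[of a' b' w] by simp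
  qed simp
  also have "\<dots> \<le> 2 * \<kappa> + 2"
    using int4 I fourth[OF I(1)] fourth[OF I(2)] fourth[OF I(3)] fourth[OF I(4)] by (simp add: prob_space)
  finally show ?thesis .
qed

end

text \<open>Chebyshev's inequality. In the second moment only the index pairs \<open>q = p\<close>
  and \<open>q = prod.swap p\<close> survive; each of the two contributes at most
  \<open>2 * \<kappa> + 2\<close> times the squared Hilbert-Schmidt norm of \<open>A\<close>, the
  second after bounding products by squares.\<close>

lemma (in prob_space) quadratic_form_concentration:
  fixes X :: "'k \<times> nat \<Rightarrow> 'a \<Rightarrow> complex" and A :: "nat \<Rightarrow> nat \<Rightarrow> complex"
  assumes "iid_entries M X (K \<times> {..<n}) \<kappa>" and kl: "k \<in> K" "l \<in> K" and e: "e > 0"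
  shows "measure M {w \<in> space M. e \<le> cmod ((\<Sum>i<n. \<Sum>j<n. A i j * cnj (X (k, i) w) * X (l, j) w)
            - (if k = l then \<Sum>i<n. A i i else 0))}
    \<le> (4 * \<kappa> + 4) * (\<Sum>i<n. \<Sum>j<n. (cmod (A i j))\<^sup>2) / e\<^sup>2"
proof -
  interpret iid_entries M X "K \<times> {..<n}" \<kappa> by fact
  define S where "S = (\<lambda>w. (\<Sum>i<n. \<Sum>j<n. A i j * cnj (X (k, i) w) * X (l, j) w)
            - (if k = l then \<Sum>i<n. A i i else 0))"
  define P where "P = {..<n} \<times> {..<n}"
  define B where "B = (\<lambda>p. A (fst p) (snd p))"
  define T where "T = (\<lambda>p. dev (k, fst p) (l, snd p))"
  have finP: "finite P" by (simp add: P_def)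
  have PI: "(k, fst p) \<in> K \<times> {..<n}" "(l, snd p) \<in> K \<times> {..<n}" if "p \<in> P" for p
    using that kl by (auto simp: P_def)
  have S: "S w = (\<Sum>p\<in>P. B p * T p w)" for w
  proof -
    have "(\<Sum>p\<in>P. B p * T p w) = (\<Sum>i<n. \<Sum>j<n. A i j * dev (k, i) (l, j) w)"
      unfolding P_def B_def T_def by (simp add: sum.cartesian_product split_def)
    also have "\<dots> = (\<Sum>i<n. \<Sum>j<n. A i j * cnj (X (k, i) w) * X (l, j) w - (if k = l \<and> i = j then A i j else 0))"
      by (intro sum.cong refl) (simp add: dev_def algebra_simps)
    also have "\<dots> = (\<Sum>i<n. \<Sum>j<n. A i j * cnj (X (k, i) w) * X (l, j) w)
        - (\<Sum>i<n. \<Sum>j<n. if k = l \<and> i = j then A i j else 0)" by (simp only: sum_subtractf)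
    also have "(\<Sum>i<n. \<Sum>j<n. if k = l \<and> i = j then A i j else 0) = (if k = l then \<Sum>i<n. A i i else 0)"
      by (simp add: sum.delta')
    finally show ?thesis by (simp add: S_def)
  qed
  have SS: "complex_of_real ((cmod (S w))\<^sup>2) = (\<Sum>p\<in>P. \<Sum>q\<in>P. B p * cnj (B q) * (T p w * cnj (T q w)))" for w
    unfolding complex_norm_square S cnj_sum sum_product by (simp add: mult_ac)
  have intT: "integrable M (\<lambda>w. T p w * cnj (T q w))" if "p \<in> P" "q \<in> P" for p q
    unfolding T_def by (intro integrable_dev PI that)
  have intSS: "integrable M (\<lambda>w. complex_of_real ((cmod (S w))\<^sup>2))"
    unfolding SS using intT by (intro Bochner_Integration.integrable_sum integrable_mult_right) auto
  then have intS: "integrable M (\<lambda>w. (cmod (S w))\<^sup>2)"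
    by (simp only: complex_of_real_integrable_eq)
  \<comment> \<open>The sign of \<open>2 * \<kappa> + 2\<close> can be read off only from an actual
    entry; for empty \<open>P\<close> all sums are zero.\<close>
  have k0: "0 \<le> 2 * \<kappa> + 2" if "P \<noteq> {}"
  proof -
    from that have "\<exists>p. p \<in> P" by (simp only: ex_in_conv not_False_eq_True)
    then obtain p where "p \<in> P" ..
    moreover have "0 \<le> expectation (\<lambda>w. (cmod (X (k, fst p) w)) ^ 4)"
      by (rule Bochner_Integration.integral_nonneg) simp
    ultimately show ?thesis using fourth[OF PI(1), of p] by linarith
  qed
  have "complex_of_real (expectation (\<lambda>w. (cmod (S w))\<^sup>2)) = expectation (\<lambda>w. complex_of_real ((cmod (S w))\<^sup>2))"
    by (simp only: integral_complex_of_real)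
  also have "\<dots> = (\<Sum>p\<in>P. \<Sum>q\<in>P. B p * cnj (B q) * expectation (\<lambda>w. T p w * cnj (T q w)))"
    unfolding SS using intT by (simp add: Bochner_Integration.integral_sum Bochner_Integration.integrable_sum)
  finally have eq: "complex_of_real (expectation (\<lambda>w. (cmod (S w))\<^sup>2)) =
      (\<Sum>p\<in>P. \<Sum>q\<in>P. B p * cnj (B q) * expectation (\<lambda>w. T p w * cnj (T q w)))" .
  let ?h = "\<lambda>p q. if q = p \<or> q = prod.swap p then cmod (B p) * cmod (B q) * (2 * \<kappa> + 2) else 0"
  let ?w = "\<lambda>p. (2 * \<kappa> + 2) * ((cmod (B p))\<^sup>2 + ((cmod (B p))\<^sup>2 + (cmod (B (prod.swap p)))\<^sup>2) / 2)"
  have "0 \<le> expectation (\<lambda>w. (cmod (S w))\<^sup>2)" by (rule Bochner_Integration.integral_nonneg) simp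
  then have "expectation (\<lambda>w. (cmod (S w))\<^sup>2)
      = cmod (\<Sum>p\<in>P. \<Sum>q\<in>P. B p * cnj (B q) * expectation (\<lambda>w. T p w * cnj (T q w)))"
    unfolding eq[symmetric] by simp
  also have "\<dots> \<le> (\<Sum>p\<in>P. \<Sum>q\<in>P. cmod (B p * cnj (B q) * expectation (\<lambda>w. T p w * cnj (T q w))))"
    by (intro sum_norm_le order_refl)
  also have "\<dots> \<le> (\<Sum>p\<in>P. \<Sum>q\<in>P. ?h p q)"
  proof (intro sum_mono)
    fix p q assume pq: "p \<in> P" "q \<in> P"
    show "cmod (B p * cnj (B q) * expectation (\<lambda>w. T p w * cnj (T q w))) \<le> ?h p q"
    proof (cases "q = p \<or> q = prod.swap p")
      case True
      have "cmod (expectation (\<lambda>w. T p w * cnj (T q w))) \<le> 2 * \<kappa> + 2"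
        unfolding T_def by (intro cmod_expectation_dev_le PI pq)
      then show ?thesis using True by (simp add: norm_mult mult_left_mono)
    next
      case False
      have "expectation (\<lambda>w. T p w * cnj (T q w)) = 0"
        unfolding T_def using False by (intro expectation_dev_eq_0 PI pq) (auto simp: prod_eq_iff)
      then show ?thesis using False by simp
    qed
  qed
  also have "\<dots> \<le> (\<Sum>p\<in>P. ?w p)"
  proof (rule sum_mono)
    fix p assume p: "p \<in> P"
    then have k: "0 \<le> 2 * \<kappa> + 2" using k0 by blast
    have "(\<Sum>q\<in>P. ?h p q)
       \<le> (\<Sum>q\<in>P. (if q = p then cmod (B p) * cmod (B q) * (2 * \<kappa> + 2) else 0) +
              (if q = prod.swap p then cmod (B p) * cmod (B q) * (2 * \<kappa> + 2) else 0))"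
      using k by (intro sum_mono) auto
    also have "\<dots> = cmod (B p) * cmod (B p) * (2 * \<kappa> + 2) + cmod (B p) * cmod (B (prod.swap p)) * (2 * \<kappa> + 2)"
      using finP p unfolding sum.distrib by (auto simp: P_def)
    also have "\<dots> = (2 * \<kappa> + 2) * (cmod (B p) * cmod (B p) + cmod (B p) * cmod (B (prod.swap p)))"
      by (simp add: algebra_simps)
    also have "\<dots> \<le> ?w p"
      using zero_le_power2[of "cmod (B p) - cmod (B (prod.swap p))"] k
      by (intro mult_left_mono) (simp_all add: power2_eq_square algebra_simps)
    finally show "(\<Sum>q\<in>P. ?h p q) \<le> ?w p" .
  qed
  also have "\<dots> = (2 * \<kappa> + 2) * ((3 / 2) * (\<Sum>p\<in>P. (cmod (B p))\<^sup>2) + (1 / 2) * (\<Sum>p\<in>P. (cmod (B (prod.swap p)))\<^sup>2))"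
    unfolding sum_distrib_left sum.distrib[symmetric] by (intro sum.cong refl) (simp add: field_simps)
  also have "(\<Sum>p\<in>P. (cmod (B (prod.swap p)))\<^sup>2) = (\<Sum>p\<in>P. (cmod (B p))\<^sup>2)"
    by (rule sum.reindex_bij_witness[of _ prod.swap prod.swap]) (auto simp: P_def)
  also have "(\<Sum>p\<in>P. (cmod (B p))\<^sup>2) = (\<Sum>i<n. \<Sum>j<n. (cmod (A i j))\<^sup>2)"
    unfolding P_def B_def by (simp add: sum.cartesian_product split_def)
  finally have E: "expectation (\<lambda>w. (cmod (S w))\<^sup>2) \<le> (4 * \<kappa> + 4) * (\<Sum>i<n. \<Sum>j<n. (cmod (A i j))\<^sup>2)"
    by (simp add: algebra_simps)
  have "{w \<in> space M. e \<le> cmod (S w)} = {w \<in> space M. e\<^sup>2 \<le> (cmod (S w))\<^sup>2}"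
    using e by (auto simp: abs_le_square_iff[symmetric])
  also have "measure M \<dots> \<le> expectation (\<lambda>w. (cmod (S w))\<^sup>2) / e\<^sup>2"
    using e by (intro integral_Markov_inequality_measure[OF intS, of "{}"]) auto
  also have "\<dots> \<le> (4 * \<kappa> + 4) * (\<Sum>i<n. \<Sum>j<n. (cmod (A i j))\<^sup>2) / e\<^sup>2"
    by (intro divide_right_mono E) simp
  finally show ?thesis by (simp only: S_def)
qed

section \<open>The Stieltjes transform outside the support\<close>

text \<open>The complement of the support is a union of null intervals, possibly uncountable; the
  Lindelof property reduces it to a countable union.\<close>

lemma AE_msupp:
  assumes "prob_space \<mu>" and sets: "sets \<mu> = sets borel"
  shows "AE t in \<mu>. t \<in> msupp \<mu>"
proof -
  interpret prob_space \<mu> by fact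
  define F where "F = {{t - e<..<t + e} | t e. e > 0 \<and> measure \<mu> {t - e<..<t + e} = 0}"
  have "open S" if "S \<in> F" for S using that by (auto simp: F_def)
  then obtain F' where F': "F' \<subseteq> F" "countable F'" "\<Union>F' = \<Union>F"
    using Lindelof[of F] by metis
  have "(\<Union>S\<in>F'. S) \<in> null_sets \<mu>"
  proof (rule null_sets_UN'[OF F'(2)])
    fix S assume "S \<in> F'"
    then have "S \<in> sets \<mu>" "measure \<mu> S = 0" using F'(1) sets by (auto simp: F_def)
    then show "S \<in> null_sets \<mu>" by (auto simp: emeasure_eq_measure)
  qed
  moreover have "{t \<in> space \<mu>. t \<notin> msupp \<mu>} \<subseteq> (\<Union>S\<in>F'. S)"
  proof
    fix t assume "t \<in> {t \<in> space \<mu>. t \<notin> msupp \<mu>}"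
    then obtain e where e: "e > 0" "\<not> measure \<mu> {t - e<..<t + e} > 0" by (auto simp: msupp_def)
    then have "measure \<mu> {t - e<..<t + e} = 0" using measure_nonneg[of \<mu> "{t - e<..<t + e}"] by linarith
    then have "{t - e<..<t + e} \<in> F" "t \<in> {t - e<..<t + e}" using e by (auto simp: F_def)
    then have "t \<in> \<Union>F" by blast
    then show "t \<in> (\<Union>S\<in>F'. S)" using F'(3) by simp
  qed
  ultimately show ?thesis by (rule AE_I')
qed

lemma msupp_bounds:
  assumes "prob_space \<mu>" "sets \<mu> = sets borel" "compact (msupp \<mu>)"
  shows "Inf (msupp \<mu>) \<le> Sup (msupp \<mu>)" "AE t in \<mu>. Inf (msupp \<mu>) \<le> t" "AE t in \<mu>. t \<le> Sup (msupp \<mu>)"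
proof -
  interpret prob_space \<mu> by fact
  have bdd: "bdd_below (msupp \<mu>)" "bdd_above (msupp \<mu>)"
    using compact_imp_bounded[OF assms(3)] by (auto intro: bounded_imp_bdd_below bounded_imp_bdd_above)
  have AE: "AE t in \<mu>. t \<in> msupp \<mu>" by (rule AE_msupp[OF assms(1,2)])
  then have "msupp \<mu> \<noteq> {}" by (auto simp: AE_False)
  then show "Inf (msupp \<mu>) \<le> Sup (msupp \<mu>)" using bdd by (intro cInf_le_cSup)
  show "AE t in \<mu>. Inf (msupp \<mu>) \<le> t" using AE by eventually_elim (rule cInf_lower[OF _ bdd(1)])
  show "AE t in \<mu>. t \<le> Sup (msupp \<mu>)" using AE by eventually_elim (rule cSup_upper[OF _ bdd(2)])
qed

text \<open>Here \<open>a\<close> is any almost sure lower bound, so the locale applies to the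
  reflected measure with \<open>- b\<close> without computing the support of that measure.\<close>

locale measure_above = prob_space \<mu> for \<mu> :: "real measure" +
  fixes a :: real
  assumes sets_borel: "sets \<mu> = sets borel" and AE_ge: "AE t in \<mu>. a \<le> t"
begin

lemma measurable_kernel: "(\<lambda>t. 1 / (z - t)) \<in> borel_measurable \<mu>"
  using sets_borel by (simp cong: measurable_cong_sets)

lemma integrable_kernel: "z < a \<Longrightarrow> integrable \<mu> (\<lambda>t. 1 / (z - t))"
proof (rule integrable_const_bound[where B = "1 / (a - z)"])
  assume "z < a"
  show "AE t in \<mu>. norm (1 / (z - t)) \<le> 1 / (a - z)"
    using AE_ge by eventually_elim (use \<open>z < a\<close> in \<open>auto simp: abs_div intro!: divide_left_mono\<close>)
qed (rule measurable_kernel)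

lemma stieltjes_lower: "z < a \<Longrightarrow> - 1 / (a - z) \<le> stieltjes \<mu> z"
proof -
  assume z: "z < a"
  have "(\<integral>t. - 1 / (a - z) \<partial>\<mu>) \<le> stieltjes \<mu> z"
    unfolding stieltjes_def
  proof (rule integral_mono_AE)
    show "AE t in \<mu>. - 1 / (a - z) \<le> 1 / (z - t)"
      using AE_ge
    proof eventually_elim
      fix t assume "a \<le> t"
      then have "1 / (t - z) \<le> 1 / (a - z)" using z by (intro divide_left_mono) auto
      moreover have "1 / (z - t) = - (1 / (t - z))" by (metis minus_diff_eq minus_divide_right)
      ultimately show "- 1 / (a - z) \<le> 1 / (z - t)" by simp
    qed
  qed (use integrable_kernel[OF z] in auto)
  then show ?thesis by (simp add: prob_space)
qed

lemma stieltjes_neg: "z < a \<Longrightarrow> stieltjes \<mu> z < 0"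
proof -
  assume z: "z < a"
  have "stieltjes \<mu> z < (\<integral>t. 0 \<partial>\<mu>)"
    unfolding stieltjes_def
  proof (rule integral_less_AE_space[OF integrable_kernel[OF z]])
    show "AE t in \<mu>. 1 / (z - t) < 0" using AE_ge by eventually_elim (use z in auto)
  qed (simp_all add: emeasure_space_1)
  then show ?thesis by simp
qed

lemma kernel_diff: "z < y \<Longrightarrow> y < a \<Longrightarrow> a \<le> t \<Longrightarrow>
   1 / (z - t) - 1 / (y - t) = (y - z) / ((z - t) * (y - t))" for z y t :: real
  by (simp add: field_simps)

lemma stieltjes_decreasing: "z < y \<Longrightarrow> y < a \<Longrightarrow> stieltjes \<mu> y < stieltjes \<mu> z"
proof -
  assume zy: "z < y" "y < a"
  then have za: "z < a" by simp
  show ?thesis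
    unfolding stieltjes_def
  proof (rule integral_less_AE_space[OF integrable_kernel[OF zy(2)] integrable_kernel[OF za]])
    show "AE t in \<mu>. 1 / (y - t) < 1 / (z - t)"
      using AE_ge
    proof eventually_elim
      fix t assume t: "a \<le> t"
      have "0 < (y - z) / ((z - t) * (y - t))" using zy t by (intro divide_pos_pos mult_neg_neg) auto
      then show "1 / (y - t) < 1 / (z - t)" using kernel_diff[OF zy t] by linarith
    qed
  qed (simp_all add: emeasure_space_1)
qed

lemma stieltjes_lipschitz:
  assumes "z < y" "y \<le> a - d" "d > 0"
  shows "stieltjes \<mu> z - stieltjes \<mu> y \<le> (y - z) / d\<^sup>2"
proof -
  have zy: "y < a" "z < a" using assms by auto
  have "stieltjes \<mu> z - stieltjes \<mu> y = (\<integral>t. 1 / (z - t) - 1 / (y - t) \<partial>\<mu>)"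
    unfolding stieltjes_def using integrable_kernel zy by simp
  also have "\<dots> \<le> (\<integral>t. (y - z) / d\<^sup>2 \<partial>\<mu>)"
  proof (rule integral_mono_AE)
    show "AE t in \<mu>. 1 / (z - t) - 1 / (y - t) \<le> (y - z) / d\<^sup>2"
      using AE_ge
    proof eventually_elim
      fix t assume t: "a \<le> t"
      have "d * d \<le> (t - z) * (t - y)" using assms t by (intro mult_mono) auto
      then have "d\<^sup>2 \<le> (z - t) * (y - t)" by (simp add: power2_eq_square algebra_simps)
      then show "1 / (z - t) - 1 / (y - t) \<le> (y - z) / d\<^sup>2"
        unfolding kernel_diff[OF assms(1) zy(1) t] using assms by (intro divide_left_mono mult_pos_pos mult_neg_neg) (use t in auto)
    qed
  qed (use integrable_kernel zy in auto)
  finally show ?thesis by (simp add: prob_space)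
qed

lemma continuous_stieltjes: "z < a \<Longrightarrow> isCont (stieltjes \<mu>) z"
proof -
  assume z: "z < a"
  define d where "d = (a - z) / 2"
  have d: "d > 0" "z + d = a - d" using z by (auto simp: d_def field_simps)
  have lip: "\<bar>stieltjes \<mu> y - stieltjes \<mu> z\<bar> \<le> \<bar>y - z\<bar> / d\<^sup>2" if "\<bar>y - z\<bar> < d" for y
  proof (cases y z rule: linorder_cases)
    case less
    then show ?thesis using stieltjes_lipschitz[of y z d] stieltjes_decreasing[of y z] d that z by auto
  next
    case greater
    then show ?thesis using stieltjes_lipschitz[of z y d] stieltjes_decreasing[of z y] d that z by auto
  qed simp
  show ?thesis unfolding isCont_def
  proof (rule Lim_null_comparison[THEN Lim_null[THEN iffD2]])
    show "\<forall>\<^sub>F y in at z. norm (stieltjes \<mu> y - stieltjes \<mu> z) \<le> \<bar>y - z\<bar> / d\<^sup>2"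
      using d lip by (auto simp: eventually_at dist_real_def)
    show "((\<lambda>y. \<bar>y - z\<bar> / d\<^sup>2) \<longlongrightarrow> 0) (at z)"
      by (rule tendsto_eq_rhs, (rule tendsto_intros)+) (use d in auto)
  qed
qed

lemma stieltjes_attains:
  assumes "t < 0" "y < a" "stieltjes \<mu> y < t"
  shows "\<exists>z<a. stieltjes \<mu> z = t"
proof -
  \<comment> \<open>At distance at least \<open>- 2 / t\<close> from \<open>a\<close>, the bound
    \<open>stieltjes_lower\<close> yields a value of at least \<open>t / 2\<close>, which exceeds
    the negative \<open>t\<close>; the intermediate value theorem then applies between
    \<open>z0\<close> and \<open>y\<close>.\<close>
  define z0 where "z0 = min y (a + 2 / t)"
  have z0: "z0 \<le> y" "z0 < a" using assms by (auto simp: z0_def)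
  have "- 2 / t \<le> a - z0" by (simp add: z0_def)
  moreover have "0 < - 2 / t" using assms(1) by (simp add: field_simps)
  ultimately have "1 / (a - z0) \<le> 1 / (- 2 / t)" using z0 by (intro divide_left_mono mult_pos_pos) auto
  then have "t \<le> stieltjes \<mu> z0" using stieltjes_lower[OF z0(2)] assms(1) by simp
  then have "\<exists>z. z0 \<le> z \<and> z \<le> y \<and> stieltjes \<mu> z = t"
    using assms z0 by (intro IVT2) (auto intro!: continuous_stieltjes)
  then obtain z where "z \<le> y" "stieltjes \<mu> z = t" by blast
  then show ?thesis using assms(2) by (intro exI[of _ z]) simp
qed

lemma INF_stieltjes_less:
  assumes "z < a" shows "(INF z\<in>{..<a}. ereal (stieltjes \<mu> z)) < ereal (stieltjes \<mu> z)"
proof -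
  have "(INF z\<in>{..<a}. ereal (stieltjes \<mu> z)) \<le> ereal (stieltjes \<mu> ((z + a) / 2))"
    by (rule INF_lower) (use assms in auto)
  also have "\<dots> < ereal (stieltjes \<mu> z)" using assms stieltjes_decreasing[of z "(z + a) / 2"] by simp
  finally show ?thesis .
qed

lemma INF_stieltjes_neg: "(INF z\<in>{..<a}. ereal (stieltjes \<mu> z)) < 0"
  using INF_stieltjes_less[of "a - 1"] stieltjes_neg[of "a - 1"]
  by (simp add: order.strict_trans zero_ereal_def)

text \<open>By monotonicity the one-sided limit is an infimum, taken in \<open>ereal\<close> because
  it may be \<open>- \<infinity>\<close>. In this form, an edge value below \<open>t\<close>
  immediately provides a point whose transform is below \<open>t\<close>.\<close>

lemma tendsto_stieltjes_edge:
  "((\<lambda>z. ereal (stieltjes \<mu> z)) \<longlongrightarrow> (INF z\<in>{..<a}. ereal (stieltjes \<mu> z))) (at_left a)"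
proof (rule decreasing_tendsto)
  have lt: "\<forall>\<^sub>F z in at_left a. z < a" by (simp add: eventually_at_filter)
  show "\<forall>\<^sub>F z in at_left a. (INF z\<in>{..<a}. ereal (stieltjes \<mu> z)) \<le> ereal (stieltjes \<mu> z)"
    using lt by eventually_elim (rule INF_lower, simp)
  fix s assume "(INF z\<in>{..<a}. ereal (stieltjes \<mu> z)) < s"
  then obtain y where y: "y < a" "ereal (stieltjes \<mu> y) < s" by (auto simp: INF_less_iff)
  have "\<forall>\<^sub>F z in at_left a. z \<in> {y<..<a}" by (rule eventually_at_left_real[OF y(1)])
  then show "\<forall>\<^sub>F z in at_left a. ereal (stieltjes \<mu> z) < s"
  proof eventually_elim
    fix z assume "z \<in> {y<..<a}"
    then have "ereal (stieltjes \<mu> z) < ereal (stieltjes \<mu> y)" using stieltjes_decreasing[of y z] by simp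
    then show "ereal (stieltjes \<mu> z) < s" using y(2) by (rule order.strict_trans)
  qed
qed

text \<open>Provides the assumption \<open>upper\<close> of \<open>edge_spectrum\<close>. The kernel
  at \<open>z < a\<close> is unbounded, so weak convergence is applied to a truncation at
  \<open>z + \<epsilon>\<close>, still left of \<open>a\<close>; since the smallest eigenvalue tends
  to \<open>a\<close>, the truncation does not affect any eigenvalue for large
  \<open>n\<close>.\<close>

lemma averaged_kernel_bound:
  fixes lam :: "nat \<Rightarrow> nat \<Rightarrow> real"
  assumes weak: "\<And>g :: real \<Rightarrow> real. continuous_on UNIV g \<Longrightarrow> bounded (range g) \<Longrightarrow>
       (\<lambda>n. (1 / real n) * (\<Sum>i\<in>{1..n}. g (lam n i))) \<longlonglongrightarrow> (\<integral>t. g t \<partial>\<mu>)"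
    and mono: "\<And>n i. i \<in> {1..n} \<Longrightarrow> lam n 1 \<le> lam n i"
    and lim: "(\<lambda>n. lam n 1) \<longlonglongrightarrow> a"
    and s: "(INF z\<in>{..<a}. ereal (stieltjes \<mu> z)) < ereal s"
  shows "\<exists>z \<epsilon>. \<epsilon> > 0 \<and> (\<forall>\<^sub>F n in sequentially. z + \<epsilon> \<le> lam n 1 \<and>
           (1 / real n) * (\<Sum>i\<in>{1..n}. 1 / (z - lam n i)) \<le> s)"
proof -
  obtain z where z: "z < a" "stieltjes \<mu> z < s" using s by (auto simp: INF_less_iff)
  define \<epsilon> where "\<epsilon> = (a - z) / 2"
  have \<epsilon>: "\<epsilon> > 0" "z + \<epsilon> < a" using z by (auto simp: \<epsilon>_def field_simps)
  define g where "g = (\<lambda>t. 1 / (z - max t (z + \<epsilon>)))"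
  have ne: "z - max t (z + \<epsilon>) \<noteq> 0" for t using \<epsilon> by auto
  have "continuous_on UNIV g" unfolding g_def using ne by (auto intro!: continuous_intros)
  moreover have "bounded (range g)"
  proof (rule boundedI[of _ "1 / \<epsilon>"])
    fix y assume "y \<in> range g"
    then obtain t where y: "y = g t" by blast
    have "norm (g t) = 1 / \<bar>z - max t (z + \<epsilon>)\<bar>" by (simp add: g_def)
    also have "\<dots> \<le> 1 / \<epsilon>" using \<epsilon> by (intro divide_left_mono) auto
    finally show "norm y \<le> 1 / \<epsilon>" using y by simp
  qed
  ultimately have "(\<lambda>n. (1 / real n) * (\<Sum>i\<in>{1..n}. g (lam n i))) \<longlonglongrightarrow> (\<integral>t. g t \<partial>\<mu>)" by (rule weak)
  moreover have "(\<integral>t. g t \<partial>\<mu>) = stieltjes \<mu> z"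
    unfolding stieltjes_def
  proof (rule integral_cong_AE)
    show "g \<in> borel_measurable \<mu>" unfolding g_def using sets_borel by (simp cong: measurable_cong_sets)
    show "AE t in \<mu>. g t = 1 / (z - t)"
      using AE_ge by eventually_elim (use \<epsilon> in \<open>simp add: g_def max_def\<close>)
  qed (rule measurable_kernel)
  ultimately have "\<forall>\<^sub>F n in sequentially. (1 / real n) * (\<Sum>i\<in>{1..n}. g (lam n i)) < s"
    using z(2) by (auto intro: order_tendstoD(2))
  moreover have "\<forall>\<^sub>F n in sequentially. z + \<epsilon> < lam n 1" by (rule order_tendstoD(1)[OF lim \<epsilon>(2)])
  ultimately have "\<forall>\<^sub>F n in sequentially. z + \<epsilon> \<le> lam n 1 \<and>
           (1 / real n) * (\<Sum>i\<in>{1..n}. 1 / (z - lam n i)) \<le> s"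
  proof eventually_elim
    case (elim n)
    have "g (lam n i) = 1 / (z - lam n i)" if "i \<in> {1..n}" for i
      using mono[OF that] elim(2) by (simp add: g_def max_def)
    then have "(\<Sum>i\<in>{1..n}. g (lam n i)) = (\<Sum>i\<in>{1..n}. 1 / (z - lam n i))" by (rule sum.cong[OF refl])
    then show ?case using elim by simp
  qed
  with \<epsilon>(1) show ?thesis by blast
qed

end

section \<open>Reflection, edge values and critical values\<close>

lemma measurable_uminus_borel:
  assumes "sets \<mu> = sets (borel :: real measure)"
  shows "(uminus :: real \<Rightarrow> real) \<in> \<mu> \<rightarrow>\<^sub>M borel"
proof -
  have "(uminus :: real \<Rightarrow> real) \<in> borel \<rightarrow>\<^sub>M borel" by simp
  then show ?thesis unfolding measurable_def using assms sets_eq_imp_space_eq[OF assms] by simp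
qed

lemma measure_above_reflect:
  assumes "prob_space \<mu>" and sets: "sets \<mu> = sets borel" and "AE t in \<mu>. t \<le> b"
  shows "measure_above (distr \<mu> borel uminus) (- b)"
    and "stieltjes (distr \<mu> borel uminus) z = - stieltjes \<mu> (- z)"
proof -
  interpret prob_space \<mu> by fact
  note meas = measurable_uminus_borel[OF sets]
  show "measure_above (distr \<mu> borel uminus) (- b)"
  proof (intro measure_above.intro measure_above_axioms.intro)
    show "prob_space (distr \<mu> borel uminus)" by (rule prob_space_distr[OF meas])
    show "AE t in distr \<mu> borel uminus. - b \<le> t"
      using assms(3) by (subst AE_distr_iff[OF meas]) auto
  qed simp
  have "stieltjes (distr \<mu> borel uminus) z = (\<integral>t. 1 / (z - (- t)) \<partial>\<mu>)"
    unfolding stieltjes_def by (rule integral_distr[OF meas]) auto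
  also have "\<dots> = (\<integral>t. - (1 / (- z - t)) \<partial>\<mu>)"
    by (intro Bochner_Integration.integral_cong refl) (metis add.inverse_inverse diff_minus_eq_add minus_diff_eq minus_divide_right add.commute)
  also have "\<dots> = - stieltjes \<mu> (- z)" unfolding stieltjes_def by (rule Bochner_Integration.integral_minus)
  finally show "stieltjes (distr \<mu> borel uminus) z = - stieltjes \<mu> (- z)" .
qed

lemma G_left_eq_INF:
  assumes "measure_above \<mu> (Inf (msupp \<mu>))"
  shows "G_left \<mu> = (INF z\<in>{..<Inf (msupp \<mu>)}. ereal (stieltjes \<mu> z))"
  unfolding G_left_def
  by (rule tendsto_Lim[OF _ measure_above.tendsto_stieltjes_edge[OF assms]]) simp

lemma G_right_eq_INF:
  assumes "prob_space \<mu>" "sets \<mu> = sets borel" and b: "AE t in \<mu>. t \<le> Sup (msupp \<mu>)"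
  shows "- G_right \<mu> = (INF z\<in>{..< - Sup (msupp \<mu>)}. ereal (stieltjes (distr \<mu> borel uminus) z))"
proof -
  let ?b = "Sup (msupp \<mu>)" and ?\<mu> = "distr \<mu> borel uminus"
  note refl = measure_above_reflect[OF assms]
  let ?I = "INF z\<in>{..< - ?b}. ereal (stieltjes ?\<mu> z)"
  have "((\<lambda>z. - ereal (stieltjes ?\<mu> z)) \<longlongrightarrow> - ?I) (at_left (- ?b))"
    using measure_above.tendsto_stieltjes_edge[OF refl(1)] by (rule tendsto_uminus_ereal)
  then have "((\<lambda>z. ereal (stieltjes \<mu> z)) \<longlongrightarrow> - ?I) (at_right ?b)"
    by (simp add: refl(2) at_right_minus[of ?b] filterlim_filtermap)
  then have "G_right \<mu> = - ?I" unfolding G_right_def by (intro tendsto_Lim) simp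
  then show ?thesis by simp
qed

text \<open>The case \<open>G = - \<infinity>\<close> is included: then
  \<open>ereal_inv G = 0\<close>, the first equivalence reduces to \<open>\<theta> < 0\<close>, and
  both sides of the second are false.\<close>

lemma less_inverse_iff:
  fixes G :: ereal and \<theta> :: real
  assumes "G < 0" "\<theta> \<noteq> 0"
  shows "\<theta> < ereal_inv G \<longleftrightarrow> \<theta> < 0 \<and> G < ereal (1 / \<theta>)" "\<theta> = ereal_inv G \<longleftrightarrow> ereal (1 / \<theta>) = G"
proof -
  have "(\<theta> < ereal_inv G \<longleftrightarrow> \<theta> < 0 \<and> G < ereal (1 / \<theta>)) \<and> (\<theta> = ereal_inv G \<longleftrightarrow> ereal (1 / \<theta>) = G)"
  proof (cases G)
    case (real g)
    with assms have g: "g < 0" by simp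
    have "\<theta> < 1 / g \<longleftrightarrow> \<theta> < 0 \<and> g < 1 / \<theta>"
    proof (cases "\<theta> < 0")
      case True
      then show ?thesis using g by (simp add: neg_less_divide_eq mult.commute)
    next
      case False
      have "1 / g < 0" using g by simp
      then show ?thesis using False by linarith
    qed
    then show ?thesis using real g assms by (auto simp: ereal_inv_def field_simps)
  qed (use assms in \<open>auto simp: ereal_inv_def\<close>)
  then show "\<theta> < ereal_inv G \<longleftrightarrow> \<theta> < 0 \<and> G < ereal (1 / \<theta>)" "\<theta> = ereal_inv G \<longleftrightarrow> ereal (1 / \<theta>) = G" by auto
qed

lemma ereal_inv_uminus: "ereal_inv (- G) = - ereal_inv G" by (cases G) (auto simp: ereal_inv_def)

text \<open>Eliminates \<open>rho\<close> and the critical values: from here on only the position of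
  \<open>1 / \<theta>\<close> relative to the edge values matters. The definite description in
  \<open>rho\<close> is legitimate because the transform is negative and strictly monotone left of
  the support, and positive and strictly monotone right of it.\<close>

lemma rho_position:
  fixes \<mu> :: "real measure"
  assumes \<mu>: "prob_space \<mu>" "sets \<mu> = sets borel" "compact (msupp \<mu>)" and "\<theta> \<noteq> 0"
  shows "rho \<mu> \<theta> < Inf (msupp \<mu>) \<longleftrightarrow> \<theta> < 0 \<and> G_left \<mu> < ereal (1 / \<theta>)"
    and "Sup (msupp \<mu>) < rho \<mu> \<theta> \<longleftrightarrow> 0 < \<theta> \<and> ereal (1 / \<theta>) < G_right \<mu>"
    and "G_left \<mu> < 0" "0 < G_right \<mu>"
    and "\<theta> = theta_under \<mu> \<longleftrightarrow> ereal (1 / \<theta>) = G_left \<mu>" "\<theta> = theta_bar \<mu> \<longleftrightarrow> ereal (1 / \<theta>) = G_right \<mu>"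
proof -
  let ?a = "Inf (msupp \<mu>)" and ?b = "Sup (msupp \<mu>)" and ?\<mu> = "distr \<mu> borel uminus"
  note bd = msupp_bounds[OF \<mu>]
  interpret L: measure_above \<mu> ?a
    using bd \<mu> by (simp add: measure_above_def measure_above_axioms_def)
  interpret R: measure_above ?\<mu> "- ?b" by (rule measure_above_reflect[OF \<mu>(1,2) bd(3)])
  note Gl = G_left_eq_INF[OF L.measure_above_axioms] and Gr = G_right_eq_INF[OF \<mu>(1,2) bd(3)]
  have refl: "stieltjes \<mu> z = - stieltjes ?\<mu> (- z)" for z
    by (simp add: measure_above_reflect(2)[OF \<mu>(1,2) bd(3)])
  show Gl0: "G_left \<mu> < 0" unfolding Gl by (rule L.INF_stieltjes_neg)
  have Gr0': "- G_right \<mu> < 0" unfolding Gr by (rule R.INF_stieltjes_neg)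
  then show Gr0: "0 < G_right \<mu>" by (cases "G_right \<mu>") auto
  have under: "\<theta> < theta_under \<mu> \<longleftrightarrow> \<theta> < 0 \<and> G_left \<mu> < ereal (1 / \<theta>)"
    unfolding theta_under_def by (rule less_inverse_iff(1)[OF Gl0 assms(4)])
  show "\<theta> = theta_under \<mu> \<longleftrightarrow> ereal (1 / \<theta>) = G_left \<mu>"
    unfolding theta_under_def by (rule less_inverse_iff(2)[OF Gl0 assms(4)])
  have mt: "- \<theta> \<noteq> 0" using assms(4) by simp
  have "- \<theta> < - theta_bar \<mu> \<longleftrightarrow> - \<theta> < 0 \<and> - G_right \<mu> < ereal (1 / - \<theta>)"
    unfolding theta_bar_def ereal_inv_uminus[symmetric] by (rule less_inverse_iff(1)[OF Gr0' mt])
  moreover have "- G_right \<mu> < ereal (1 / - \<theta>) \<longleftrightarrow> ereal (1 / \<theta>) < G_right \<mu>"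
    by (cases "G_right \<mu>") auto
  ultimately have bar: "theta_bar \<mu> < \<theta> \<longleftrightarrow> 0 < \<theta> \<and> ereal (1 / \<theta>) < G_right \<mu>" by simp
  have "- \<theta> = - theta_bar \<mu> \<longleftrightarrow> ereal (1 / - \<theta>) = - G_right \<mu>"
    unfolding theta_bar_def ereal_inv_uminus[symmetric] by (rule less_inverse_iff(2)[OF Gr0' mt])
  moreover have "ereal (1 / - \<theta>) = - G_right \<mu> \<longleftrightarrow> ereal (1 / \<theta>) = G_right \<mu>"
    by (cases "G_right \<mu>") auto
  ultimately show "\<theta> = theta_bar \<mu> \<longleftrightarrow> ereal (1 / \<theta>) = G_right \<mu>" by simp
  have pos: "0 < stieltjes \<mu> z" if "?b < z" for z
    using R.stieltjes_neg[of "- z"] that by (simp add: refl)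
  have low: "rho \<mu> \<theta> < ?a" if h: "\<theta> < theta_under \<mu>"
  proof -
    from h under have t: "\<theta> < 0" "G_left \<mu> < ereal (1 / \<theta>)" by auto
    then obtain y where "y < ?a" "stieltjes \<mu> y < 1 / \<theta>" unfolding Gl by (auto simp: INF_less_iff)
    then obtain z where z: "z < ?a" "stieltjes \<mu> z = 1 / \<theta>"
      using L.stieltjes_attains[of "1 / \<theta>" y] t by auto
    have "(THE z. (z < ?a \<or> ?b < z) \<and> stieltjes \<mu> z = 1 / \<theta>) = z"
    proof (rule the_equality)
      fix y assume y: "(y < ?a \<or> ?b < y) \<and> stieltjes \<mu> y = 1 / \<theta>"
      have "1 / \<theta> < 0" using t by simp
      then have "y < ?a" using y pos[of y] by auto
      then show "y = z"
        using y z L.stieltjes_decreasing[of y z] L.stieltjes_decreasing[of z y] by (cases y z rule: linorder_cases) auto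
    qed (use z in auto)
    then show ?thesis using z h by (simp add: rho_def Let_def)
  qed
  have high: "?b < rho \<mu> \<theta>" if h: "theta_bar \<mu> < \<theta>"
  proof -
    from h bar have t: "0 < \<theta>" "ereal (1 / \<theta>) < G_right \<mu>" by auto
    then have "- G_right \<mu> < ereal (- (1 / \<theta>))" by (cases "G_right \<mu>") auto
    then obtain y where "y < - ?b" "stieltjes ?\<mu> y < - (1 / \<theta>)" unfolding Gr by (auto simp: INF_less_iff)
    then obtain z' where z': "z' < - ?b" "stieltjes ?\<mu> z' = - (1 / \<theta>)"
      using R.stieltjes_attains[of "- (1 / \<theta>)" y] t by auto
    define z where "z = - z'"
    have z: "?b < z" "stieltjes \<mu> z = 1 / \<theta>" using z' by (auto simp: z_def refl)
    have "(THE z. (z < ?a \<or> ?b < z) \<and> stieltjes \<mu> z = 1 / \<theta>) = z"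
    proof (rule the_equality)
      fix y assume y: "(y < ?a \<or> ?b < y) \<and> stieltjes \<mu> y = 1 / \<theta>"
      have "0 < 1 / \<theta>" using t by simp
      then have "?b < y" using y L.stieltjes_neg[of y] by auto
      then show "y = z"
        using y z R.stieltjes_decreasing[of "- y" "- z"] R.stieltjes_decreasing[of "- z" "- y"]
        by (cases y z rule: linorder_cases) (auto simp: refl)
    qed (use z in auto)
    then show ?thesis using z h by (simp add: rho_def Let_def)
  qed
  have mid: "rho \<mu> \<theta> = ?a \<or> rho \<mu> \<theta> = ?b" if "\<not> \<theta> < theta_under \<mu>" "\<not> theta_bar \<mu> < \<theta>"
    using that by (simp add: rho_def Let_def)
  show "rho \<mu> \<theta> < ?a \<longleftrightarrow> \<theta> < 0 \<and> G_left \<mu> < ereal (1 / \<theta>)"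
    using low high mid bd(1) unfolding under[symmetric] by force
  show "?b < rho \<mu> \<theta> \<longleftrightarrow> 0 < \<theta> \<and> ereal (1 / \<theta>) < G_right \<mu>"
    using low high mid bd(1) unfolding bar[symmetric] by force
qed

section \<open>Counting perturbed eigenvalues\<close>

text \<open>The spectral form of \<open>(z - X)^(-1) / n\<close>. The factor \<open>1 / n\<close>
  absorbs the normalization of the vectors, so the concentration lemma can be used with entries of
  variance one.\<close>

definition avg_resolvent :: "nat \<Rightarrow> (nat \<Rightarrow> real) \<Rightarrow> (nat \<Rightarrow> nat \<Rightarrow> complex) \<Rightarrow> real \<Rightarrow> nat \<Rightarrow> nat \<Rightarrow> complex" where
  "avg_resolvent n f v z i j = (\<Sum>k\<in>{1..n}. complex_of_real (1 / (real n * (z - f k))) * (v k i * cnj (v k j)))"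

lemma sum_cmod_sq_orthonormal:
  assumes "orthonormal_sys n v K" "k \<in> K"
  shows "(\<Sum>i<n. (cmod (v k i))\<^sup>2) = 1"
proof -
  have "complex_of_real (\<Sum>i<n. (cmod (v k i))\<^sup>2) = 1"
    using assms cip_self[of n "v k"] by (auto simp: orthonormal_sys_def)
  then show ?thesis by (simp only: of_real_eq_1_iff)
qed

lemma avg_resolvent_trace:
  assumes "orthonormal_sys n v {1..n}"
  shows "(\<Sum>i<n. avg_resolvent n f v z i i) = complex_of_real (1 / real n * (\<Sum>k\<in>{1..n}. 1 / (z - f k)))"
proof -
  have "(\<Sum>i<n. avg_resolvent n f v z i i)
      = (\<Sum>k\<in>{1..n}. \<Sum>i<n. complex_of_real (1 / (real n * (z - f k))) * (v k i * cnj (v k i)))"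
    unfolding avg_resolvent_def by (rule sum.swap)
  also have "\<dots> = (\<Sum>k\<in>{1..n}. complex_of_real (1 / (real n * (z - f k))))"
  proof (rule sum.cong[OF refl])
    fix k assume k: "k \<in> {1..n}"
    have "(\<Sum>i<n. v k i * cnj (v k i)) = complex_of_real (\<Sum>i<n. (cmod (v k i))\<^sup>2)"
      unfolding of_real_sum by (simp only: complex_norm_square)
    also have "\<dots> = 1" unfolding sum_cmod_sq_orthonormal[OF assms k] by simp
    finally show "(\<Sum>i<n. complex_of_real (1 / (real n * (z - f k))) * (v k i * cnj (v k i)))
        = complex_of_real (1 / (real n * (z - f k)))"
      by (simp only: sum_distrib_left[symmetric] mult_1_right)
  qed
  also have "\<dots> = complex_of_real (1 / real n * (\<Sum>k\<in>{1..n}. 1 / (z - f k)))"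
    unfolding of_real_sum[symmetric] sum_distrib_left by simp
  finally show ?thesis .
qed

text \<open>Parseval's identity in each row. The right-hand side is the quantity that the second
  condition of the hypothesis controls.\<close>

lemma avg_resolvent_hs:
  assumes on: "orthonormal_sys n v {1..n}"
  shows "(\<Sum>i<n. \<Sum>j<n. (cmod (avg_resolvent n f v z i j))\<^sup>2) = 1 / (real n)\<^sup>2 * (\<Sum>k\<in>{1..n}. 1 / (z - f k)\<^sup>2)"
proof -
  define c where "c = (\<lambda>k. 1 / (real n * (z - f k)))"
  have row: "(\<Sum>j<n. (cmod (avg_resolvent n f v z i j))\<^sup>2) = (\<Sum>k\<in>{1..n}. (c k)\<^sup>2 * (cmod (v k i))\<^sup>2)" for i
  proof -
    define y where "y = (\<lambda>j. \<Sum>k\<in>{1..n}. (complex_of_real (c k) * cnj (v k i)) * v k j)"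
    have "cnj (avg_resolvent n f v z i j) = y j" for j
      by (simp add: avg_resolvent_def y_def c_def mult_ac)
    then have "(\<Sum>j<n. (cmod (avg_resolvent n f v z i j))\<^sup>2) = (\<Sum>j<n. (cmod (y j))\<^sup>2)"
      by (metis complex_mod_cnj)
    also have "\<dots> = (\<Sum>k\<in>{1..n}. (cmod (cip n (v k) y))\<^sup>2)" by (rule sum_cmod_coords[OF on, symmetric])
    also have "\<dots> = (\<Sum>k\<in>{1..n}. (c k)\<^sup>2 * (cmod (v k i))\<^sup>2)"
      unfolding y_def
      by (intro sum.cong refl, subst coords_of_combination[OF on order_refl])
         (auto simp: norm_mult power_mult_distrib)
    finally show ?thesis .
  qed
  have "(\<Sum>i<n. \<Sum>j<n. (cmod (avg_resolvent n f v z i j))\<^sup>2) = (\<Sum>k\<in>{1..n}. \<Sum>i<n. (c k)\<^sup>2 * (cmod (v k i))\<^sup>2)"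
    unfolding row by (rule sum.swap)
  also have "\<dots> = (\<Sum>k\<in>{1..n}. (c k)\<^sup>2)"
    unfolding sum_distrib_left[symmetric]
    by (intro sum.cong refl) (simp only: sum_cmod_sq_orthonormal[OF on] mult_1_right)
  also have "\<dots> = 1 / (real n)\<^sup>2 * (\<Sum>k\<in>{1..n}. 1 / (z - f k)\<^sup>2)"
    unfolding sum_distrib_left by (intro sum.cong refl) (simp add: c_def power_divide power_mult_distrib)
  finally show ?thesis .
qed

lemma avg_resolvent_form:
  fixes x y :: "nat \<Rightarrow> complex"
  assumes "n > 0"
  shows "(\<Sum>i<n. \<Sum>j<n. avg_resolvent n f v z i j * cnj (x i) * y j)
    = (\<Sum>k\<in>{1..n}. cip n (\<lambda>i. x i / complex_of_real (sqrt (real n))) (v k)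
          * cip n (v k) (\<lambda>i. y i / complex_of_real (sqrt (real n))) / complex_of_real (z - f k))"
proof -
  let ?s = "complex_of_real (sqrt (real n))"
  let ?c = "\<lambda>k. complex_of_real (1 / (real n * (z - f k)))"
  have "(\<Sum>i<n. \<Sum>j<n. avg_resolvent n f v z i j * cnj (x i) * y j)
      = (\<Sum>i<n. \<Sum>j<n. \<Sum>k\<in>{1..n}. ?c k * (cnj (x i) * v k i) * (cnj (v k j) * y j))"
    unfolding avg_resolvent_def sum_distrib_right by (simp only: mult_ac)
  also have "\<dots> = (\<Sum>k\<in>{1..n}. ?c k * (cip n x (v k) * cip n (v k) y))" by (rule sum_rank_one_form)
  also have "\<dots> = (\<Sum>k\<in>{1..n}. cip n (\<lambda>i. x i / ?s) (v k)
          * cip n (v k) (\<lambda>i. y i / ?s) / complex_of_real (z - f k))"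
  proof (rule sum.cong[OF refl])
    fix k
    have "cip n (\<lambda>i. x i / ?s) (v k) = cip n x (v k) / ?s"
      by (simp add: cip_def sum_divide_distrib)
    moreover have "cip n (v k) (\<lambda>i. y i / ?s) = cip n (v k) y / ?s"
      by (simp add: cip_def sum_divide_distrib)
    moreover have "?s * ?s = of_nat n"
      by (simp only: of_real_mult[symmetric] real_sqrt_mult_self abs_of_nat of_real_of_nat_eq)
    ultimately show "?c k * (cip n x (v k) * cip n (v k) y)
      = cip n (\<lambda>i. x i / ?s) (v k)
          * cip n (v k) (\<lambda>i. y i / ?s) / complex_of_real (z - f k)" by simp
  qed
  finally show ?thesis .
qed

text \<open>The matrix \<open>K(z)\<close> of the overview before \<open>\<Theta>\<inverse>\<close>
  is subtracted.\<close>

definition schur_entry :: "nat \<Rightarrow> (nat \<Rightarrow> real) \<Rightarrow> (nat \<Rightarrow> nat \<Rightarrow> complex) \<Rightarrow> (nat \<Rightarrow> nat \<Rightarrow> complex) \<Rightarrow> real \<Rightarrow> nat \<Rightarrow> nat \<Rightarrow> complex" where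
  "schur_entry n f v u z l m = (\<Sum>k\<in>{1..n}. cip n (u l) (v k) * cip n (v k) (u m) / complex_of_real (z - f k))"

text \<open>Errors of modulus at most \<epsilon> in the entries of an r by r matrix change its
  quadratic form by at most \<open>r * \<epsilon>\<close> times the squared norm, hence the margin
  \<open>real r * \<epsilon>\<close>. The conclusion is the hypothesis \<open>pos\<close> of
  \<open>perturbed_inertia\<close>.\<close>

lemma near_diagonal_form_bound:
  assumes close: "\<And>l m. l \<in> {1..r} \<Longrightarrow> m \<in> {1..r} \<Longrightarrow>
      cmod (schur_entry n f v u z l m - (if l = m then complex_of_real g else 0)) \<le> \<epsilon>"
    and big: "\<And>l. l \<in> {1..r} \<Longrightarrow> l \<notin> N \<Longrightarrow> 1 / \<theta> l + real r * \<epsilon> \<le> g"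
    and c: "\<forall>l\<in>N. c l = 0"
  shows "(\<Sum>l\<in>{1..r}. (cmod (c l))\<^sup>2 / \<theta> l)
        \<le> (\<Sum>k\<in>{1..n}. (cmod (\<Sum>l\<in>{1..r}. cip n (v k) (u l) * c l))\<^sup>2 / (z - f k))"
proof -
  let ?T = "schur_entry n f v u z"
  let ?t = "\<lambda>k l m. cnj (c l) * c m * (cip n (u l) (v k) * cip n (v k) (u m) / complex_of_real (z - f k))"
  let ?E = "\<lambda>l m. ?T l m - (if l = m then complex_of_real g else 0)"
  let ?S = "\<Sum>m\<in>{1..r}. \<Sum>l\<in>{1..r}. cnj (c l) * c m * ?E l m"
  define Q where "Q = (\<Sum>k\<in>{1..n}. (cmod (\<Sum>l\<in>{1..r}. cip n (v k) (u l) * c l))\<^sup>2 / (z - f k))"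
  define W where "W = (\<Sum>l\<in>{1..r}. (cmod (c l))\<^sup>2)"
  have "complex_of_real Q = (\<Sum>k\<in>{1..n}. (\<Sum>m\<in>{1..r}. cip n (v k) (u m) * c m)
       * cnj (\<Sum>l\<in>{1..r}. cip n (v k) (u l) * c l) / complex_of_real (z - f k))"
    unfolding Q_def of_real_sum of_real_divide complex_norm_square ..
  also have "\<dots> = (\<Sum>k\<in>{1..n}. \<Sum>m\<in>{1..r}. \<Sum>l\<in>{1..r}. ?t k l m)"
    unfolding cnj_sum complex_cnj_mult cip_cnj sum_product unfolding sum_divide_distrib
    by (intro sum.cong refl) simp
  also have "\<dots> = (\<Sum>m\<in>{1..r}. \<Sum>k\<in>{1..n}. \<Sum>l\<in>{1..r}. ?t k l m)"
    by (rule sum.swap)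
  also have "\<dots> = (\<Sum>m\<in>{1..r}. \<Sum>l\<in>{1..r}. \<Sum>k\<in>{1..n}. ?t k l m)"
    by (intro sum.cong refl sum.swap)
  also have "\<dots> = (\<Sum>m\<in>{1..r}. \<Sum>l\<in>{1..r}. cnj (c l) * c m * ?T l m)"
    unfolding schur_entry_def sum_distrib_left ..
  also have "\<dots> = (\<Sum>m\<in>{1..r}. \<Sum>l\<in>{1..r}. cnj (c l) * c m * ?E l m + (if l = m then complex_of_real g * (c m * cnj (c m)) else 0))"
    by (intro sum.cong refl) (simp add: algebra_simps)
  also have "\<dots> = ?S + (\<Sum>m\<in>{1..r}. complex_of_real g * (c m * cnj (c m)))"
    by (simp only: sum.distrib) (simp add: sum.delta)
  also have "(\<Sum>m\<in>{1..r}. complex_of_real g * (c m * cnj (c m))) = complex_of_real (g * W)"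
    unfolding W_def sum_distrib_left of_real_sum of_real_mult complex_norm_square ..
  finally have eq: "complex_of_real Q
      = ?S + complex_of_real (g * W)" .
  have Q: "Q = Re ?S + g * W"
    using arg_cong[OF eq, of Re] by (simp only: plus_complex.sel Re_complex_of_real)
  have "cmod ?S
     \<le> (\<Sum>m\<in>{1..r}. \<Sum>l\<in>{1..r}. \<epsilon> * (((cmod (c l))\<^sup>2 + (cmod (c m))\<^sup>2) / 2))"
  proof (intro sum_norm_le)
    fix l m assume lm: "m \<in> {1..r}" "l \<in> {1..r}"
    have "0 \<le> (cmod (c l) - cmod (c m))\<^sup>2" by simp
    then have 1: "cmod (c l) * cmod (c m) \<le> ((cmod (c l))\<^sup>2 + (cmod (c m))\<^sup>2) / 2"
      by (simp add: power2_eq_square algebra_simps)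
    have e: "cmod (?E l m) \<le> \<epsilon>" by (rule close[OF lm(2,1)])
    then have "0 \<le> \<epsilon>" using norm_ge_zero order_trans by blast
    have "cmod (cnj (c l) * c m * ?E l m) = (cmod (c l) * cmod (c m)) * cmod (?E l m)" by (simp add: norm_mult)
    also have "\<dots> \<le> ((cmod (c l))\<^sup>2 + (cmod (c m))\<^sup>2) / 2 * \<epsilon>" by (intro mult_mono 1 e) auto
    finally show "cmod (cnj (c l) * c m * ?E l m) \<le> \<epsilon> * (((cmod (c l))\<^sup>2 + (cmod (c m))\<^sup>2) / 2)"
      by (simp only: mult.commute)
  qed
  also have "\<dots> = real r * \<epsilon> * W"
  proof -
    have "(\<Sum>l\<in>{1..r}. \<epsilon> * (((cmod (c l))\<^sup>2 + b) / 2)) = \<epsilon> / 2 * (W + real r * b)" for b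
    proof -
      have "(\<Sum>l\<in>{1..r}. \<epsilon> * (((cmod (c l))\<^sup>2 + b) / 2)) = \<epsilon> * ((\<Sum>l\<in>{1..r}. (cmod (c l))\<^sup>2 + b) / 2)"
        unfolding sum_distrib_left sum_divide_distrib ..
      then show ?thesis by (simp add: sum.distrib W_def)
    qed
    then have "(\<Sum>m\<in>{1..r}. \<Sum>l\<in>{1..r}. \<epsilon> * (((cmod (c l))\<^sup>2 + (cmod (c m))\<^sup>2) / 2))
        = (\<Sum>m\<in>{1..r}. \<epsilon> / 2 * (W + real r * (cmod (c m))\<^sup>2))" by (intro sum.cong refl)
    also have "\<dots> = \<epsilon> / 2 * (real r * W + real r * W)"
      unfolding sum_distrib_left[symmetric] sum.distrib by (simp add: W_def sum_distrib_left)
    finally show ?thesis by simp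
  qed
  finally have "- (real r * \<epsilon> * W) \<le> Re ?S"
    using abs_Re_le_cmod[of ?S] by linarith
  then have "(g - real r * \<epsilon>) * W \<le> Q" unfolding Q by (simp add: algebra_simps)
  moreover have "(\<Sum>l\<in>{1..r}. (cmod (c l))\<^sup>2 / \<theta> l) \<le> (\<Sum>l\<in>{1..r}. (g - real r * \<epsilon>) * (cmod (c l))\<^sup>2)"
  proof (rule sum_mono)
    fix l assume l: "l \<in> {1..r}"
    show "(cmod (c l))\<^sup>2 / \<theta> l \<le> (g - real r * \<epsilon>) * (cmod (c l))\<^sup>2"
    proof (cases "l \<in> N")
      case False
      then have "1 / \<theta> l * (cmod (c l))\<^sup>2 \<le> (g - real r * \<epsilon>) * (cmod (c l))\<^sup>2"
        using big[OF l] by (intro mult_right_mono) auto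
      then show ?thesis by simp
    qed (use c in simp)
  qed
  ultimately show ?thesis unfolding Q_def W_def by (simp add: sum_distrib_left)
qed

section \<open>Comparison of the two counting functions\<close>

lemma perturbed_uminus:
  assumes "X \<in> carrier_mat n n"
  shows "mat n n (\<lambda>(i,j). - perturbed n X r \<theta> u $$ (i,j))
    = perturbed n (mat n n (\<lambda>(i,j). - X $$ (i,j))) r (\<lambda>k. - \<theta> k) u"
  by (rule eq_matI) (simp_all add: perturbed_def sum_negf)

lemma bij_reflect: "bij_betw (\<lambda>k. Suc n - k) {1..n} {1..n}"
  by (rule bij_betw_byWitness[of _ "\<lambda>k. Suc n - k"]) auto

lemma card_reflect: "card {k\<in>{1..n}. P (Suc n - k)} = card {k\<in>{1..n}. P k}"
proof (rule bij_betw_same_card[of "\<lambda>k. Suc n - k"])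
  show "bij_betw (\<lambda>k. Suc n - k) {k \<in> {1..n}. P (Suc n - k)} {k \<in> {1..n}. P k}"
    by (rule bij_betw_byWitness[of _ "\<lambda>k. Suc n - k"]) auto
qed

lemma card_split:
  assumes "finite A" "\<And>k. k \<in> A \<Longrightarrow> Q k \<longleftrightarrow> \<not> P k"
  shows "card {k\<in>A. P k} + card {k\<in>A. Q k} = card A"
proof -
  have "{k\<in>A. P k} \<union> {k\<in>A. Q k} = A" "{k\<in>A. P k} \<inter> {k\<in>A. Q k} = {}" using assms(2) by auto
  then show ?thesis using assms(1) by (metis (no_types, lifting) card_Un_disjoint finite_Un)
qed

text \<open>In this context \<gamma> is the approximate common diagonal value of the Schur matrix,
  and \<open>N\<close> is the set of indices at which \<open>\<gamma> - 1 / \<theta> l\<close> is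
  negative, that is, the negative squares of \<open>K(z)\<close>.\<close>

context
  fixes n r :: nat and X f v \<theta> u g w z \<epsilon> \<gamma> N
  assumes X: "eigensystem n X f v" and Y: "eigensystem n (perturbed n X r \<theta> u) g w"
    and z: "\<And>k. k \<in> {1..n} \<Longrightarrow> f k \<noteq> z"
    and \<theta>: "\<And>l. l \<in> {1..r} \<Longrightarrow> \<theta> l \<noteq> 0" and N: "N \<subseteq> {1..r}"
    and close: "\<And>l m. l \<in> {1..r} \<Longrightarrow> m \<in> {1..r} \<Longrightarrow>
      cmod (schur_entry n f v u z l m - (if l = m then complex_of_real \<gamma> else 0)) \<le> \<epsilon>"
    and above: "\<And>l. l \<in> {1..r} \<Longrightarrow> l \<notin> N \<Longrightarrow> 1 / \<theta> l + real r * \<epsilon> \<le> \<gamma>"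
    and below: "\<And>l. l \<in> N \<Longrightarrow> \<gamma> + real r * \<epsilon> \<le> 1 / \<theta> l"
begin

lemma perturbed_count_le:
  "card {j\<in>{1..n}. g j < z} + card {l\<in>{1..r}. 0 < \<theta> l} \<le> card {k\<in>{1..n}. f k < z} + card N"
  by (rule perturbed_inertia[OF X Y z \<theta> N near_diagonal_form_bound[OF close above]])

text \<open>Inertia for \<open>- X\<close> and \<open>- \<theta>\<close> at \<open>- z\<close>, with
  \<open>{1..r} - N\<close> in place of \<open>N\<close>. Taking complements of the counts turns the
  strict inequality for \<open>g\<close> into a weak one.\<close>

lemma perturbed_count_ge:
  "card {k\<in>{1..n}. f k < z} + card N \<le> card {j\<in>{1..n}. g j \<le> z} + card {l\<in>{1..r}. 0 < \<theta> l}"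
proof -
  let ?X = "mat n n (\<lambda>(i,j). - X $$ (i,j))" and ?f = "\<lambda>k. - f (Suc n - k)" and ?v = "\<lambda>k. v (Suc n - k)"
  let ?g = "\<lambda>k. - g (Suc n - k)" and ?\<theta> = "\<lambda>k. - \<theta> k"
  have Xc: "X \<in> carrier_mat n n" using X by (simp add: eigensystem_def)
  have schur: "schur_entry n ?f ?v u (- z) l m = - schur_entry n f v u z l m" for l m
  proof -
    let ?t = "\<lambda>k. cip n (u l) (v k) * cip n (v k) (u m) / complex_of_real (z - f k)"
    have "schur_entry n ?f ?v u (- z) l m
       = (\<Sum>k\<in>{1..n}. (\<lambda>k. - ?t k) (Suc n - k))"
      unfolding schur_entry_def
    proof (rule sum.cong[OF refl])
      fix k
      have "complex_of_real (- z - - f (Suc n - k)) = - complex_of_real (z - f (Suc n - k))" by simp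
      then show "cip n (u l) (v (Suc n - k)) * cip n (v (Suc n - k)) (u m) / complex_of_real (- z - - f (Suc n - k))
        = - ?t (Suc n - k)" by (simp only: divide_minus_right)
    qed
    also have "\<dots> = (\<Sum>k\<in>{1..n}. - ?t k)"
      by (rule sum.reindex_bij_betw[OF bij_reflect])
    also have "\<dots> = - schur_entry n f v u z l m" by (simp only: schur_entry_def sum_negf)
    finally show ?thesis .
  qed
  have "card {j\<in>{1..n}. ?g j < - z} + card {l\<in>{1..r}. 0 < ?\<theta> l} \<le> card {k\<in>{1..n}. ?f k < - z} + card ({1..r} - N)"
  proof (rule perturbed_inertia)
    show "eigensystem n ?X ?f ?v" by (rule eigensystem_uminus[OF X])
    show "eigensystem n (perturbed n ?X r ?\<theta> u) ?g (\<lambda>k. w (Suc n - k))"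
      unfolding perturbed_uminus[OF Xc, symmetric] by (rule eigensystem_uminus[OF Y])
    show "?f k \<noteq> - z" if "k \<in> {1..n}" for k
    proof -
      have "Suc n - k \<in> {1..n}" using that by auto
      from z[OF this] show ?thesis by simp
    qed
    show "?\<theta> l \<noteq> 0" if "l \<in> {1..r}" for l using \<theta> that by simp
    show "(\<Sum>l\<in>{1..r}. (cmod (c l))\<^sup>2 / ?\<theta> l)
        \<le> (\<Sum>k\<in>{1..n}. (cmod (\<Sum>l\<in>{1..r}. cip n (?v k) (u l) * c l))\<^sup>2 / (- z - ?f k))"
      if "\<forall>l\<in>{1..r} - N. c l = 0" for c
    proof (rule near_diagonal_form_bound[where g = "- \<gamma>" and \<epsilon> = \<epsilon>, OF _ _ that])
      fix l m assume lm: "l \<in> {1..r}" "m \<in> {1..r}"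
      have eq: "schur_entry n ?f ?v u (- z) l m - (if l = m then complex_of_real (- \<gamma>) else 0)
          = - (schur_entry n f v u z l m - (if l = m then complex_of_real \<gamma> else 0))"
        unfolding schur by (cases "l = m") simp_all
      show "cmod (schur_entry n ?f ?v u (- z) l m - (if l = m then complex_of_real (- \<gamma>) else 0)) \<le> \<epsilon>"
        using close[OF lm] by (simp only: eq norm_minus_cancel)
    next
      fix l assume "l \<in> {1..r}" "l \<notin> {1..r} - N"
      then show "1 / ?\<theta> l + real r * \<epsilon> \<le> - \<gamma>" using below[of l] by simp
    qed
  qed simp
  moreover have "card {j\<in>{1..n}. ?g j < - z} = card {j\<in>{1..n}. z < g j}"
    using card_reflect[of n "\<lambda>j. z < g j"] by simp
  moreover have "card {k\<in>{1..n}. ?f k < - z} = card {k\<in>{1..n}. z < f k}"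
    using card_reflect[of n "\<lambda>j. z < f j"] by simp
  moreover have "card {j\<in>{1..n}. z < g j} + card {j\<in>{1..n}. g j \<le> z} = card {1..n}"
    by (rule card_split) auto
  moreover have "card {k\<in>{1..n}. z < f k} + card {k\<in>{1..n}. f k < z} = card {1..n}"
    by (rule card_split) (use z in force)+
  moreover have "card {l\<in>{1..r}. 0 < ?\<theta> l} + card {l\<in>{1..r}. 0 < \<theta> l} = card {1..r}"
    by (rule card_split) (use \<theta> in force)+
  moreover have "card ({1..r} - N) + card N = r"
    using N card_mono[OF _ N] by (simp add: card_Diff_subset finite_subset)
  ultimately show ?thesis by simp
qed

text \<open>At most \<open>i - 1\<close> eigenvalues of \<open>X\<close> lie below \<open>z\<close>,
  hence at most \<open>s + i - 1\<close> perturbed ones do. \<open>N_card\<close> is what makes the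
  shift equal to \<open>s\<close>.\<close>

lemma perturbed_eigenvalue_ge:
  assumes i: "1 \<le> i" "i \<le> n" "z < f i" and N_card: "card N = s + card {l\<in>{1..r}. 0 < \<theta> l}" and "s + i \<le> n"
  shows "z \<le> g (s + i)"
proof (rule ccontr)
  assume "\<not> z \<le> g (s + i)"
  moreover have "g j \<le> g (s + i)" if "j \<in> {1..s + i}" for j
    using Y that assms(5) unfolding eigensystem_def by auto
  ultimately have "{1..s + i} \<subseteq> {j\<in>{1..n}. g j < z}" using assms(5) by force
  from card_mono[OF _ this] have "s + i \<le> card {j\<in>{1..n}. g j < z}" by simp
  moreover have "{k\<in>{1..n}. f k < z} \<subseteq> {1..<i}"
  proof
    fix k assume k: "k \<in> {k\<in>{1..n}. f k < z}"
    have "\<not> i \<le> k"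
    proof
      assume "i \<le> k"
      then have "f i \<le> f k" using X k i unfolding eigensystem_def by auto
      then show False using k i by simp
    qed
    then show "k \<in> {1..<i}" using k by simp
  qed
  from card_mono[OF _ this] have "card {k\<in>{1..n}. f k < z} \<le> i - 1" by simp
  ultimately show False using perturbed_count_le N_card i by linarith
qed

lemma perturbed_eigenvalue_le:
  assumes i: "1 \<le> i" "i \<le> n" "f i < z" and N_card: "card N = s + card {l\<in>{1..r}. 0 < \<theta> l}" and "s + i \<le> n"
  shows "g (s + i) \<le> z"
proof (rule ccontr)
  assume less: "\<not> g (s + i) \<le> z"
  have "{j\<in>{1..n}. g j \<le> z} \<subseteq> {1..<s + i}"
  proof
    fix k assume k: "k \<in> {k\<in>{1..n}. g k \<le> z}"
    have "\<not> s + i \<le> k"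
    proof
      assume "s + i \<le> k"
      then have "g (s + i) \<le> g k" using Y k i unfolding eigensystem_def by auto
      then show False using k less by simp
    qed
    then show "k \<in> {1..<s + i}" using k by simp
  qed
  from card_mono[OF _ this] have "card {j\<in>{1..n}. g j \<le> z} \<le> s + i - 1" by simp
  moreover have "f j \<le> f i" if "j \<in> {1..i}" for j
    using X that i unfolding eigensystem_def by auto
  then have "{1..i} \<subseteq> {k\<in>{1..n}. f k < z}" using i by force
  from card_mono[OF _ this] have "i \<le> card {k\<in>{1..n}. f k < z}" by simp
  ultimately show False using perturbed_count_ge N_card i by linarith
qed

end

section \<open>Spectrum near an edge\<close>

text \<open>The candidates are the midpoints of \<open>p\<close> consecutive intervals of length
  \<open>2 * d\<close> starting at \<open>c\<close>. A value of \<open>h\<close> can be closer than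
  \<open>d\<close> to at most one of them, and there are fewer than \<open>p\<close> values.\<close>

lemma pigeonhole_separated:
  fixes h :: "'k \<Rightarrow> real"
  assumes "finite S" "card S < p" "d > 0"
  shows "\<exists>t<p. \<forall>k\<in>S. d \<le> \<bar>c + (2 * real t + 1) * d - h k\<bar>"
proof (rule ccontr)
  assume "\<not> ?thesis"
  then have "\<forall>t\<in>{..<p}. \<exists>k\<in>S. \<bar>c + (2 * real t + 1) * d - h k\<bar> < d" by (auto simp: not_le)
  then obtain \<kappa> where \<kappa>: "\<And>t. t < p \<Longrightarrow> \<kappa> t \<in> S" "\<And>t. t < p \<Longrightarrow> \<bar>c + (2 * real t + 1) * d - h (\<kappa> t)\<bar> < d"
    by (metis lessThan_iff)
  have "inj_on \<kappa> {..<p}"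
  proof (rule inj_onI)
    fix s t assume st: "s \<in> {..<p}" "t \<in> {..<p}" "\<kappa> s = \<kappa> t"
    have "\<bar>(c + (2 * real t + 1) * d) - (c + (2 * real s + 1) * d)\<bar> < 2 * d"
      using \<kappa>(2)[of s] \<kappa>(2)[of t] st by (auto simp: abs_if split: if_splits)
    moreover have "(c + (2 * real t + 1) * d) - (c + (2 * real s + 1) * d) = (2 * d) * (real t - real s)"
      by (simp add: algebra_simps)
    ultimately have "(2 * d) * \<bar>real t - real s\<bar> < (2 * d) * 1" using assms(3) by (simp add: abs_mult)
    then have "\<bar>real t - real s\<bar> < 1" using assms(3) by (simp only: mult_less_cancel_left_pos)
    then show "s = t" by linarith
  qed
  then have "p \<le> card S" using card_inj_on_le[of \<kappa> "{..<p}" S] \<kappa>(1) assms(1) by auto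
  then show False using assms(2) by simp
qed

text \<open>The deterministic side of the lower edge; the upper edge becomes an instance through
  \<open>- X\<close>. The assumption \<open>upper\<close> is the outcome of weak convergence, while
  \<open>lower\<close> and \<open>squares\<close> are the two conditions of the hypothesis at the
  p-th eigenvalue.\<close>

locale edge_spectrum =
  fixes lam :: "nat \<Rightarrow> nat \<Rightarrow> real" and G :: ereal and m :: "nat \<Rightarrow> nat" and \<alpha> \<beta> \<eta> C :: real and p :: nat
  assumes mono: "\<And>n i j. 1 \<le> i \<Longrightarrow> i \<le> j \<Longrightarrow> j \<le> n \<Longrightarrow> lam n i \<le> lam n j"
    and upper: "\<And>s. G < ereal s \<Longrightarrow> \<exists>z \<epsilon>. \<epsilon> > 0 \<and> (\<forall>\<^sub>F n in sequentially. z + \<epsilon> \<le> lam n 1 \<and>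
           (1 / real n) * (\<Sum>i\<in>{1..n}. 1 / (z - lam n i)) \<le> s)"
    and m_top: "filterlim m at_top sequentially"
    and m_le: "\<forall>\<^sub>F n in sequentially. real (m n) \<le> C * real n powr \<alpha>"
    and lower: "G \<le> Liminf sequentially (\<lambda>n. ereal ((1 / real n) * (\<Sum>i\<in>{m n + 1..n}. 1 / (lam n p - lam n i))))"
    and squares: "\<forall>\<^sub>F n in sequentially. (\<forall>i\<in>{m n + 1..n}. lam n p \<noteq> lam n i) \<and>
            (\<Sum>i\<in>{m n + 1..n}. 1 / (lam n p - lam n i)\<^sup>2) \<le> real n powr (2 - \<eta>)"
    and \<eta>: "\<eta> > 0" and \<beta>: "0 < \<alpha>" "\<alpha> < \<beta>" "\<beta> < 1" and p: "p > 0"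
begin

text \<open>The exponent is chosen such that the \<open>m n\<close> eigenvalues closest to the edge, kept at distance
  \<open>\<delta> n\<close>, contribute at most \<open>m n / (n \<delta> n) \<rightarrow> 0\<close> to the averaged resolvent trace.\<close>

definition \<delta> :: "nat \<Rightarrow> real" where "\<delta> n = real n powr (\<beta> - 1)"

text \<open>The bound \<open>z \<le> lam n p\<close> makes the tail terms at \<open>z\<close>
  comparable with those at \<open>lam n p\<close>. The lower bound leaves room for the search window
  of \<open>ex_good_below\<close> and still tends to the edge.\<close>

definition good :: "nat \<Rightarrow> real \<Rightarrow> bool" where
  "good n z \<longleftrightarrow> lam n 1 - 2 * real p * \<delta> n \<le> z \<and> z \<le> lam n p \<and> (\<forall>k\<in>{1..n}. \<delta> n \<le> \<bar>z - lam n k\<bar>)"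

definition g :: "nat \<Rightarrow> real \<Rightarrow> real" where
  "g n z = 1 / real n * (\<Sum>k\<in>{1..n}. 1 / (z - lam n k))"

definition err :: "nat \<Rightarrow> real" where "err n = real (m n) / (real n * \<delta> n)"

lemma \<delta>_pos: "n > 0 \<Longrightarrow> \<delta> n > 0" by (simp add: \<delta>_def)

lemma \<delta>_tendsto: "\<delta> \<longlonglongrightarrow> 0"
  unfolding \<delta>_def using \<beta>
  by (intro tendsto_neg_powr filterlim_real_sequentially) auto

lemma m_div_tendsto:
  assumes "\<alpha> < t" shows "(\<lambda>n. real (m n) / real n powr t) \<longlonglongrightarrow> 0"
proof (rule tendsto_sandwich[where f = "\<lambda>_. 0" and h = "\<lambda>n. C * real n powr (\<alpha> - t)"])
  show "(\<lambda>n. C * real n powr (\<alpha> - t)) \<longlonglongrightarrow> 0"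
    using assms by (intro tendsto_mult_right_zero tendsto_neg_powr filterlim_real_sequentially) auto
  show "\<forall>\<^sub>F n in sequentially. real (m n) / real n powr t \<le> C * real n powr (\<alpha> - t)"
    using m_le eventually_gt_at_top[of 0]
  proof eventually_elim
    case (elim n)
    then have "real (m n) / real n powr t \<le> C * real n powr \<alpha> / real n powr t"
      by (intro divide_right_mono) auto
    then show ?case by (simp add: powr_diff)
  qed
qed auto

lemma err_eq: "n > 0 \<Longrightarrow> err n = real (m n) / real n powr \<beta>"
  by (simp add: err_def \<delta>_def powr_diff)

lemma err_tendsto: "err \<longlonglongrightarrow> 0"
proof (rule Lim_transform_eventually[OF m_div_tendsto[OF \<beta>(2)]])
  show "\<forall>\<^sub>F n in sequentially. real (m n) / real n powr \<beta> = err n"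
    using eventually_gt_at_top[of 0] by eventually_elim (simp add: err_eq)
qed

lemma eventually_indices: "\<forall>\<^sub>F n in sequentially. 0 < n \<and> p \<le> n \<and> p \<le> m n"
  using eventually_gt_at_top[of 0] eventually_ge_at_top[of p]
    m_top[unfolded filterlim_at_top, rule_format, of p]
  by eventually_elim simp

text \<open>The intersection with \<open>{1..n}\<close> keeps \<open>sum_split\<close> valid for
  those \<open>n\<close> with \<open>m n > n\<close>.\<close>

definition head :: "nat \<Rightarrow> nat set" where "head n = {1..n} \<inter> {..m n}"
definition tail :: "nat \<Rightarrow> nat set" where "tail n = {m n + 1..n}"

lemma sum_split: "(\<Sum>k\<in>{1..n}. h k) = (\<Sum>k\<in>head n. h k) + (\<Sum>k\<in>tail n. h k)" for h :: "nat \<Rightarrow> real"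
proof -
  have "{1..n} = head n \<union> tail n" "head n \<inter> tail n = {}" by (auto simp: head_def tail_def)
  then show ?thesis by (metis finite_Un finite_atLeastAtMost sum.union_disjoint)
qed

lemma card_head: "card (head n) \<le> m n"
proof -
  have "head n \<subseteq> {1..m n}" by (auto simp: head_def)
  from card_mono[OF _ this] show ?thesis by simp
qed

lemma head_sum_le:
  assumes "\<And>k. k \<in> head n \<Longrightarrow> \<bar>h k\<bar> \<le> B" "0 \<le> B"
  shows "\<bar>\<Sum>k\<in>head n. h k\<bar> \<le> real (m n) * B"
proof -
  have "\<bar>\<Sum>k\<in>head n. h k\<bar> \<le> real (card (head n)) * B"
    using assms(1) by (intro order_trans[OF sum_abs] sum_bounded_above) auto
  also have "\<dots> \<le> real (m n) * B" using card_head assms(2) by (intro mult_right_mono) auto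
  finally show ?thesis .
qed

lemma g_split:
  "g n z = 1 / real n * (\<Sum>k\<in>head n. 1 / (z - lam n k)) + 1 / real n * (\<Sum>k\<in>tail n. 1 / (z - lam n k))"
  unfolding g_def sum_split by (rule distrib_left)

lemma good_head:
  assumes "good n z" "n > 0"
  shows "\<bar>1 / real n * (\<Sum>k\<in>head n. 1 / (z - lam n k))\<bar> \<le> err n"
proof -
  have "\<bar>\<Sum>k\<in>head n. 1 / (z - lam n k)\<bar> \<le> real (m n) * (1 / \<delta> n)"
  proof (rule head_sum_le)
    fix k assume "k \<in> head n"
    then have "\<delta> n \<le> \<bar>z - lam n k\<bar>" using assms(1) by (auto simp: good_def head_def)
    then show "\<bar>1 / (z - lam n k)\<bar> \<le> 1 / \<delta> n"
      using \<delta>_pos[OF assms(2)] by (simp add: abs_divide) (intro divide_left_mono mult_pos_pos, auto)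
  qed (use \<delta>_pos[OF assms(2)] in simp)
  then have "1 / real n * \<bar>\<Sum>k\<in>head n. 1 / (z - lam n k)\<bar> \<le> 1 / real n * (real (m n) * (1 / \<delta> n))"
    by (intro mult_left_mono) auto
  then show ?thesis by (simp add: abs_mult err_def)
qed

lemma good_tail:
  assumes "good n z" "0 < n \<and> p \<le> n \<and> p \<le> m n" "k \<in> tail n"
  shows "z < lam n k" "lam n p \<le> lam n k" "z \<le> lam n p"
proof -
  have k: "k \<in> {1..n}" "p \<le> k" using assms p by (auto simp: tail_def)
  show "z \<le> lam n p" using assms(1) by (simp add: good_def)
  moreover show le: "lam n p \<le> lam n k" using mono[of p k n] k p by auto
  moreover have "\<delta> n \<le> \<bar>z - lam n k\<bar>" using assms(1) k by (simp add: good_def)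
  ultimately show "z < lam n k" using \<delta>_pos[of n] assms(2) by auto
qed

text \<open>Left of an eigenvalue its kernel term decreases in \<open>z\<close>, so moving the tail
  back to the fixed point \<open>z0\<close> only increases it. There the full sum is controlled by
  \<open>upper\<close>, and the head terms cost at most
  \<open>m n / (n * \<epsilon>)\<close>.\<close>

lemma eventually_g_le:
  assumes s: "G < ereal s"
  shows "\<forall>\<^sub>F n in sequentially. \<forall>z. good n z \<longrightarrow> g n z \<le> s"
proof -
  obtain s' where s': "G < ereal s'" "s' < s" using ereal_dense2[OF s] by auto
  obtain z0 \<epsilon> where \<epsilon>: "\<epsilon> > 0" and ev: "\<forall>\<^sub>F n in sequentially. z0 + \<epsilon> \<le> lam n 1 \<and>
           (1 / real n) * (\<Sum>i\<in>{1..n}. 1 / (z0 - lam n i)) \<le> s'"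
    using upper[OF s'(1)] by blast
  have "(\<lambda>n. 2 * real p * \<delta> n) \<longlonglongrightarrow> 0" by (intro tendsto_mult_right_zero \<delta>_tendsto)
  then have 1: "\<forall>\<^sub>F n in sequentially. 2 * real p * \<delta> n < \<epsilon>" using \<epsilon> by (rule order_tendstoD)
  have "(\<lambda>n. err n + real (m n) / real n powr 1 * (1 / \<epsilon>)) \<longlonglongrightarrow> 0 + 0 * (1 / \<epsilon>)"
    by (intro tendsto_intros err_tendsto m_div_tendsto) (use \<beta> in simp)
  then have 2: "\<forall>\<^sub>F n in sequentially. err n + real (m n) / real n powr 1 * (1 / \<epsilon>) < s - s'"
    using s'(2) by (intro order_tendstoD) auto
  from 1 2 ev eventually_indices show ?thesis
  proof eventually_elim
    case (elim n)
    then have n: "n > 0" by simp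
    show ?case
    proof (intro allI impI)
      fix z assume z: "good n z"
      have z0: "z0 < z" using z elim by (simp add: good_def)
      have lam1: "lam n 1 \<le> lam n k" if "k \<in> {1..n}" for k using mono[of 1 k n] that by auto
      have "(\<Sum>k\<in>tail n. 1 / (z - lam n k)) \<le> (\<Sum>k\<in>tail n. 1 / (z0 - lam n k))"
      proof (rule sum_mono)
        fix k assume "k \<in> tail n"
        then have "z < lam n k" using good_tail[OF z] elim by blast
        then show "1 / (z - lam n k) \<le> 1 / (z0 - lam n k)"
          using z0 by (intro divide_left_mono mult_neg_neg) auto
      qed
      also have "\<dots> = (\<Sum>k\<in>{1..n}. 1 / (z0 - lam n k)) - (\<Sum>k\<in>head n. 1 / (z0 - lam n k))"
        unfolding sum_split by simp
      also have "\<dots> \<le> (\<Sum>k\<in>{1..n}. 1 / (z0 - lam n k)) + real (m n) * (1 / \<epsilon>)"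
      proof -
        have "\<bar>\<Sum>k\<in>head n. 1 / (z0 - lam n k)\<bar> \<le> real (m n) * (1 / \<epsilon>)"
        proof (rule head_sum_le)
          fix k assume "k \<in> head n"
          then have "z0 + \<epsilon> \<le> lam n k" using lam1[of k] elim by (auto simp: head_def)
          then show "\<bar>1 / (z0 - lam n k)\<bar> \<le> 1 / \<epsilon>"
            using \<epsilon> by (simp add: abs_divide) (intro divide_left_mono mult_pos_pos, auto)
        qed (use \<epsilon> in simp)
        then show ?thesis by linarith
      qed
      finally have "1 / real n * (\<Sum>k\<in>tail n. 1 / (z - lam n k))
         \<le> 1 / real n * ((\<Sum>k\<in>{1..n}. 1 / (z0 - lam n k)) + real (m n) * (1 / \<epsilon>))"
        by (intro mult_left_mono) auto
      also have "\<dots> = 1 / real n * (\<Sum>k\<in>{1..n}. 1 / (z0 - lam n k)) + real (m n) / real n powr 1 * (1 / \<epsilon>)"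
        using n by (simp add: distrib_left)
      finally have "1 / real n * (\<Sum>k\<in>tail n. 1 / (z - lam n k)) \<le> s' + real (m n) / real n powr 1 * (1 / \<epsilon>)"
        using elim by linarith
      moreover have "1 / real n * (\<Sum>k\<in>head n. 1 / (z - lam n k)) \<le> err n"
        using good_head[OF z n] by linarith
      ultimately show "g n z \<le> s" using elim g_split[of n z] by linarith
    qed
  qed
qed

text \<open>The opposite move: carrying the tail forward from \<open>z\<close> to
  \<open>lam n p\<close> decreases it, and there \<open>lower\<close> applies.\<close>

lemma eventually_g_ge:
  assumes s: "ereal s < G"
  shows "\<forall>\<^sub>F n in sequentially. \<forall>z. good n z \<longrightarrow> s \<le> g n z"
proof -
  obtain s' where s': "ereal s' < G" "s < s'" using ereal_dense2[OF s] by auto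
  have ev: "\<forall>\<^sub>F n in sequentially. s' < (1 / real n) * (\<Sum>i\<in>tail n. 1 / (lam n p - lam n i))"
    using less_LiminfD[OF less_le_trans[OF s'(1) lower]] by (simp add: tail_def)
  have 2: "\<forall>\<^sub>F n in sequentially. err n < s' - s"
    using s'(2) by (intro order_tendstoD[OF err_tendsto]) auto
  from 2 ev squares eventually_indices show ?thesis
  proof eventually_elim
    case (elim n)
    then have n: "n > 0" by simp
    show ?case
    proof (intro allI impI)
      fix z assume z: "good n z"
      have "(\<Sum>k\<in>tail n. 1 / (lam n p - lam n k)) \<le> (\<Sum>k\<in>tail n. 1 / (z - lam n k))"
      proof (rule sum_mono)
        fix k assume k: "k \<in> tail n"
        have "z < lam n k" "lam n p \<le> lam n k" "z \<le> lam n p" using good_tail[OF z _ k] elim by blast+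
        moreover have "lam n p \<noteq> lam n k" using elim k by (simp add: tail_def)
        ultimately show "1 / (lam n p - lam n k) \<le> 1 / (z - lam n k)"
          by (intro divide_left_mono mult_neg_neg) auto
      qed
      then have "1 / real n * (\<Sum>k\<in>tail n. 1 / (lam n p - lam n k)) \<le> 1 / real n * (\<Sum>k\<in>tail n. 1 / (z - lam n k))"
        by (intro mult_left_mono) auto
      moreover have "- err n \<le> 1 / real n * (\<Sum>k\<in>head n. 1 / (z - lam n k))"
        using good_head[OF z n] by linarith
      ultimately show "s \<le> g n z" using elim g_split[of n z] by linarith
    qed
  qed
qed

text \<open>The first term is the head, \<open>m n / (n * \<delta> n)^2\<close>; the second is the
  tail, compared with its value at \<open>lam n p\<close> and bounded by
  \<open>squares\<close>.\<close>

definition hs_bound :: "nat \<Rightarrow> real" where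
  "hs_bound n = real (m n) / real n powr (2 * \<beta>) + real n powr (- \<eta>)"

lemma hs_bound_tendsto: "hs_bound \<longlonglongrightarrow> 0"
proof -
  have "(\<lambda>n. real n powr (- \<eta>)) \<longlonglongrightarrow> 0"
    using \<eta> by (intro tendsto_neg_powr filterlim_real_sequentially) auto
  moreover have "(\<lambda>n. real (m n) / real n powr (2 * \<beta>)) \<longlonglongrightarrow> 0" by (rule m_div_tendsto) (use \<beta> in simp)
  ultimately show ?thesis unfolding hs_bound_def using tendsto_add_zero by blast
qed

lemma eventually_hs_le:
  "\<forall>\<^sub>F n in sequentially. \<forall>z. good n z \<longrightarrow> 1 / (real n)\<^sup>2 * (\<Sum>k\<in>{1..n}. 1 / (z - lam n k)\<^sup>2) \<le> hs_bound n"
  using squares eventually_indices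
proof eventually_elim
  case (elim n)
  then have n: "n > 0" by simp
  have n2: "(real n)\<^sup>2 = real n powr 2" using n by (simp add: powr_realpow)
  show ?case
  proof (intro allI impI)
    fix z assume z: "good n z"
    have "(\<Sum>k\<in>tail n. 1 / (z - lam n k)\<^sup>2) \<le> (\<Sum>k\<in>tail n. 1 / (lam n p - lam n k)\<^sup>2)"
    proof (rule sum_mono)
      fix k assume k: "k \<in> tail n"
      have "z < lam n k" "lam n p \<le> lam n k" "z \<le> lam n p" using good_tail[OF z _ k] elim by blast+
      moreover have "lam n p \<noteq> lam n k" using elim k by (simp add: tail_def)
      ultimately have l: "0 < lam n k - lam n p" "lam n k - lam n p \<le> lam n k - z" by auto
      then have "(lam n k - lam n p)\<^sup>2 \<le> (lam n k - z)\<^sup>2" by (intro power_mono) auto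
      then have "(lam n p - lam n k)\<^sup>2 \<le> (z - lam n k)\<^sup>2" by (simp only: power2_commute)
      moreover have "(lam n p - lam n k)\<^sup>2 > 0" using l by simp
      ultimately show "1 / (z - lam n k)\<^sup>2 \<le> 1 / (lam n p - lam n k)\<^sup>2"
        by (intro divide_left_mono mult_pos_pos) linarith+
    qed
    also have "\<dots> \<le> real n powr (2 - \<eta>)" using elim by (simp add: tail_def)
    finally have t: "1 / (real n)\<^sup>2 * (\<Sum>k\<in>tail n. 1 / (z - lam n k)\<^sup>2) \<le> 1 / (real n)\<^sup>2 * real n powr (2 - \<eta>)"
      by (intro mult_left_mono) auto
    have te: "1 / (real n)\<^sup>2 * real n powr (2 - \<eta>) = real n powr (- \<eta>)"
      using n unfolding n2 by (simp add: powr_diff powr_minus divide_simps)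
    have "\<bar>\<Sum>k\<in>head n. 1 / (z - lam n k)\<^sup>2\<bar> \<le> real (m n) * (1 / (\<delta> n)\<^sup>2)"
    proof (rule head_sum_le)
      fix k assume "k \<in> head n"
      then have "\<delta> n \<le> \<bar>z - lam n k\<bar>" using z by (auto simp: good_def head_def)
      then have "(\<delta> n)\<^sup>2 \<le> \<bar>z - lam n k\<bar>\<^sup>2" using \<delta>_pos[OF n] by (intro power_mono) auto
      moreover have "0 < (\<delta> n)\<^sup>2" using \<delta>_pos[OF n] by simp
      ultimately have "1 / (z - lam n k)\<^sup>2 \<le> 1 / (\<delta> n)\<^sup>2"
        by (intro divide_left_mono mult_pos_pos) auto
      then show "\<bar>1 / (z - lam n k)\<^sup>2\<bar> \<le> 1 / (\<delta> n)\<^sup>2" by simp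
    qed simp
    then have "1 / (real n)\<^sup>2 * (\<Sum>k\<in>head n. 1 / (z - lam n k)\<^sup>2) \<le> 1 / (real n)\<^sup>2 * (real (m n) * (1 / (\<delta> n)\<^sup>2))"
      by (intro mult_left_mono) auto
    also have "\<dots> = real (m n) / ((real n * \<delta> n)\<^sup>2)" by (simp add: power_mult_distrib)
    also have "(real n * \<delta> n)\<^sup>2 = real n powr (2 * \<beta>)"
    proof -
      have "real n * \<delta> n = real n powr \<beta>" using n by (simp add: \<delta>_def powr_diff)
      then show ?thesis using n by (simp add: powr_power mult.commute)
    qed
    finally show "1 / (real n)\<^sup>2 * (\<Sum>k\<in>{1..n}. 1 / (z - lam n k)\<^sup>2) \<le> hs_bound n"
      using t unfolding te sum_split hs_bound_def distrib_left by linarith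
  qed
qed

text \<open>Only the \<open>i - 1\<close> eigenvalues before the i-th can obstruct a point of the
  window; the others lie to the right of the window by at least \<open>\<delta> n\<close>, because
  the last candidate stops at \<open>lam n i - \<delta> n\<close>.\<close>

lemma ex_good_below:
  assumes i: "1 \<le> i" "i \<le> p" "p \<le> n"
  shows "\<exists>z. good n z \<and> z < lam n i \<and> lam n i - 2 * real p * \<delta> n \<le> z"
proof -
  have d: "\<delta> n > 0" using i by (intro \<delta>_pos) auto
  have "card {1..<i} < p" using i by simp
  from pigeonhole_separated[OF _ this d, where c = "lam n i - 2 * real p * \<delta> n" and h = "lam n"]
  obtain t where t: "t < p"
    "\<forall>k\<in>{1..<i}. \<delta> n \<le> \<bar>lam n i - 2 * real p * \<delta> n + (2 * real t + 1) * \<delta> n - lam n k\<bar>" by auto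
  define z where "z = lam n i - 2 * real p * \<delta> n + (2 * real t + 1) * \<delta> n"
  have "(2 * real t + 1) * \<delta> n \<le> (2 * real p - 1) * \<delta> n" using t(1) d by (intro mult_right_mono) auto
  then have z1: "z \<le> lam n i - \<delta> n" by (simp add: z_def algebra_simps)
  have z2: "lam n i - 2 * real p * \<delta> n \<le> z" using d by (simp add: z_def)
  have "\<delta> n \<le> \<bar>z - lam n k\<bar>" if "k \<in> {1..n}" for k
  proof (cases "k < i")
    case True
    then show ?thesis using t(2) that by (simp add: z_def)
  next
    case False
    then have "lam n i \<le> lam n k" using mono[of i k n] i that by auto
    then show ?thesis using z1 by simp
  qed
  moreover have "lam n 1 \<le> lam n i" "lam n i \<le> lam n p" using mono[of 1 i n] mono[of i p n] i by auto
  ultimately show ?thesis using z1 z2 d unfolding good_def by (intro exI[of _ z]) auto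
qed

text \<open>The assumption \<open>gap\<close> keeps the window to the left of
  \<open>lam n p\<close>, so that only the eigenvalues strictly between the i-th and the p-th can
  obstruct.\<close>

lemma ex_good_above:
  assumes i: "1 \<le> i" "i \<le> p" "p \<le> n" and gap: "lam n i + 2 * real p * \<delta> n \<le> lam n p"
  shows "\<exists>z. good n z \<and> lam n i < z \<and> z \<le> lam n i + 2 * real p * \<delta> n"
proof -
  have d: "\<delta> n > 0" using i by (intro \<delta>_pos) auto
  have "card {i<..<p} < p" using i by simp
  from pigeonhole_separated[OF _ this d, where c = "lam n i" and h = "lam n"]
  obtain t where t: "t < p" "\<forall>k\<in>{i<..<p}. \<delta> n \<le> \<bar>lam n i + (2 * real t + 1) * \<delta> n - lam n k\<bar>" by auto
  define z where "z = lam n i + (2 * real t + 1) * \<delta> n"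
  have "(2 * real t + 1) * \<delta> n \<le> (2 * real p - 1) * \<delta> n" using t(1) d by (intro mult_right_mono) auto
  then have z1: "z \<le> lam n i + 2 * real p * \<delta> n - \<delta> n" by (simp add: z_def algebra_simps)
  have z2: "lam n i + \<delta> n \<le> z" using d by (simp add: z_def algebra_simps)
  have "\<delta> n \<le> \<bar>z - lam n k\<bar>" if "k \<in> {1..n}" for k
  proof -
    consider "k \<le> i" | "k \<in> {i<..<p}" | "p \<le> k" by fastforce
    then show ?thesis
    proof cases
      case 1
      then have "lam n k \<le> lam n i" using mono[of k i n] i that by auto
      then show ?thesis using z2 by simp
    next
      case 2
      then show ?thesis using t(2) by (simp add: z_def)
    next
      case 3
      then have "lam n p \<le> lam n k" using mono[of p k n] p that by auto
      then show ?thesis using z1 gap by simp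
    qed
  qed
  moreover have "lam n 1 \<le> lam n i" using mono[of 1 i n] i by auto
  moreover have "lam n 1 - 2 * real p * \<delta> n \<le> z"
    using \<open>lam n 1 \<le> lam n i\<close> z2 d by (smt (verit) mult_nonneg_nonneg of_nat_0_le_iff)
  ultimately show ?thesis using z1 z2 d gap unfolding good_def by (intro exI[of _ z]) auto
qed

text \<open>Each \<open>t k\<close> differs from \<open>G\<close>, so a real number fits strictly
  between them and separates \<open>t k\<close> from the trace at all good points for large
  \<open>n\<close>. Finitely many \<open>k\<close> then share one \<epsilon>.\<close>

lemma common_margin:
  fixes t :: "'k \<Rightarrow> real"
  assumes "finite K" "\<And>k. k \<in> K \<Longrightarrow> ereal (t k) \<noteq> G" "r > 0"
  shows "\<exists>\<epsilon>>0. \<forall>\<^sub>F n in sequentially. \<forall>z. good n z \<longrightarrow> (\<forall>k\<in>K.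
      (ereal (t k) < G \<longrightarrow> t k + r * \<epsilon> \<le> g n z) \<and> (G < ereal (t k) \<longrightarrow> g n z + r * \<epsilon> \<le> t k))"
proof -
  let ?P = "\<lambda>\<epsilon> k n z. (ereal (t k) < G \<longrightarrow> t k + r * \<epsilon> \<le> g n z) \<and> (G < ereal (t k) \<longrightarrow> g n z + r * \<epsilon> \<le> t k)"
  show ?thesis
    using assms(1,2)
  proof (induction K rule: finite_induct)
    case empty
    then show ?case by (intro exI[of _ 1]) simp
  next
    case (insert k K)
    then obtain \<epsilon> where \<epsilon>: "\<epsilon> > 0" "\<forall>\<^sub>F n in sequentially. \<forall>z. good n z \<longrightarrow> (\<forall>k\<in>K. ?P \<epsilon> k n z)" by auto
    have "\<exists>\<epsilon>'>0. \<forall>\<^sub>F n in sequentially. \<forall>z. good n z \<longrightarrow> ?P \<epsilon>' k n z"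
    proof (cases "ereal (t k) < G")
      case True
      obtain s where s: "ereal s < G" "t k < s" using ereal_dense2[OF True] by auto
      show ?thesis using eventually_g_ge[OF s(1)] s(2) True assms(3)
        by (intro exI[of _ "(s - t k) / r"]) (auto elim!: eventually_mono)
    next
      case False
      then have less: "G < ereal (t k)" using insert.prems[of k] by auto
      obtain s where s: "G < ereal s" "s < t k" using ereal_dense2[OF less] by auto
      show ?thesis using eventually_g_le[OF s(1)] s(2) False assms(3)
        by (intro exI[of _ "(t k - s) / r"]) (auto elim!: eventually_mono)
    qed
    then obtain \<epsilon>' where \<epsilon>': "\<epsilon>' > 0" "\<forall>\<^sub>F n in sequentially. \<forall>z. good n z \<longrightarrow> ?P \<epsilon>' k n z" by blast
    have le: "r * min \<epsilon> \<epsilon>' \<le> r * \<epsilon>" "r * min \<epsilon> \<epsilon>' \<le> r * \<epsilon>'" using assms(3) by auto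
    have "\<forall>\<^sub>F n in sequentially. \<forall>z. good n z \<longrightarrow> (\<forall>k\<in>insert k K. ?P (min \<epsilon> \<epsilon>') k n z)"
      using \<epsilon>(2) \<epsilon>'(2)
    proof eventually_elim
      case (elim n)
      show ?case
      proof (intro allI impI ballI)
        fix z k' assume "good n z" "k' \<in> insert k K"
        then show "?P (min \<epsilon> \<epsilon>') k' n z"
          using elim le by (smt (verit, best) insert_iff)
      qed
    qed
    then show ?case using \<epsilon>(1) \<epsilon>'(1) by (intro exI[of _ "min \<epsilon> \<epsilon>'"]) auto
  qed
qed

end

section \<open>Sticking at the lower edge\<close>

text \<open>Meant for events about perturbed eigenvalues, whose measurability is not established:
  \<open>measure\<close> is 0 outside \<open>sets M\<close>.\<close>

lemma (in prob_space) measure_le_of_subset: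
  assumes "S \<subseteq> T" "T \<in> sets M"
  shows "measure M S \<le> measure M T"
proof (cases "S \<in> sets M")
  case True
  then show ?thesis using assms by (intro finite_measure_mono)
qed (simp add: measure_notin_sets)

lemma conv_prob_zero_cong:
  assumes "conv_prob_zero M Y"
    and eq: "\<forall>\<^sub>F n in sequentially. \<forall>w\<in>space M. \<bar>Y n w\<bar> = \<bar>Z n w\<bar>"
  shows "conv_prob_zero M Z"
  unfolding conv_prob_zero_def
proof (intro allI impI)
  fix e :: real assume "e > 0"
  then have "(\<lambda>n. measure M {w \<in> space M. \<bar>Y n w\<bar> > e}) \<longlonglongrightarrow> 0"
    using assms(1) by (simp add: conv_prob_zero_def)
  then show "(\<lambda>n. measure M {w \<in> space M. \<bar>Z n w\<bar> > e}) \<longlonglongrightarrow> 0"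
  proof (rule Lim_transform_eventually)
    show "\<forall>\<^sub>F n in sequentially. measure M {w \<in> space M. \<bar>Y n w\<bar> > e} = measure M {w \<in> space M. \<bar>Z n w\<bar> > e}"
      using eq by eventually_elim (rule arg_cong[where f = "measure M"], auto)
  qed
qed

text \<open>Common form of (C1), (C2) and of their upper analogues, the latter for the spectrum of
  \<open>- X\<close> with edge value \<open>- G_right\<close>. An extended real replaces the inverse
  critical value so that \<open>- \<infinity>\<close> is covered.\<close>

definition spectral_gap_hyp :: "(nat \<Rightarrow> nat \<Rightarrow> real) \<Rightarrow> ereal \<Rightarrow> real \<Rightarrow> nat \<Rightarrow> bool" where
  "spectral_gap_hyp lam G \<alpha> p \<longleftrightarrow> (\<exists>m :: nat \<Rightarrow> nat. filterlim m at_top sequentially \<and>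
        (\<exists>C. \<forall>\<^sub>F n in sequentially. real (m n) \<le> C * real n powr \<alpha>) \<and>
        G \<le> Liminf sequentially (\<lambda>n. ereal ((1 / real n) * (\<Sum>i\<in>{m n + 1..n}. 1 / (lam n p - lam n i)))) \<and>
        (\<exists>\<eta>>0. \<forall>\<^sub>F n in sequentially. (\<forall>i\<in>{m n + 1..n}. lam n p \<noteq> lam n i) \<and>
            (\<Sum>i\<in>{m n + 1..n}. 1 / (lam n p - lam n i)\<^sup>2) \<le> real n powr (2 - \<eta>)))"

lemma lower_edge_sticking:
  fixes M :: "'w measure" and x :: "nat \<Rightarrow> nat \<Rightarrow> nat \<Rightarrow> 'w \<Rightarrow> complex" and X :: "nat \<Rightarrow> complex mat"
    and r :: nat and \<theta> :: "nat \<Rightarrow> real" and G :: ereal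
  defines "s \<equiv> card {k\<in>{1..r}. \<theta> k < 0 \<and> G < ereal (1 / \<theta> k)}"
  assumes "prob_space M"
    and iid: "\<And>n. iid_entries M (\<lambda>(k,l). x n k l) ({1..r} \<times> {..<n}) \<kappa>" and \<kappa>: "0 \<le> \<kappa>" and r: "r \<ge> 1"
    and herm: "\<And>n. hermitian_mat n (X n)" and \<theta>: "\<And>k. k \<in> {1..r} \<Longrightarrow> \<theta> k \<noteq> 0"
    and upper: "\<And>t. G < ereal t \<Longrightarrow> \<exists>z \<epsilon>. \<epsilon> > 0 \<and> (\<forall>\<^sub>F n in sequentially. z + \<epsilon> \<le> ord_eig (X n) 1 \<and>
           (1 / real n) * (\<Sum>i\<in>{1..n}. 1 / (z - ord_eig (X n) i)) \<le> t)"
    and gap: "spectral_gap_hyp (\<lambda>n i. ord_eig (X n) i) G \<alpha> p"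
    and G_ne: "\<And>k. k \<in> {1..r} \<Longrightarrow> ereal (1 / \<theta> k) \<noteq> G" and "G < 0"
    and \<alpha>: "0 < \<alpha>" "\<alpha> < 1" "\<alpha> < \<alpha>'" and i: "1 \<le> i" "s + i + r \<le> p"
  shows "conv_prob_zero M (\<lambda>n w. real n powr (1 - \<alpha>') *
     (ord_eig (perturbed n (X n) r \<theta> (\<lambda>k l. x n k l w / complex_of_real (sqrt (real n)))) (s + i) - ord_eig (X n) i))"
proof -
  interpret prob_space M by fact
  define lam where "lam = (\<lambda>n i. ord_eig (X n) i)"
  define u where "u = (\<lambda>n w k l. x n k l w / complex_of_real (sqrt (real n)))"
  define lamt where "lamt = (\<lambda>n w i. ord_eig (perturbed n (X n) r \<theta> (u n w)) i)"
  \<comment> \<open>With \<beta> above \<alpha> the head becomes negligible; below 1,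
    \<open>\<delta> n\<close> tends to 0; below \<alpha>', \<open>\<delta> n\<close> stays
    negligible on the scale \<open>n powr (\<alpha>' - 1)\<close>.\<close>
  define \<beta> where "\<beta> = (\<alpha> + min \<alpha>' 1) / 2"
  have \<beta>_bounds: "\<alpha> < \<beta>" "\<beta> < 1" "\<beta> < \<alpha>'" using \<alpha> by (auto simp: \<beta>_def min_def field_simps)
  from gap obtain m C \<eta> where H: "filterlim m at_top sequentially"
    "\<forall>\<^sub>F n in sequentially. real (m n) \<le> C * real n powr \<alpha>"
    "G \<le> Liminf sequentially (\<lambda>n. ereal ((1 / real n) * (\<Sum>i\<in>{m n + 1..n}. 1 / (lam n p - lam n i))))"
    "\<eta> > 0" "\<forall>\<^sub>F n in sequentially. (\<forall>i\<in>{m n + 1..n}. lam n p \<noteq> lam n i) \<and>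
            (\<Sum>i\<in>{m n + 1..n}. 1 / (lam n p - lam n i)\<^sup>2) \<le> real n powr (2 - \<eta>)"
    unfolding spectral_gap_hyp_def lam_def by blast
  interpret edge_spectrum lam G m \<alpha> \<beta> \<eta> C p
  proof
    show "lam n i \<le> lam n j" if "1 \<le> i" "i \<le> j" "j \<le> n" for n i j
      unfolding lam_def by (rule hermitian_ord_eig_mono[OF herm that])
    show "\<exists>z \<epsilon>. \<epsilon> > 0 \<and> (\<forall>\<^sub>F n in sequentially. z + \<epsilon> \<le> lam n 1 \<and>
           (1 / real n) * (\<Sum>i\<in>{1..n}. 1 / (z - lam n i)) \<le> t)" if "G < ereal t" for t
      unfolding lam_def by (rule upper[OF that])
    show "p > 0" using i by simp
  qed (fact H \<alpha> \<beta>_bounds)+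
  define N where "N = {k\<in>{1..r}. G < ereal (1 / \<theta> k)}"
  \<comment> \<open>As \<open>G < 0\<close>, every positive \<open>\<theta> k\<close> satisfies
    \<open>G < 1 / \<theta> k\<close>, so \<open>N\<close> consists of the indices counted by
    \<open>s\<close> together with all positive ones. After the positive ones cancel in the inertia
    count, the shift is \<open>s\<close>.\<close>
  have N_card: "card N = s + card {l\<in>{1..r}. 0 < \<theta> l}"
  proof -
    have "G < ereal (1 / \<theta> k)" if "0 < \<theta> k" for k
    proof -
      have "0 < ereal (1 / \<theta> k)" using that by simp
      with \<open>G < 0\<close> show ?thesis by (rule less_trans)
    qed
    then have "N = {k\<in>{1..r}. \<theta> k < 0 \<and> G < ereal (1 / \<theta> k)} \<union> {l\<in>{1..r}. 0 < \<theta> l}"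
      using \<theta> by (force simp: N_def)
    then have "card N = card ({k\<in>{1..r}. \<theta> k < 0 \<and> G < ereal (1 / \<theta> k)} \<union> {l\<in>{1..r}. 0 < \<theta> l})" by (rule arg_cong)
    also have "\<dots> = s + card {l\<in>{1..r}. 0 < \<theta> l}" unfolding s_def by (rule card_Un_disjoint) auto
    finally show ?thesis .
  qed
  obtain v where v: "\<And>n. eigensystem n (X n) (lam n) (v n)"
    using hermitian_eigensystem[OF herm] unfolding lam_def by metis
  define vt where "vt = (\<lambda>n w. SOME v. eigensystem n (perturbed n (X n) r \<theta> (u n w)) (lamt n w) v)"
  have vt: "eigensystem n (perturbed n (X n) r \<theta> (u n w)) (lamt n w) (vt n w)" for n w
    unfolding vt_def lamt_def by (rule someI_ex[OF hermitian_eigensystem[OF hermitian_perturbed[OF herm]]])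
  have on: "orthonormal_sys n (v n) {1..n}" for n using v[of n] by (simp add: eigensystem_def)
  obtain \<epsilon> where \<epsilon>: "\<epsilon> > 0" and margin: "\<forall>\<^sub>F n in sequentially. \<forall>z. good n z \<longrightarrow> (\<forall>k\<in>{1..r}.
      (ereal (1 / \<theta> k) < G \<longrightarrow> 1 / \<theta> k + real r * \<epsilon> \<le> g n z) \<and> (G < ereal (1 / \<theta> k) \<longrightarrow> g n z + real r * \<epsilon> \<le> 1 / \<theta> k))"
    using common_margin[of "{1..r}" "\<lambda>k. 1 / \<theta> k" "real r"] G_ne r by auto
  \<comment> \<open>Here \<open>z\<close> is deterministic and the sum is polynomial in the entries,
    so, in contrast to events about \<open>lamt\<close>, these sets are shown to be
    measurable.\<close>
  define bad where "bad = (\<lambda>n z k l. {w \<in> space M. \<epsilon> \<le> cmod ((\<Sum>i<n. \<Sum>j<n. avg_resolvent n (lam n) (v n) z i j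
      * cnj (x n k i w) * x n l j w) - (if k = l then complex_of_real (g n z) else 0))})"
  define Bad where "Bad = (\<lambda>n z. \<Union>kl\<in>{1..r} \<times> {1..r}. bad n z (fst kl) (snd kl))"
  define hs where "hs = (\<lambda>n z. 1 / (real n)\<^sup>2 * (\<Sum>k\<in>{1..n}. 1 / (z - lam n k)\<^sup>2))"
  define bound where "bound = (\<lambda>n. (real r)\<^sup>2 * ((4 * \<kappa> + 4) * hs_bound n / \<epsilon>\<^sup>2))"
  have meas: "x n k j \<in> borel_measurable M" if "k \<in> {1..r}" "j < n" for n k j
    using iid_entries.measurable_entries[OF iid, of "(k, j)" n] that by simp
  have bad_sets: "bad n z k l \<in> sets M" if "k \<in> {1..r}" "l \<in> {1..r}" for n z k l
  proof -
    have cnj: "cnj \<in> borel_measurable borel"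
      by (intro borel_measurable_continuous_onI continuous_intros)
    have "(\<lambda>w. \<Sum>i<n. \<Sum>j<n. avg_resolvent n (lam n) (v n) z i j * cnj (x n k i w) * x n l j w) \<in> borel_measurable M"
      by (intro borel_measurable_sum borel_measurable_times measurable_compose[OF meas cnj]
            borel_measurable_const meas that) auto
    then show ?thesis unfolding bad_def by measurable
  qed
  have Bad_sets: "Bad n z \<in> sets M" for n z
    unfolding Bad_def by (rule sets.finite_UN) (auto intro: bad_sets)
  have Bad_measure: "measure M (Bad n z) \<le> (real r)\<^sup>2 * ((4 * \<kappa> + 4) * hs n z / \<epsilon>\<^sup>2)" for n z
  proof -
    have "measure M (Bad n z) \<le> (\<Sum>kl\<in>{1..r} \<times> {1..r}. measure M (bad n z (fst kl) (snd kl)))"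
      unfolding Bad_def by (rule measure_UNION_le) (auto intro: bad_sets)
    also have "\<dots> \<le> (\<Sum>kl\<in>{1..r} \<times> {1..r}. (4 * \<kappa> + 4) * hs n z / \<epsilon>\<^sup>2)"
    proof (rule sum_mono)
      fix kl assume "kl \<in> {1..r} \<times> {1..r}"
      then have kl: "fst kl \<in> {1..r}" "snd kl \<in> {1..r}" by auto
      show "measure M (bad n z (fst kl) (snd kl))
          \<le> (4 * \<kappa> + 4) * hs n z / \<epsilon>\<^sup>2"
        using quadratic_form_concentration[OF iid[of n] kl \<epsilon>, where A = "avg_resolvent n (lam n) (v n) z"]
        unfolding bad_def g_def hs_def avg_resolvent_trace[OF on] avg_resolvent_hs[OF on] by simp
    qed
    also have "\<dots> = (real r)\<^sup>2 * ((4 * \<kappa> + 4) * hs n z / \<epsilon>\<^sup>2)"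
      by (simp add: power2_eq_square)
    finally show ?thesis .
  qed
  have control: "\<forall>\<^sub>F n in sequentially. \<forall>z. good n z \<longrightarrow> measure M (Bad n z) \<le> bound n \<and>
      (\<forall>w\<in>space M - Bad n z. (z < lam n i \<longrightarrow> z \<le> lamt n w (s + i)) \<and> (lam n i < z \<longrightarrow> lamt n w (s + i) \<le> z))"
    using margin eventually_hs_le eventually_indices
  proof eventually_elim
    case (elim n)
    then have n: "0 < n" "p \<le> n" by auto
    show ?case
    proof (intro allI impI conjI ballI)
      fix z assume z: "good n z"
      have "hs n z \<le> hs_bound n" using elim z unfolding hs_def by blast
      then have "(real r)\<^sup>2 * ((4 * \<kappa> + 4) * hs n z / \<epsilon>\<^sup>2) \<le> bound n"
        unfolding bound_def using \<kappa> by (intro mult_left_mono divide_right_mono) auto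
      then show "measure M (Bad n z) \<le> bound n" using Bad_measure[of n z] by linarith
      fix w assume w: "w \<in> space M - Bad n z"
      have ne: "lam n k \<noteq> z" if "k \<in> {1..n}" for k
        using z \<delta>_pos[OF n(1)] that by (force simp: good_def)
      have close: "cmod (schur_entry n (lam n) (v n) (u n w) z k l - (if k = l then complex_of_real (g n z) else 0)) \<le> \<epsilon>"
        if kl: "k \<in> {1..r}" "l \<in> {1..r}" for k l
      proof -
        have "w \<notin> bad n z k l"
        proof
          assume "w \<in> bad n z k l"
          then have "w \<in> Bad n z" unfolding Bad_def using kl by (intro UN_I[of "(k, l)"]) auto
          then show False using w by blast
        qed
        then show ?thesis
          using w unfolding bad_def avg_resolvent_form[OF n(1)] schur_entry_def u_def by simp
      qed
      have above: "1 / \<theta> l + real r * \<epsilon> \<le> g n z" if "l \<in> {1..r}" "l \<notin> N" for l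
      proof -
        have "ereal (1 / \<theta> l) < G" using G_ne[OF that(1)] that by (auto simp: N_def)
        then show ?thesis using elim(1) z that(1) by blast
      qed
      have below: "g n z + real r * \<epsilon> \<le> 1 / \<theta> l" if "l \<in> N" for l
        using elim(1) z that unfolding N_def by blast
      have NN: "N \<subseteq> {1..r}" by (auto simp: N_def)
      have idx: "1 \<le> i" "i \<le> n" "s + i \<le> n" using i n by auto
      show "z \<le> lamt n w (s + i)" if "z < lam n i"
        by (rule perturbed_eigenvalue_ge[OF v vt ne \<theta> NN close above below idx(1,2) that N_card idx(3)])
      show "lamt n w (s + i) \<le> z" if "lam n i < z"
        by (rule perturbed_eigenvalue_le[OF v vt ne \<theta> NN close above below idx(1,2) that N_card idx(3)])
    qed
  qed
  \<comment> \<open>This is where \<open>s + i + r \<le> p\<close> is used: it gives a sure upper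
    bound by \<open>lam n p\<close> when there is no room for a good point between
    \<open>lam n i\<close> and \<open>lam n p\<close>.\<close>
  have interlace: "lamt n w (s + i) \<le> lam n p" if "p \<le> n" for n w
  proof -
    have "lamt n w (s + i) \<le> lam n (s + i + r)"
      by (rule perturbed_interlacing[OF v vt]) (use i that in auto)
    also have "\<dots> \<le> lam n p" using mono[of "s + i + r" p n] i that by auto
    finally show ?thesis .
  qed
  have "conv_prob_zero M (\<lambda>n w. real n powr (1 - \<alpha>') * (lamt n w (s + i) - lam n i))"
    unfolding conv_prob_zero_def
  proof (intro allI impI)
    fix e :: real assume e: "e > 0"
    let ?S = "\<lambda>n. {w \<in> space M. \<bar>real n powr (1 - \<alpha>') * (lamt n w (s + i) - lam n i)\<bar> > e}"
    have small: "\<forall>\<^sub>F n in sequentially. real n powr (1 - \<alpha>') * (2 * real p * \<delta> n) \<le> e"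
    proof -
      have "(\<lambda>n. 2 * real p * real n powr (\<beta> - \<alpha>')) \<longlonglongrightarrow> 0"
        using \<beta>_bounds by (intro tendsto_mult_right_zero tendsto_neg_powr filterlim_real_sequentially) auto
      then have "\<forall>\<^sub>F n in sequentially. 2 * real p * real n powr (\<beta> - \<alpha>') < e" using e by (rule order_tendstoD)
      then show ?thesis using eventually_gt_at_top[of 0]
      proof eventually_elim
        case (elim n)
        have "real n powr (1 - \<alpha>') * \<delta> n = real n powr (\<beta> - \<alpha>')"
          unfolding \<delta>_def by (simp add: powr_add[symmetric])
        then show ?case using elim(1) by (simp add: mult.left_commute)
      qed
    qed
    show "(\<lambda>n. measure M (?S n)) \<longlonglongrightarrow> 0"
    proof (rule tendsto_sandwich[where f = "\<lambda>_. 0" and h = "\<lambda>n. bound n + bound n"])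
      have "(\<lambda>n. (real r)\<^sup>2 * ((4 * \<kappa> + 4) * hs_bound n / \<epsilon>\<^sup>2)) \<longlonglongrightarrow> (real r)\<^sup>2 * ((4 * \<kappa> + 4) * 0 / \<epsilon>\<^sup>2)"
        by (intro tendsto_intros hs_bound_tendsto) (use \<epsilon> in auto)
      then have "bound \<longlonglongrightarrow> 0" by (simp add: bound_def)
      then show "(\<lambda>n. bound n + bound n) \<longlonglongrightarrow> 0" using tendsto_add_zero by blast
      show "\<forall>\<^sub>F n in sequentially. measure M (?S n) \<le> bound n + bound n"
        using control small eventually_indices
      proof eventually_elim
        case (elim n)
        then have n: "0 < n" "p \<le> n" by auto
        have ip: "i \<le> p" using i by simp
        define S where "S = ?S n"
        have S: "\<bar>lamt n w (s + i) - lam n i\<bar> > 2 * real p * \<delta> n" if "w \<in> S" for w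
        proof (rule ccontr)
          assume "\<not> ?thesis"
          then have "real n powr (1 - \<alpha>') * \<bar>lamt n w (s + i) - lam n i\<bar> \<le> real n powr (1 - \<alpha>') * (2 * real p * \<delta> n)"
            by (intro mult_left_mono) auto
          then show False using that elim(2) by (simp add: S_def abs_mult)
        qed
        obtain z1 where z1: "good n z1" "z1 < lam n i" "lam n i - 2 * real p * \<delta> n \<le> z1"
          using ex_good_below[OF i(1) ip n(2)] by blast
        have ge: "lam n i - 2 * real p * \<delta> n \<le> lamt n w (s + i)" if "w \<in> space M - Bad n z1" for w
          using elim(1) z1 that by force
        have b1: "measure M (Bad n z1) \<le> bound n" using elim(1) z1 by blast
        then have b0: "0 \<le> bound n" using measure_nonneg[of M "Bad n z1"] by linarith
        show "measure M S \<le> bound n + bound n"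
        proof (cases "lam n i + 2 * real p * \<delta> n \<le> lam n p")
          case True
          then obtain z2 where z2: "good n z2" "lam n i < z2" "z2 \<le> lam n i + 2 * real p * \<delta> n"
            using ex_good_above[OF i(1) ip n(2)] by blast
          have le: "lamt n w (s + i) \<le> lam n i + 2 * real p * \<delta> n" if "w \<in> space M - Bad n z2" for w
            using elim(1) z2 that by force
          have b2: "measure M (Bad n z2) \<le> bound n" using elim(1) z2 by blast
          have "S \<subseteq> Bad n z1 \<union> Bad n z2"
          proof
            fix w assume w: "w \<in> S"
            show "w \<in> Bad n z1 \<union> Bad n z2"
            proof (rule ccontr)
              assume "w \<notin> Bad n z1 \<union> Bad n z2"
              then show False using S[OF w] ge[of w] le[of w] w by (simp add: S_def)
            qed
          qed
          then have "measure M S \<le> measure M (Bad n z1 \<union> Bad n z2)"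
            by (rule measure_le_of_subset) (intro sets.Un Bad_sets)
          also have "\<dots> \<le> measure M (Bad n z1) + measure M (Bad n z2)"
            by (rule measure_Un_le) (rule Bad_sets)+
          finally show ?thesis using b1 b2 by linarith
        next
          case False
          have "S \<subseteq> Bad n z1"
          proof
            fix w assume w: "w \<in> S"
            show "w \<in> Bad n z1"
            proof (rule ccontr)
              assume "w \<notin> Bad n z1"
              then show False using S[OF w] ge[of w] interlace[OF n(2), of w] False w by (simp add: S_def)
            qed
          qed
          then have "measure M S \<le> measure M (Bad n z1)" by (rule measure_le_of_subset) (rule Bad_sets)
          then show ?thesis using b1 b0 by linarith
        qed
      qed
    qed auto
  qed
  then show ?thesis unfolding lamt_def u_def lam_def .
qed

section \<open>Both edges\<close>

lemma iid_entries_of_law: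
  assumes "prob_space M" and A1: "assumption_A1 \<nu>"
    and indep: "prob_space.indep_vars M (\<lambda>_. borel) X I"
    and law: "\<And>a. a \<in> I \<Longrightarrow> distr M borel (X a) = \<nu>"
  shows "iid_entries M X I (\<integral>t. (cmod t) ^ 4 \<partial>\<nu>)"
proof -
  interpret prob_space M by fact
  have rv: "X a \<in> M \<rightarrow>\<^sub>M borel" if "a \<in> I" for a
    using indep that by (simp add: indep_vars_def2)
  note \<nu> = A1[unfolded assumption_A1_def]
  have int: "integrable M (\<lambda>w. h (X a w))" if "a \<in> I" "integrable \<nu> h" for a and h :: "complex \<Rightarrow> real"
    using integrable_distr[OF rv[OF that(1)]] that(2) law[OF that(1)] by simp
  have expect: "(\<integral>w. h (X a w) \<partial>M) = (\<integral>t. h t \<partial>\<nu>)" if "a \<in> I" "h \<in> borel_measurable borel"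
    for a and h :: "complex \<Rightarrow> real"
    using integral_distr[OF rv[OF that(1)] that(2)] law[OF that(1)] by simp
  show ?thesis
  proof (intro iid_entries.intro iid_entries_axioms.intro)
    fix a assume a: "a \<in> I"
    show "expectation (X a) = 0" using integral_distr[OF rv[OF a], of "\<lambda>z. z"] law[OF a] \<nu> by simp
    show "expectation (\<lambda>w. (cmod (X a w))\<^sup>2) = 1" using expect[OF a, of "\<lambda>z. (cmod z)\<^sup>2"] \<nu> by simp
    show "integrable M (\<lambda>w. (cmod (X a w)) ^ 4)"
      using int[OF a, of "\<lambda>z. (cmod z) ^ 4"] log_sobolev_fourth_moment[OF A1] by simp
    show "expectation (\<lambda>w. (cmod (X a w)) ^ 4) \<le> (\<integral>t. (cmod t) ^ 4 \<partial>\<nu>)"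
      using expect[OF a, of "\<lambda>z. (cmod z) ^ 4"] by simp
  qed (fact assms)+
qed

lemma hermitian_uminus:
  assumes "hermitian_mat n X"
  shows "hermitian_mat n (mat n n (\<lambda>(i,j). - X $$ (i,j)))"
  unfolding hermitian_mat_def
proof (intro conjI allI impI)
  fix i j assume ij: "i < n" "j < n"
  then have "X $$ (i,j) = cnj (X $$ (j,i))" using assms unfolding hermitian_mat_def by blast
  then show "mat n n (\<lambda>(i,j). - X $$ (i,j)) $$ (i,j) = cnj (mat n n (\<lambda>(i,j). - X $$ (i,j)) $$ (j,i))"
    using ij by simp
qed simp

theorem theorem4p3:
  fixes M :: "'w measure"
    and \<nu> :: "complex measure"
    and x :: "nat \<Rightarrow> nat \<Rightarrow> nat \<Rightarrow> 'w \<Rightarrow> complex"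
    and X :: "nat \<Rightarrow> complex mat"
    and \<mu>X :: "real measure"
    and r :: nat and \<theta> :: "nat \<Rightarrow> real"
    and \<alpha> :: real and p q :: nat
  defines "a \<equiv> Inf (msupp \<mu>X)"
    and "b \<equiv> Sup (msupp \<mu>X)"
    and "lam \<equiv> (\<lambda>n i. ord_eig (X n) i)"
    and "lamt \<equiv> (\<lambda>n w i. ord_eig (perturbed n (X n) r \<theta>
                   (\<lambda>k l. x n k l w / complex_of_real (sqrt (real n)))) i)"
    and "pm \<equiv> card {k \<in> {1..r}. rho \<mu>X (\<theta> k) < Inf (msupp \<mu>X)}"
    and "pp \<equiv> card {k \<in> {1..r}. rho \<mu>X (\<theta> k) > Sup (msupp \<mu>X)}"
  assumes M: "prob_space M"
    (* (A1) *)
    and A1: "assumption_A1 \<nu>"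
    (* i.i.d. model *)
    and indep: "\<And>n. prob_space.indep_vars M (\<lambda>_. borel) (\<lambda>(k,l). x n k l) ({1..r} \<times> {..<n})"
    and law: "\<And>n k l. k \<in> {1..r} \<Longrightarrow> l < n \<Longrightarrow> distr M borel (x n k l) = \<nu>"
    (* perturbation parameters *)
    and r: "r \<ge> 1"
    and \<theta>_nz: "\<And>k. k \<in> {1..r} \<Longrightarrow> \<theta> k \<noteq> 0"
    and \<theta>_mono: "\<And>k l. 1 \<le> k \<Longrightarrow> k \<le> l \<Longrightarrow> l \<le> r \<Longrightarrow> \<theta> k \<le> \<theta> l"
    (* deterministic Hermitian matrices *)
    and herm: "\<And>n. hermitian_mat n (X n)"
    (* (H1) *)
    and \<mu>X_prob: "prob_space \<mu>X" and \<mu>X_sets: "sets \<mu>X = sets borel"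
    and \<mu>X_cpt: "compact (msupp \<mu>X)"
    and weak: "\<And>g :: real \<Rightarrow> real. continuous_on UNIV g \<Longrightarrow> bounded (range g) \<Longrightarrow>
       (\<lambda>n. (1 / real n) * (\<Sum>i\<in>{1..n}. g (lam n i))) \<longlonglongrightarrow> (\<integral>t. g t \<partial>\<mu>X)"
    and lam_min: "(\<lambda>n. lam n 1) \<longlonglongrightarrow> a"
    and lam_max: "(\<lambda>n. lam n n) \<longlonglongrightarrow> b"
    (* (A3) *)
    and A3: "\<And>k. k \<in> {1..r} \<Longrightarrow> \<theta> k \<noteq> theta_under \<mu>X \<and> \<theta> k \<noteq> theta_bar \<mu>X"
    and \<alpha>: "0 < \<alpha>" "\<alpha> < 1"
    and pq: "p > 0" "q > 0"
    (* (C1), (C2) of (H3)[p,alpha,a] *)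
    and H3a: "\<exists>m :: nat \<Rightarrow> nat. (\<forall>n. m n > 0) \<and> filterlim m at_top sequentially \<and>
        (\<exists>C. eventually (\<lambda>n. real (m n) \<le> C * real n powr \<alpha>) sequentially) \<and>
        Liminf sequentially (\<lambda>n. ereal ((1 / real n) *
            (\<Sum>i\<in>{m n + 1..n}. 1 / (lam n p - lam n i)))) \<ge> G_left \<mu>X \<and>
        (\<exists>\<eta>>0. eventually (\<lambda>n. (\<forall>i\<in>{m n + 1..n}. lam n p \<noteq> lam n i) \<and>
            (\<Sum>i\<in>{m n + 1..n}. 1 / (lam n p - lam n i)\<^sup>2) \<le> real n powr (2 - \<eta>)) sequentially)"
    (* (C1'), (C2') of (H3)[q,alpha,b] *)
    and H3b: "\<exists>m :: nat \<Rightarrow> nat. (\<forall>n. m n > 0) \<and> filterlim m at_top sequentially \<and>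
        (\<exists>C. eventually (\<lambda>n. real (m n) \<le> C * real n powr \<alpha>) sequentially) \<and>
        Limsup sequentially (\<lambda>n. ereal ((1 / real n) *
            (\<Sum>i\<in>{m n + 1..n}. 1 / (lam n (n - q + 1) - lam n (n - i + 1))))) \<le> G_right \<mu>X \<and>
        (\<exists>\<eta>>0. eventually (\<lambda>n. (\<forall>i\<in>{m n + 1..n}. lam n (n - q + 1) \<noteq> lam n (n - i + 1)) \<and>
            (\<Sum>i\<in>{m n + 1..n}. 1 / (lam n (n - q + 1) - lam n (n - i + 1))\<^sup>2)
              \<le> real n powr (2 - \<eta>)) sequentially)"
  shows "\<forall>\<alpha>'>\<alpha>.
     (\<forall>i. 1 \<le> i \<and> i \<le> p - (pm + r) \<longrightarrow>
        conv_prob_zero M (\<lambda>n w. real n powr (1 - \<alpha>') * (lamt n w (pm + i) - lam n i))) \<and>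
     (\<forall>j. j < q - (pp + r) \<longrightarrow>
        conv_prob_zero M (\<lambda>n w. real n powr (1 - \<alpha>') * (lamt n w (n - (pp + j)) - lam n (n - j))))"
proof (intro allI impI conjI)
  fix \<alpha>' assume \<alpha>': "\<alpha> < \<alpha>'"
  interpret prob_space M by (rule M)
  let ?a = "Inf (msupp \<mu>X)" and ?b = "Sup (msupp \<mu>X)"
  define \<kappa> where "\<kappa> = (\<integral>t. (cmod t) ^ 4 \<partial>\<nu>)"
  have \<kappa>: "0 \<le> \<kappa>" unfolding \<kappa>_def by (rule Bochner_Integration.integral_nonneg) simp
  have iid: "iid_entries M (\<lambda>(k,l). x n k l) ({1..r} \<times> {..<n}) \<kappa>" for n
    unfolding \<kappa>_def by (rule iid_entries_of_law[OF M A1 indep]) (use law in auto)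
  note bounds = msupp_bounds[OF \<mu>X_prob \<mu>X_sets \<mu>X_cpt]
  note rho = rho_position[OF \<mu>X_prob \<mu>X_sets \<mu>X_cpt \<theta>_nz]
  have pm: "pm = card {k\<in>{1..r}. \<theta> k < 0 \<and> G_left \<mu>X < ereal (1 / \<theta> k)}"
    unfolding pm_def by (rule arg_cong[where f = card]) (use rho(1) in auto)
  \<comment> \<open>The outliers above \<open>b\<close> are the outliers below \<open>- b\<close>
    for \<open>- \<theta>\<close> and the edge value \<open>- G_right\<close>.\<close>
  have pp: "pp = card {k\<in>{1..r}. - \<theta> k < 0 \<and> - G_right \<mu>X < ereal (1 / - \<theta> k)}"
  proof -
    have "- G_right \<mu>X < ereal (1 / - \<theta> k) \<longleftrightarrow> ereal (1 / \<theta> k) < G_right \<mu>X" for k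
      by (cases "G_right \<mu>X") auto
    then show ?thesis unfolding pp_def by (intro arg_cong[where f = card]) (use rho(2) in auto)
  qed
  show "conv_prob_zero M (\<lambda>n w. real n powr (1 - \<alpha>') * (lamt n w (pm + i) - lam n i))"
    if i: "1 \<le> i \<and> i \<le> p - (pm + r)" for i
  proof -
    interpret L: measure_above \<mu>X ?a
      using bounds \<mu>X_prob \<mu>X_sets by (simp add: measure_above_def measure_above_axioms_def)
    note Gl = G_left_eq_INF[OF L.measure_above_axioms]
    show ?thesis
      unfolding lamt_def lam_def pm
    proof (rule lower_edge_sticking[OF M iid \<kappa> r herm \<theta>_nz _ _ _ rho(3)])
      show "\<exists>z \<epsilon>. \<epsilon> > 0 \<and> (\<forall>\<^sub>F n in sequentially. z + \<epsilon> \<le> ord_eig (X n) 1 \<and>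
           (1 / real n) * (\<Sum>i\<in>{1..n}. 1 / (z - ord_eig (X n) i)) \<le> t)" if "G_left \<mu>X < ereal t" for t
        using L.averaged_kernel_bound[OF weak _ lam_min[unfolded a_def] that[unfolded Gl]]
          hermitian_ord_eig_mono[OF herm] unfolding lam_def by auto
      show "spectral_gap_hyp (\<lambda>n i. ord_eig (X n) i) (G_left \<mu>X) \<alpha> p"
        using H3a unfolding spectral_gap_hyp_def lam_def by blast
    qed (use rho A3 \<alpha> \<alpha>' i r pm in auto)
  qed
  show "conv_prob_zero M (\<lambda>n w. real n powr (1 - \<alpha>') * (lamt n w (n - (pp + j)) - lam n (n - j)))"
    if j: "j < q - (pp + r)" for j
  proof -
    let ?\<mu> = "distr \<mu>X borel uminus"
    define X' where "X' = (\<lambda>n. mat n n (\<lambda>(i,j). - X n $$ (i,j)))"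
    define lam' where "lam' = (\<lambda>n i. ord_eig (X' n) i)"
    let ?u = "\<lambda>n w k l. x n k l w / complex_of_real (sqrt (real n))"
    interpret R: measure_above ?\<mu> "- ?b" by (rule measure_above_reflect[OF \<mu>X_prob \<mu>X_sets bounds(3)])
    note Gr = G_right_eq_INF[OF \<mu>X_prob \<mu>X_sets bounds(3)]
    have herm': "hermitian_mat n (X' n)" for n unfolding X'_def by (rule hermitian_uminus[OF herm])
    have lam': "lam' n i = - lam n (Suc n - i)" if "i \<in> {1..n}" for n i
      unfolding lam'_def lam_def X'_def by (rule ord_eig_uminus[OF herm that])
    \<comment> \<open>The spectral measures of \<open>X'\<close> are the reflections of those of
      \<open>X\<close>, so they converge to the reflected limit law.\<close>
    have weak': "(\<lambda>n. (1 / real n) * (\<Sum>i\<in>{1..n}. h (lam' n i))) \<longlonglongrightarrow> (\<integral>t. h t \<partial>?\<mu>)"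
      if h: "continuous_on UNIV h" "bounded (range h)" for h :: "real \<Rightarrow> real"
    proof -
      have "(\<Sum>i\<in>{1..n}. h (lam' n i)) = (\<Sum>i\<in>{1..n}. h (- lam n i))" for n
      proof -
        have "(\<Sum>i\<in>{1..n}. h (lam' n i)) = (\<Sum>i\<in>{1..n}. (\<lambda>i. h (- lam n i)) (Suc n - i))"
          by (intro sum.cong refl) (simp add: lam')
        also have "\<dots> = (\<Sum>i\<in>{1..n}. h (- lam n i))" by (rule sum.reindex_bij_betw[OF bij_reflect])
        finally show ?thesis .
      qed
      moreover have "(\<lambda>n. (1 / real n) * (\<Sum>i\<in>{1..n}. h (- lam n i))) \<longlonglongrightarrow> (\<integral>t. h (- t) \<partial>\<mu>X)"
      proof (rule weak)
        show "continuous_on UNIV (\<lambda>t. h (- t))"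
          by (rule continuous_on_compose2[OF h(1)]) (auto intro!: continuous_intros)
        show "bounded (range (\<lambda>t. h (- t)))" by (rule bounded_subset[OF h(2)]) auto
      qed
      moreover have "(\<integral>t. h t \<partial>?\<mu>) = (\<integral>t. h (- t) \<partial>\<mu>X)"
        by (rule integral_distr[OF measurable_uminus_borel[OF \<mu>X_sets] borel_measurable_continuous_onI[OF h(1)]])
      ultimately show ?thesis by simp
    qed
    have lim': "(\<lambda>n. lam' n 1) \<longlonglongrightarrow> - ?b"
    proof (rule Lim_transform_eventually[OF tendsto_minus[OF lam_max[unfolded b_def]]])
      show "\<forall>\<^sub>F n in sequentially. - lam n n = lam' n 1"
        using eventually_gt_at_top[of 0] by eventually_elim (simp add: lam')
    qed
    \<comment> \<open>The offset \<open>j\<close> starts from 0 and eigenvalue indices from 1, hence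
      \<open>j + 1\<close>. Reflection takes \<open>pp + (j + 1)\<close> back to
      \<open>n - (pp + j)\<close>, and \<open>j < q - (pp + r)\<close> becomes
      \<open>pp + (j + 1) + r \<le> q\<close>.\<close>
    have "conv_prob_zero M (\<lambda>n w. real n powr (1 - \<alpha>') *
        (ord_eig (perturbed n (X' n) r (\<lambda>k. - \<theta> k) (?u n w)) (pp + (j + 1)) - ord_eig (X' n) (j + 1)))"
      unfolding pp
    proof (rule lower_edge_sticking[OF M iid \<kappa> r herm'])
      show "- \<theta> k \<noteq> 0" if "k \<in> {1..r}" for k using \<theta>_nz[OF that] by simp
      show "\<exists>z \<epsilon>. \<epsilon> > 0 \<and> (\<forall>\<^sub>F n in sequentially. z + \<epsilon> \<le> ord_eig (X' n) 1 \<and>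
           (1 / real n) * (\<Sum>i\<in>{1..n}. 1 / (z - ord_eig (X' n) i)) \<le> t)" if "- G_right \<mu>X < ereal t" for t
        using R.averaged_kernel_bound[OF weak' _ lim' that[unfolded Gr]]
          hermitian_ord_eig_mono[OF herm'] unfolding lam'_def by auto
      show "ereal (1 / - \<theta> k) \<noteq> - G_right \<mu>X" if "k \<in> {1..r}" for k
        using rho(6)[OF that] A3[OF that] by (cases "G_right \<mu>X") auto
      show "- G_right \<mu>X < 0" using rho(4)[of 1] r by (cases "G_right \<mu>X") auto
      show "card {k \<in> {1..r}. - \<theta> k < 0 \<and> - G_right \<mu>X < ereal (1 / - \<theta> k)} + (j + 1) + r \<le> q"
        using j unfolding pp[symmetric] by linarith
      show "spectral_gap_hyp (\<lambda>n i. ord_eig (X' n) i) (- G_right \<mu>X) \<alpha> q"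
      proof -
        from H3b obtain m C \<eta> where m: "filterlim m at_top sequentially"
          "\<forall>\<^sub>F n in sequentially. real (m n) \<le> C * real n powr \<alpha>" "\<eta> > 0"
          and ls: "Limsup sequentially (\<lambda>n. ereal ((1 / real n) *
            (\<Sum>i\<in>{m n + 1..n}. 1 / (lam n (n - q + 1) - lam n (n - i + 1))))) \<le> G_right \<mu>X"
          and sq: "\<forall>\<^sub>F n in sequentially. (\<forall>i\<in>{m n + 1..n}. lam n (n - q + 1) \<noteq> lam n (n - i + 1)) \<and>
            (\<Sum>i\<in>{m n + 1..n}. 1 / (lam n (n - q + 1) - lam n (n - i + 1))\<^sup>2) \<le> real n powr (2 - \<eta>)"
          by blast
        \<comment> \<open>Subtraction on naturals truncates, so \<open>n - q + 1\<close> is the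
          reflected index only for \<open>q \<le> n\<close>; hence the comparisons below hold
          eventually.\<close>
        have q: "lam' n q = - lam n (n - q + 1)" if "q \<le> n" for n
          using lam'[of q n] pq(2) that by (simp add: Suc_diff_le)
        have tl: "lam' n i = - lam n (n - i + 1)" if "i \<in> {m n + 1..n}" for n i
          using lam'[of i n] that by (simp add: Suc_diff_le)
        have diff: "lam' n q - lam' n i = - (lam n (n - q + 1) - lam n (n - i + 1))"
          if "q \<le> n" "i \<in> {m n + 1..n}" for n i
          using q[OF that(1)] tl[OF that(2)] by simp
        let ?d = "\<lambda>n i. lam n (n - q + 1) - lam n (n - i + 1)"
        let ?R = "\<lambda>n. ereal ((1 / real n) * (\<Sum>i\<in>{m n + 1..n}. 1 / ?d n i))"
        let ?L = "\<lambda>n. ereal ((1 / real n) * (\<Sum>i\<in>{m n + 1..n}. 1 / (lam' n q - lam' n i)))"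
        have ev_q: "\<forall>\<^sub>F n in sequentially. q \<le> n" by (rule eventually_ge_at_top)
        have "Liminf sequentially (\<lambda>n. ?L n) = Liminf sequentially (\<lambda>n. - ?R n)"
        proof (rule Liminf_eq)
          show "\<forall>\<^sub>F n in sequentially. ?L n = - ?R n"
            using ev_q
          proof eventually_elim
            case (elim n)
            have "(\<Sum>i\<in>{m n + 1..n}. 1 / (lam' n q - lam' n i))
               = (\<Sum>i\<in>{m n + 1..n}. - (1 / ?d n i))"
              by (intro sum.cong refl) (simp only: diff[OF elim] divide_minus_right)
            then show ?case by (simp add: sum_negf)
          qed
        qed
        also have "\<dots> = - Limsup sequentially (\<lambda>n. ?R n)" by (rule ereal_Liminf_uminus)
        finally have li: "- G_right \<mu>X \<le> Liminf sequentially (\<lambda>n. ?L n)"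
          using ls by (simp only: ereal_minus_le_minus)
        have "\<forall>\<^sub>F n in sequentially. (\<forall>i\<in>{m n + 1..n}. lam' n q \<noteq> lam' n i) \<and>
            (\<Sum>i\<in>{m n + 1..n}. 1 / (lam' n q - lam' n i)\<^sup>2) \<le> real n powr (2 - \<eta>)"
          using sq ev_q
        proof eventually_elim
          case (elim n)
          have "(\<Sum>i\<in>{m n + 1..n}. 1 / (lam' n q - lam' n i)\<^sup>2)
             = (\<Sum>i\<in>{m n + 1..n}. 1 / (?d n i)\<^sup>2)"
            by (intro sum.cong refl) (simp only: diff[OF elim(2)] power2_minus)
          moreover have "lam' n q \<noteq> lam' n i" if i: "i \<in> {m n + 1..n}" for i
            using elim(1) i q[OF elim(2)] tl[OF i] by auto
          ultimately show ?case using elim(1) by simp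
        qed
        with m li show ?thesis unfolding spectral_gap_hyp_def lam'_def by blast
      qed
    qed (use \<alpha> \<alpha>' in auto)
    then show ?thesis
    proof (rule conv_prob_zero_cong)
      have "\<forall>\<^sub>F n in sequentially. q \<le> n" by (rule eventually_ge_at_top)
      then show "\<forall>\<^sub>F n in sequentially. \<forall>w\<in>space M.
        \<bar>real n powr (1 - \<alpha>') * (ord_eig (perturbed n (X' n) r (\<lambda>k. - \<theta> k) (?u n w)) (pp + (j + 1)) - ord_eig (X' n) (j + 1))\<bar>
        = \<bar>real n powr (1 - \<alpha>') * (lamt n w (n - (pp + j)) - lam n (n - j))\<bar>"
      proof eventually_elim
        case (elim n)
        have idx: "j + 1 \<in> {1..n}" "pp + (j + 1) \<in> {1..n}" using j elim by auto
        have "ord_eig (X' n) (j + 1) = - lam n (n - j)"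
          using lam'[OF idx(1)] by (simp add: lam'_def)
        moreover have "ord_eig (perturbed n (X' n) r (\<lambda>k. - \<theta> k) (?u n w)) (pp + (j + 1)) = - lamt n w (n - (pp + j))" for w
        proof -
          have "X n \<in> carrier_mat n n" using herm[of n] by (simp add: hermitian_mat_def)
          from perturbed_uminus[OF this, of r \<theta> "?u n w"]
          have "ord_eig (perturbed n (X' n) r (\<lambda>k. - \<theta> k) (?u n w)) (pp + (j + 1))
            = - ord_eig (perturbed n (X n) r \<theta> (?u n w)) (Suc n - (pp + (j + 1)))"
            unfolding X'_def using ord_eig_uminus[OF hermitian_perturbed[OF herm] idx(2), of r \<theta> "?u n w"] by simp
          then show ?thesis by (simp add: lamt_def)
        qed
        ultimately show ?case by (simp add: abs_mult abs_minus_commute)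
      qed
    qed
  qed
qed

end
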